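(* Let $\mathbb{E}_3(n)$ denote the expected number of subsquares of order $3$ in a random Latin square of order $n$. Then, as $n\to\infty$, \[ \mathbb{E}_3(n)\ge \frac{1}{219006}-o(1). \]
   Context: A Latin square of order $n$ is an $n\times n$ matrix filled with symbols from $[n]=\{1,\dots,n\}$ with no symbol repeated in any row or column. A subsquare of order $a$ of a Latin square $L$ is an $a\times a$ submatrix of $L$ (determined by a set of $a$ rows and a set of $a$ columns, not necessarily contiguous) that is itself a Latin square, i.e. contains exactly $a$ distinct symbols. A random Latin square of order $n$ is chosen uniformly from all Latin squares of order $n$. The term $o(1)$ tends to $0$ as $n\to\infty$. *)

theory Defs
  imports "HOL-Probability.Probability" "HOL-Library.Landau_Symbols"
begin

text \<open>A matrix of order \<open>n\<close> is an extensional function on \<open>{1..n}\<close> in each index, so that every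
  Latin square is represented by exactly one element of this set and counting is meaningful.\<close>

definition latin_squares :: "nat \<Rightarrow> (nat \<Rightarrow> nat \<Rightarrow> nat) set" where
  "latin_squares n = {L \<in> {1..n} \<rightarrow>\<^sub>E {1..n} \<rightarrow>\<^sub>E {1..n}.
     (\<forall>i\<in>{1..n}. inj_on (\<lambda>j. L i j) {1..n}) \<and>
     (\<forall>j\<in>{1..n}. inj_on (\<lambda>i. L i j) {1..n})}"

definition subsquares :: "nat \<Rightarrow> nat \<Rightarrow> (nat \<Rightarrow> nat \<Rightarrow> nat) \<Rightarrow> (nat set \<times> nat set) set" where
  "subsquares n a L = {(R, C). R \<subseteq> {1..n} \<and> C \<subseteq> {1..n} \<and> card R = a \<and> card C = a \<and>
     card {L i j | i j. i \<in> R \<and> j \<in> C} = a}"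

definition random_latin_square :: "nat \<Rightarrow> (nat \<Rightarrow> nat \<Rightarrow> nat) pmf" where
  "random_latin_square n = pmf_of_set (latin_squares n)"

definition expected_subsquares :: "nat \<Rightarrow> nat \<Rightarrow> real" where
  "expected_subsquares a n =
     measure_pmf.expectation (random_latin_square n) (\<lambda>L. real (card (subsquares n a L)))"

text \<open>\<^const>\<open>pmf_of_set\<close> is the uniform distribution only on finite nonempty sets.\<close>

lemma finite_latin_squares: "finite (latin_squares n)"
proof -
  have "finite ({1..n} \<rightarrow>\<^sub>E {1..n} \<rightarrow>\<^sub>E {1..n})"
    by (intro finite_PiE) auto
  then show ?thesis
    unfolding latin_squares_def by (rule rev_finite_subset) auto
qed

lemma mod_cancel_interval:
  fixes x y k n :: nat
  assumes "(x + k) mod n = (y + k) mod n" "x \<in> {1..n}" "y \<in> {1..n}"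
  shows "x = y"
proof -
  have *: "u = v" if uv: "(u + k) mod n = (v + k) mod n" "v \<le> u" "u \<le> n" "1 \<le> v" for u v :: nat
  proof -
    have "n dvd (u + k) - (v + k)"
      using uv by (metis mod_eq_dvd_iff_nat add_le_mono1)
    then have "n dvd u - v" by simp
    moreover have "u - v < n" using uv by auto
    ultimately show ?thesis using uv(2) by (auto dest: dvd_imp_le)
  qed
  show ?thesis
    using *[of x y] *[of y x] assms by (cases "y \<le> x") auto
qed

lemma latin_squares_nonempty: "latin_squares n \<noteq> {}"
proof -
  define L where "L = (\<lambda>i\<in>{1..n}. \<lambda>j\<in>{1..n}. Suc ((i + j) mod n))"
  have "L \<in> {1..n} \<rightarrow>\<^sub>E {1..n} \<rightarrow>\<^sub>E {1..n}"
    unfolding L_def by (auto simp: PiE_iff Suc_le_eq)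
  moreover have "inj_on (\<lambda>j. L i j) {1..n}" if "i \<in> {1..n}" for i
    using that by (auto simp: L_def inj_on_def add.commute[of i] intro: mod_cancel_interval)
  moreover have "inj_on (\<lambda>i. L i j) {1..n}" if "j \<in> {1..n}" for j
    using that by (auto simp: L_def inj_on_def intro: mod_cancel_interval)
  ultimately have "L \<in> latin_squares n"
    unfolding latin_squares_def by blast
  then show ?thesis by blast
qed

lemma expected_subsquares_eq_average:
  "expected_subsquares a n =
     (\<Sum>L\<in>latin_squares n. real (card (subsquares n a L))) / real (card (latin_squares n))"
  unfolding expected_subsquares_def random_latin_square_def
  by (rule integral_pmf_of_set[OF latin_squares_nonempty finite_latin_squares])

end

theory Submission
  imports Defs
begin

text \<open>
  A subsquare of order 3 is built cell by cell. Each of the nine cells should be completed with probability of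
  order \<open>1/n\<close>, given the cells before it; this is immediate for all but three cells. To bring a symbol \<open>s\<close>
  into the cell \<open>(r, c)\<close>, either switch rows \<open>r\<close> and \<open>p\<close> on the cycle through column \<open>c\<close>, where \<open>p\<close>
  is the row with \<open>s\<close> in column \<open>c\<close>, or exchange the entries of row \<open>r\<close> in column \<open>c\<close> and in the
  column of \<open>s\<close> and repair the two other rows that are affected. The second switching can be undone
  knowing only the two columns, unless it creates an intercalate through \<open>(r, c)\<close>; then one of \<open>n\<close> rows must
  be remembered too. Since the other intercalates through \<open>(r, c)\<close> are visible before the exchange, a bound for
  the expected number of such virtual intercalates and the Cauchy-Schwarz inequality show that this loses
  only a constant factor. The factors are \<open>9.3\<close>, \<open>9.3\<close> and about \<open>114\<close>, and \<open>18 \<cdot> 9.3\<^sup>2 \<cdot> 114 < 219006\<close>.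
\<close>

section \<open>Cycles and arcs of two bijections\<close>

text \<open>The three hard cells are the last cell of a 3-cycle between two columns and, after
  transposition, the second and third cells of the third row. The cycle switch fails exactly when a
  prescribed column of row \<open>r\<close> lies on the cycle through \<open>c\<close>. With one
  prescribed column the virtual intercalates can be bounded directly. The third cell has two
  prescribed columns, which causes two new difficulties. Both may lie on the cycle through
  \<open>c\<close>; a column switch shows that at least half of the squares have them on different
  cycles, and only these are used. Moreover, removing a virtual intercalate may carry one prescribed
  entry into another row, so that the third row of the pattern is spread over two rows. Such squares
  are compared with squares having two completed cells by a cyclic relabelling of the columns and
  symbols, so the last comparison is made for the sum over all choices of rows, columns and symbols.
  A further obstruction to the exchange, a fixed row among the two rows to be repaired, is shown to
  occur with small probability.\<close>

lemma card_le_inverse: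
  assumes "finite U" "\<And>x. x \<in> T \<Longrightarrow> f x \<in> U" "\<And>x. x \<in> T \<Longrightarrow> h (f x) = x"
  shows "card T \<le> card U"
proof (rule card_inj_on_le[of f])
  show "inj_on f T" using assms(3) by (metis inj_onI)
qed (use assms in auto)

definition stable :: "nat set \<Rightarrow> (nat \<Rightarrow> nat) \<Rightarrow> (nat \<Rightarrow> nat) \<Rightarrow> nat set \<Rightarrow> bool" where
  "stable S f g W \<longleftrightarrow> W \<subseteq> S \<and> f ` W = g ` W"

text \<open>For bijections this is the orbit of \<open>c\<close> under
  \<open>inv_into S f \<circ> g\<close>. Described as a least set with equal images it is symmetric
  in \<open>f\<close> and \<open>g\<close> and needs no starting point or direction.\<close>

definition cycle :: "nat set \<Rightarrow> (nat \<Rightarrow> nat) \<Rightarrow> (nat \<Rightarrow> nat) \<Rightarrow> nat \<Rightarrow> nat set" where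
  "cycle S f g c = \<Inter>{W. stable S f g W \<and> c \<in> W}"

text \<open>For bijections and distinct \<open>c\<close>, \<open>d\<close>, the map
  \<open>inv_into S f \<circ> g\<close> takes \<open>insert c W\<close> onto
  \<open>insert d W\<close>. So \<open>W\<close> consists of the points strictly between
  \<open>c\<close> and \<open>d\<close> on their common orbit, possibly together with further
  complete orbits.\<close>

definition half_stable :: "nat set \<Rightarrow> (nat \<Rightarrow> nat) \<Rightarrow> (nat \<Rightarrow> nat) \<Rightarrow> nat \<Rightarrow> nat \<Rightarrow> nat set \<Rightarrow> bool" where
  "half_stable S f g c d W \<longleftrightarrow> W \<subseteq> S - {c, d} \<and> g ` insert c W = f ` insert d W"

definition arc :: "nat set \<Rightarrow> (nat \<Rightarrow> nat) \<Rightarrow> (nat \<Rightarrow> nat) \<Rightarrow> nat \<Rightarrow> nat \<Rightarrow> nat set" where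
  "arc S f g c d = \<Inter>{W. half_stable S f g c d W}"

locale two_bij =
  fixes S :: "nat set" and f g :: "nat \<Rightarrow> nat"
  assumes fin: "finite S" and f: "bij_betw f S S" and g: "bij_betw g S S"
begin

lemma injf: "inj_on f S" and injg: "inj_on g S"
  using f g by (auto simp: bij_betw_def)

lemma stable_S: "stable S f g S"
  using f g by (simp add: stable_def bij_betw_def)

lemma stable_Int: "stable S f g V \<Longrightarrow> stable S f g W \<Longrightarrow> stable S f g (V \<inter> W)"
  by (simp add: stable_def inj_on_image_Int[OF injf] inj_on_image_Int[OF injg] le_infI1)

lemma stable_Diff: "stable S f g V \<Longrightarrow> stable S f g W \<Longrightarrow> stable S f g (V - W)"
  by (simp add: stable_def inj_on_image_set_diff[OF injf, of V W] inj_on_image_set_diff[OF injg, of V W] Diff_subset_conv le_supI2)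

lemma cycle_eq:
  assumes "c \<in> S" shows "stable S f g (cycle S f g c)" "c \<in> cycle S f g c"
proof -
  let ?X = "{W. stable S f g W \<and> c \<in> W}"
  have fX: "finite ?X" by (rule finite_subset[of _ "Pow S"]) (use fin in \<open>auto simp: stable_def\<close>)
  have "S \<in> ?X" using stable_S assms by auto
  then have ne: "?X \<noteq> {}" by blast
  have "Y \<noteq> {} \<Longrightarrow> Y \<subseteq> ?X \<Longrightarrow> \<Inter>Y \<in> ?X" if "finite Y" for Y
    using that
  proof (induction Y rule: finite_induct)
    case (insert W Y)
    show ?case
    proof (cases "Y = {}")
      case False
      then have "\<Inter>Y \<in> ?X" using insert by auto
      then show ?thesis using insert.prems stable_Int[of W "\<Inter>Y"] by auto
    qed (use insert in auto)
  qed auto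
  from this[OF fX ne] have "cycle S f g c \<in> ?X" by (simp add: cycle_def)
  then show "stable S f g (cycle S f g c)" "c \<in> cycle S f g c" by auto
qed

lemma cycle_subset: "stable S f g W \<Longrightarrow> c \<in> W \<Longrightarrow> cycle S f g c \<subseteq> W"
  by (auto simp: cycle_def)

lemma cycle_S: "c \<in> S \<Longrightarrow> cycle S f g c \<subseteq> S"
  using cycle_subset[OF stable_S] .

lemma cycle_disjoint:
  assumes "c \<in> S" "d \<in> S" "d \<notin> cycle S f g c"
  shows "cycle S f g c \<inter> cycle S f g d = {}"
  using cycle_subset[OF stable_Diff[OF stable_S cycle_eq(1)[OF assms(1)]], of d] assms by auto

lemma half_stable_Int:
  assumes "half_stable S f g c d V" "half_stable S f g c d W" "c \<in> S" "d \<in> S"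
  shows "half_stable S f g c d (V \<inter> W)"
proof -
  have sub: "insert c V \<subseteq> S" "insert c W \<subseteq> S" "insert d V \<subseteq> S" "insert d W \<subseteq> S"
    using assms by (auto simp: half_stable_def)
  have "g ` insert c (V \<inter> W) = g ` (insert c V \<inter> insert c W)" by simp
  also have "\<dots> = g ` insert c V \<inter> g ` insert c W" by (rule inj_on_image_Int[OF injg sub(1,2)])
  also have "\<dots> = f ` insert d V \<inter> f ` insert d W" using assms by (simp only: half_stable_def)
  also have "\<dots> = f ` (insert d V \<inter> insert d W)" by (rule inj_on_image_Int[OF injf sub(3,4), symmetric])
  also have "\<dots> = f ` insert d (V \<inter> W)" by simp
  finally show ?thesis using assms unfolding half_stable_def by blast
qed

text \<open>Intersecting the defining equation with \<open>W\<close> leaves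
  \<open>card (V \<inter> W) + 1\<close> elements on the side of \<open>c\<close>; the other side
  reaches this number only if \<open>d\<close> is in \<open>W\<close>.\<close>

lemma half_stable_stable:
  assumes "half_stable S f g c d V" "stable S f g W" "c \<in> W" "c \<in> S" "d \<in> S"
  shows "d \<in> W" "half_stable S f g c d (V \<inter> W)"
proof -
  have sub: "insert c V \<subseteq> S" "insert d V \<subseteq> S" "W \<subseteq> S"
    using assms by (auto simp: half_stable_def stable_def)
  have "g ` insert c (V \<inter> W) = g ` (insert c V \<inter> W)" using assms(3) by simp
  also have "\<dots> = g ` insert c V \<inter> g ` W" by (rule inj_on_image_Int[OF injg sub(1,3)])
  also have "\<dots> = f ` insert d V \<inter> f ` W" using assms by (simp only: half_stable_def stable_def)
  also have "\<dots> = f ` (insert d V \<inter> W)" by (rule inj_on_image_Int[OF injf sub(2,3), symmetric])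
  finally have eq: "g ` insert c (V \<inter> W) = f ` (insert d V \<inter> W)" .
  have fV: "finite (V \<inter> W)" using fin assms(2) by (auto simp: stable_def intro: finite_subset)
  show "d \<in> W"
  proof (rule ccontr)
    assume d: "d \<notin> W"
    have "inj_on g (insert c (V \<inter> W))" by (rule inj_on_subset[OF injg]) (use sub in auto)
    then have "card (g ` insert c (V \<inter> W)) = card (insert c (V \<inter> W))" by (rule card_image)
    also have "\<dots> = Suc (card (V \<inter> W))" using fV assms(1) by (subst card_insert_disjoint) (auto simp: half_stable_def)
    finally have "card (g ` insert c (V \<inter> W)) = Suc (card (V \<inter> W))" .
    moreover have "card (f ` (insert d V \<inter> W)) \<le> card (V \<inter> W)"
      using d fV card_image_le[of "V \<inter> W" f] by (simp add: Int_insert_left)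
    ultimately show False using eq by simp
  qed
  then show "half_stable S f g c d (V \<inter> W)" using eq assms by (auto simp: half_stable_def Int_insert_left)
qed

lemma half_stable_arc:
  assumes "half_stable S f g c d W0" "c \<in> S" "d \<in> S"
  shows "half_stable S f g c d (arc S f g c d)"
proof -
  let ?X = "{W. half_stable S f g c d W}"
  have fX: "finite ?X" by (rule finite_subset[of _ "Pow S"]) (use fin in \<open>auto simp: half_stable_def\<close>)
  have ne: "?X \<noteq> {}" using assms by blast
  have "Y \<noteq> {} \<Longrightarrow> Y \<subseteq> ?X \<Longrightarrow> \<Inter>Y \<in> ?X" if "finite Y" for Y
    using that
  proof (induction Y rule: finite_induct)
    case (insert W Y)
    show ?case
    proof (cases "Y = {}")
      case False
      then have "\<Inter>Y \<in> ?X" using insert by auto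
      then show ?thesis using insert.prems half_stable_Int[of c d W "\<Inter>Y"] assms by auto
    qed (use insert in auto)
  qed auto
  from this[OF fX ne] show ?thesis by (simp add: arc_def)
qed

lemma arc_subset: "half_stable S f g c d W \<Longrightarrow> arc S f g c d \<subseteq> W"
  by (auto simp: arc_def)

text \<open>The witness is the set of iterates of \<open>c\<close> under
  \<open>inv_into S f \<circ> g\<close> strictly before the first arrival at
  \<open>d\<close>.\<close>

lemma half_stable_exists:
  assumes "c \<in> S" "c \<noteq> d" "d \<in> cycle S f g c"
  shows "\<exists>W. half_stable S f g c d W"
proof -
  define h where "h = inv_into S f \<circ> g"
  have hb: "bij_betw h S S"
    unfolding h_def using bij_betw_trans[OF g bij_betw_inv_into[OF f]] .
  have fh: "f (h j) = g j" if "j \<in> S" for j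
    using that f g by (simp add: h_def bij_betw_def f_inv_into_f) (metis f_inv_into_f image_eqI)
  have hk: "(h ^^ k) c \<in> S" for k
    using hb assms(1) by (induction k) (auto simp: bij_betw_def)
  let ?O = "range (\<lambda>k. (h ^^ k) c)"
  have OS: "?O \<subseteq> S" using hk by auto
  have "h ` ?O \<subseteq> ?O"
  proof
    fix y assume "y \<in> h ` ?O"
    then obtain k where "y = (h ^^ Suc k) c" by auto
    then show "y \<in> ?O" by blast
  qed
  moreover have "finite ?O" using OS fin finite_subset by blast
  moreover have "inj_on h ?O" using hb OS by (meson bij_betw_def inj_on_subset)
  ultimately have hO: "h ` ?O = ?O" by (simp add: endo_inj_surj)
  have "g ` ?O = f ` h ` ?O" using fh OS by (auto simp: image_image subset_iff)
  then have "stable S f g ?O" using OS hO by (simp add: stable_def)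
  moreover have "c \<in> ?O" by (metis funpow_0 rangeI)
  ultimately have "d \<in> ?O" using cycle_subset assms(3) by blast
  then obtain k0 where "(h ^^ k0) c = d" by auto
  define k where "k = (LEAST k. (h ^^ k) c = d)"
  have kd: "(h ^^ k) c = d" unfolding k_def using \<open>(h ^^ k0) c = d\<close> by (rule LeastI)
  have kmin: "(h ^^ i) c \<noteq> d" if "i < k" for i using that not_less_Least k_def by blast
  have k0: "k > 0" using kd assms(2) by (cases k) auto
  define W where "W = (\<lambda>i. (h ^^ i) c) ` {1..<k}"
  have cW: "c \<notin> W"
  proof
    assume "c \<in> W"
    then obtain i where i: "1 \<le> i" "i < k" "(h ^^ i) c = c" by (auto simp: W_def)
    \<comment> \<open>A return to \<open>c\<close> at time \<open>i\<close> would let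
      \<open>d\<close> be reached already at time \<open>k - i\<close>.\<close>
    have "(h ^^ (k - i + i)) c = (h ^^ (k - i)) c"
      using i(3) by (simp only: funpow_add o_apply)
    then show False using kd kmin[of "k - i"] i by simp
  qed
  have dW: "d \<notin> W" using kmin by (fastforce simp: W_def)
  have insc: "insert c W = (\<lambda>i. (h ^^ i) c) ` {0..<k}"
  proof -
    have "{0..<k} = insert 0 {1..<k}" using k0 by auto
    then show ?thesis by (simp add: W_def)
  qed
  have insd: "insert d W = (\<lambda>i. (h ^^ i) c) ` {1..<Suc k}"
  proof -
    have "{1..<Suc k} = insert k {1..<k}" using k0 by auto
    then show ?thesis by (simp add: W_def kd)
  qed
  have "h ` insert c W = (\<lambda>i. (h ^^ Suc i) c) ` {0..<k}"
    unfolding insc by (simp add: image_image)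
  also have "\<dots> = (\<lambda>i. (h ^^ i) c) ` Suc ` {0..<k}" by (simp only: image_image)
  also have "\<dots> = insert d W" unfolding insd by simp
  finally have "h ` insert c W = insert d W" .
  moreover have "g ` insert c W = f ` h ` insert c W"
    using fh hk insc by (auto simp: image_image)
  moreover have "W \<subseteq> S - {c, d}" using cW dW hk unfolding W_def by blast
  ultimately have "half_stable S f g c d W" by (simp only: half_stable_def)
  then show ?thesis ..
qed

lemma arc_half_stable:
  assumes "c \<in> S" "c \<noteq> d" "d \<in> cycle S f g c"
  shows "half_stable S f g c d (arc S f g c d)"
  using half_stable_exists[OF assms] half_stable_arc assms cycle_S by blast

lemma arc_cycle:
  assumes "c \<in> S" "c \<noteq> d" "d \<in> cycle S f g c"
  shows "arc S f g c d \<subseteq> cycle S f g c"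
  using arc_subset half_stable_stable(2)[OF arc_half_stable[OF assms] cycle_eq(1) cycle_eq(2)] assms cycle_S by blast

end

lemma stable_commute: "stable S f g W = stable S g f W"
  by (auto simp: stable_def)

lemma cycle_commute: "cycle S f g c = cycle S g f c"
  unfolding cycle_def stable_commute[of S f g] ..

lemma finite_onto_bij: "finite S \<Longrightarrow> h ` S = S \<Longrightarrow> bij_betw h S S"
  by (simp add: bij_betw_def eq_card_imp_inj_on)

section \<open>Switching two bijections along a stable set or an arc\<close>

context two_bij
begin

lemma switch_bij:
  assumes "stable S f g W"
  shows "bij_betw (\<lambda>j. if j \<in> W then g j else f j) S S"
proof (rule finite_onto_bij[OF fin])
  have W: "W \<subseteq> S" "f ` W = g ` W" using assms by (auto simp: stable_def)
  have "(\<lambda>j. if j \<in> W then g j else f j) ` S = g ` W \<union> f ` (S - W)" using W(1) by auto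
  also have "\<dots> = f ` S" using W by (metis Un_Diff_cancel image_Un sup.absorb_iff2)
  finally show "(\<lambda>j. if j \<in> W then g j else f j) ` S = S" using f by (simp add: bij_betw_def)
qed

lemma switch_stable:
  assumes "stable S f g W" "stable S f g V"
  shows "stable S (\<lambda>j. if j \<in> W then g j else f j) (\<lambda>j. if j \<in> W then f j else g j) V"
proof -
  have 1: "f ` (V \<inter> W) = g ` (V \<inter> W)" "f ` (V - W) = g ` (V - W)"
    using stable_Int[OF assms(2,1)] stable_Diff[OF assms(2,1)] by (auto simp: stable_def)
  have "(\<lambda>j. if j \<in> W then g j else f j) ` V = g ` (V \<inter> W) \<union> f ` (V - W)" by auto
  moreover have "(\<lambda>j. if j \<in> W then f j else g j) ` V = f ` (V \<inter> W) \<union> g ` (V - W)" by auto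
  ultimately show ?thesis using 1 assms(2) by (simp add: stable_def)
qed

text \<open>The first row gives up \<open>f d\<close> and receives \<open>g c\<close> in column
  \<open>d\<close>, the second gives up \<open>g c\<close> and receives \<open>f d\<close> in column
  \<open>c\<close>. Interchanging the rows on the arc removes the repetitions that this
  creates.\<close>

definition arc_f :: "nat \<Rightarrow> nat \<Rightarrow> nat \<Rightarrow> nat" where
  "arc_f c d = (\<lambda>j. if j = d then g c else if j \<in> arc S f g c d then g j else f j)"

definition arc_g :: "nat \<Rightarrow> nat \<Rightarrow> nat \<Rightarrow> nat" where
  "arc_g c d = (\<lambda>j. if j = c then f d else if j \<in> arc S f g c d then f j else g j)"

context
  fixes c d :: nat
  assumes cd: "c \<in> S" "c \<noteq> d" "d \<in> cycle S f g c"
begin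

lemma arc_facts: "d \<in> S" "arc S f g c d \<subseteq> S" "c \<notin> arc S f g c d" "d \<notin> arc S f g c d"
  "g ` insert c (arc S f g c d) = f ` insert d (arc S f g c d)"
  using arc_half_stable[OF cd] cycle_S[OF cd(1)] cd by (auto simp: half_stable_def)

lemma arc_f_image:
  assumes "insert d (arc S f g c d) \<subseteq> W"
  shows "arc_f c d ` W = f ` W"
proof -
  let ?F = "arc S f g c d"
  have "arc_f c d ` W = arc_f c d ` insert d ?F \<union> arc_f c d ` (W - insert d ?F)" using assms by blast
  also have "arc_f c d ` insert d ?F = g ` insert c ?F"
    using arc_facts by (auto simp: arc_f_def image_iff)
  also have "arc_f c d ` (W - insert d ?F) = f ` (W - insert d ?F)" by (auto simp: arc_f_def)
  also have "g ` insert c ?F \<union> f ` (W - insert d ?F) = f ` W"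
    unfolding arc_facts(5) using assms by blast
  finally show ?thesis .
qed

lemma arc_g_image:
  assumes "insert c (arc S f g c d) \<subseteq> W"
  shows "arc_g c d ` W = g ` W"
proof -
  let ?F = "arc S f g c d"
  have "arc_g c d ` W = arc_g c d ` insert c ?F \<union> arc_g c d ` (W - insert c ?F)" using assms by blast
  also have "arc_g c d ` insert c ?F = f ` insert d ?F"
    using arc_facts by (auto simp: arc_g_def image_iff)
  also have "arc_g c d ` (W - insert c ?F) = g ` (W - insert c ?F)" by (auto simp: arc_g_def)
  also have "f ` insert d ?F \<union> g ` (W - insert c ?F) = g ` W"
    unfolding arc_facts(5)[symmetric] using assms by blast
  finally show ?thesis .
qed

lemma arc_switch_two_bij: "two_bij S (arc_f c d) (arc_g c d)"
proof
  show "finite S" by (rule fin)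
  have "arc_f c d ` S = S" using arc_f_image[of S] arc_facts f by (simp add: bij_betw_def)
  then show "bij_betw (arc_f c d) S S" by (rule finite_onto_bij[OF fin])
  have "arc_g c d ` S = S" using arc_g_image[of S] arc_facts cd(1) g by (simp add: bij_betw_def)
  then show "bij_betw (arc_g c d) S S" by (rule finite_onto_bij[OF fin])
qed

text \<open>On subsets of the arc, half-stability for the new pair is the old equation with its
  sides interchanged. The unchanged arc makes the switch an involution; the inclusions of cycles
  tell which columns a later cycle switch can touch.\<close>

lemma arc_switch_invariant:
  shows "arc S (arc_f c d) (arc_g c d) c d = arc S f g c d" (is ?A)
    and "insert c (insert d (arc S f g c d)) \<subseteq> cycle S (arc_f c d) (arc_g c d) c" (is ?B)
    and "cycle S (arc_f c d) (arc_g c d) c \<subseteq> cycle S f g c" (is ?C)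
proof -
  interpret A: two_bij S "arc_f c d" "arc_g c d" by (rule arc_switch_two_bij)
  let ?F = "arc S f g c d"
  have g_on: "arc_g c d ` insert c G = f ` insert d G" and f_on: "arc_f c d ` insert d G = g ` insert c G"
    if "G \<subseteq> ?F" for G
    using arc_facts that by (auto simp: arc_g_def arc_f_def image_iff subset_iff)
  have F': "half_stable S (arc_f c d) (arc_g c d) c d ?F"
    using g_on[of ?F] f_on[of ?F] arc_facts by (auto simp: half_stable_def)
  then have sub: "arc S (arc_f c d) (arc_g c d) c d \<subseteq> ?F" by (rule A.arc_subset)
  have "half_stable S (arc_f c d) (arc_g c d) c d (arc S (arc_f c d) (arc_g c d) c d)"
    using A.half_stable_arc[OF F'] cd(1) arc_facts(1) by blast
  then have "half_stable S f g c d (arc S (arc_f c d) (arc_g c d) c d)"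
    using g_on[OF sub] f_on[OF sub] unfolding half_stable_def by simp
  then show ?A using arc_subset sub by blast
  show ?B
    using A.half_stable_stable[OF F' A.cycle_eq(1) A.cycle_eq(2)] A.arc_subset[of c d "?F \<inter> cycle S (arc_f c d) (arc_g c d) c"]
      A.cycle_eq(2) cd(1) arc_facts(1) \<open>?A\<close> by auto
  have sub: "insert c (insert d ?F) \<subseteq> cycle S f g c" using arc_cycle[OF cd] cycle_eq(2)[OF cd(1)] cd(3) by auto
  have "stable S (arc_f c d) (arc_g c d) (cycle S f g c)"
    using arc_f_image[of "cycle S f g c"] arc_g_image[of "cycle S f g c"] sub cycle_eq(1)[OF cd(1)]
    by (simp add: stable_def)
  then show ?C using A.cycle_subset cycle_eq(2) cd(1) by blast
qed

end

end

text \<open>Switching and switching back shows that both pairs have the same stable sets. This is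
  why a cycle switch undoes itself.\<close>

lemma switch_cycle:
  assumes "two_bij S f g" "stable S f g W"
  shows "cycle S (\<lambda>j. if j \<in> W then g j else f j) (\<lambda>j. if j \<in> W then f j else g j) c = cycle S f g c"
proof -
  interpret A: two_bij S f g by fact
  let ?f = "\<lambda>j. if j \<in> W then g j else f j" and ?g = "\<lambda>j. if j \<in> W then f j else g j"
  interpret B: two_bij S g f using A.fin A.f A.g by unfold_locales
  interpret C: two_bij S ?f ?g
    using A.fin A.switch_bij[OF assms(2)] B.switch_bij[of W] assms(2) by unfold_locales (auto simp: stable_commute)
  have "stable S ?f ?g V \<longleftrightarrow> stable S f g V" for V
  proof
    assume V: "stable S ?f ?g V"
    have "(\<lambda>j. if j \<in> W then ?g j else ?f j) = f" "(\<lambda>j. if j \<in> W then ?f j else ?g j) = g" by auto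
    then show "stable S f g V"
      using C.switch_stable[OF A.switch_stable[OF assms(2,2)] V] by simp
  qed (rule A.switch_stable[OF assms(2)])
  then show ?thesis by (simp add: cycle_def)
qed

text \<open>If \<open>W\<close> is half-stable from \<open>c\<close> to \<open>d\<close>, then
  transposing the two values of \<open>g\<close> makes \<open>insert d W\<close> stable, and this
  set misses \<open>c\<close>.\<close>

lemma cycle_toggle:
  assumes "two_bij S f g" "c \<in> S" "d \<in> S" "c \<noteq> d" "d \<in> cycle S f g c"
    and g': "bij_betw g' S S" "g' c = g d" "g' d = g c" "\<And>j. j \<in> S \<Longrightarrow> j \<noteq> c \<Longrightarrow> j \<noteq> d \<Longrightarrow> g' j = g j"
  shows "d \<notin> cycle S f g' c"
proof -
  interpret A: two_bij S f g by fact
  interpret B: two_bij S f g' using A.fin A.f g' by unfold_locales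
  obtain W where W: "half_stable S f g c d W" using A.half_stable_exists assms by blast
  have "g' ` W = g ` W" using W g' by (intro image_cong) (auto simp: half_stable_def)
  then have "stable S f g' (insert d W)"
    using W assms by (auto simp: half_stable_def stable_def)
  then have "cycle S f g' d \<subseteq> insert d W" by (rule B.cycle_subset) auto
  then have "c \<notin> cycle S f g' d" using W assms by (auto simp: half_stable_def)
  then have "cycle S f g' d \<inter> cycle S f g' c = {}" using B.cycle_disjoint assms by blast
  then show ?thesis using B.cycle_eq(2) assms by blast
qed

section \<open>Switchings in Latin squares\<close>

definition swap_nat :: "nat \<Rightarrow> nat \<Rightarrow> nat \<Rightarrow> nat" where
  "swap_nat a b i = (if i = a then b else if i = b then a else i)"

lemma swap_nat_simps [simp]: "swap_nat a b a = b" "swap_nat a b b = a" "i \<noteq> a \<Longrightarrow> i \<noteq> b \<Longrightarrow> swap_nat a b i = i"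
  by (auto simp: swap_nat_def)

lemma swap_nat_swp [simp]: "swap_nat a b (swap_nat a b i) = i"
  by (auto simp: swap_nat_def)

lemma swap_nat_inj: "inj_on h S \<Longrightarrow> a \<in> S \<Longrightarrow> b \<in> S \<Longrightarrow> inj_on (\<lambda>i. h (swap_nat a b i)) S"
proof (rule inj_onI)
  assume h: "inj_on h S" and ab: "a \<in> S" "b \<in> S"
  fix x y assume "x \<in> S" "y \<in> S" "h (swap_nat a b x) = h (swap_nat a b y)"
  moreover from this have "swap_nat a b x \<in> S" "swap_nat a b y \<in> S" using ab by (simp_all add: swap_nat_def)
  ultimately have "swap_nat a b x = swap_nat a b y" using h by (simp add: inj_on_eq_iff)
  then show "x = y" by (metis swap_nat_swp)
qed

definition row_switch :: "(nat \<Rightarrow> nat \<Rightarrow> nat) \<Rightarrow> nat \<Rightarrow> nat \<Rightarrow> nat set \<Rightarrow> (nat \<Rightarrow> nat \<Rightarrow> nat)" where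
  "row_switch L p q W = (\<lambda>i j. if j \<in> W then L (swap_nat p q i) j else L i j)"

lemma row_switch_row:
  "row_switch L p q W p = (\<lambda>j. if j \<in> W then L q j else L p j)"
  "row_switch L p q W q = (\<lambda>j. if j \<in> W then L p j else L q j)"
  "i \<noteq> p \<Longrightarrow> i \<noteq> q \<Longrightarrow> row_switch L p q W i = L i"
  by (auto simp: row_switch_def)

lemma row_switch_involution [simp]: "row_switch (row_switch L p q W) p q W = L"
  by (auto simp: row_switch_def fun_eq_iff)

locale latin =
  fixes n :: nat
begin

definition S :: "nat set" where "S = {1..n}"

lemma fin_S [simp]: "finite S" and card_S [simp]: "card S = n" by (simp_all add: S_def)

abbreviation LS :: "(nat \<Rightarrow> nat \<Rightarrow> nat) set" where "LS \<equiv> latin_squares n"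

abbreviation row_cycle :: "(nat \<Rightarrow> nat \<Rightarrow> nat) \<Rightarrow> nat \<Rightarrow> nat \<Rightarrow> nat \<Rightarrow> nat set" where
  "row_cycle L p q \<equiv> cycle S (L p) (L q)"

definition row_of :: "(nat \<Rightarrow> nat \<Rightarrow> nat) \<Rightarrow> nat \<Rightarrow> nat \<Rightarrow> nat" where
  "row_of L j s = inv_into S (\<lambda>i. L i j) s"

definition col_of :: "(nat \<Rightarrow> nat \<Rightarrow> nat) \<Rightarrow> nat \<Rightarrow> nat \<Rightarrow> nat" where
  "col_of L i s = inv_into S (L i) s"

lemma LS_iff: "L \<in> LS \<longleftrightarrow> L \<in> S \<rightarrow>\<^sub>E S \<rightarrow>\<^sub>E S \<and> (\<forall>i\<in>S. inj_on (L i) S) \<and> (\<forall>j\<in>S. inj_on (\<lambda>i. L i j) S)"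
  by (simp add: latin_squares_def S_def)

lemma fin_LS: "finite LS" by (rule finite_latin_squares)

lemma LS_range: "L \<in> LS \<Longrightarrow> i \<in> S \<Longrightarrow> j \<in> S \<Longrightarrow> L i j \<in> S"
  unfolding LS_iff by (auto simp: PiE_iff)

lemma LS_row: assumes "L \<in> LS" "i \<in> S" shows "bij_betw (L i) S S"
proof -
  have "inj_on (L i) S" using assms by (simp add: LS_iff)
  moreover have "L i ` S \<subseteq> S" using LS_range[OF assms] by auto
  ultimately show ?thesis by (simp add: bij_betw_def endo_inj_surj)
qed

lemma LS_col: assumes "L \<in> LS" "j \<in> S" shows "bij_betw (\<lambda>i. L i j) S S"
proof -
  have "inj_on (\<lambda>i. L i j) S" using assms by (simp add: LS_iff)
  moreover have "(\<lambda>i. L i j) ` S \<subseteq> S" using LS_range[OF assms(1) _ assms(2)] by auto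
  ultimately show ?thesis by (simp add: bij_betw_def endo_inj_surj)
qed

lemma LS_two_bij: "L \<in> LS \<Longrightarrow> p \<in> S \<Longrightarrow> q \<in> S \<Longrightarrow> two_bij S (L p) (L q)"
  using LS_row by unfold_locales auto

lemma row_inj: "L \<in> LS \<Longrightarrow> i \<in> S \<Longrightarrow> j \<in> S \<Longrightarrow> k \<in> S \<Longrightarrow> L i j = L i k \<Longrightarrow> j = k"
  using LS_row[of L i] by (metis bij_betw_def inj_on_eq_iff)

lemma col_inj: "L \<in> LS \<Longrightarrow> i \<in> S \<Longrightarrow> k \<in> S \<Longrightarrow> j \<in> S \<Longrightarrow> L i j = L k j \<Longrightarrow> i = k"
  using LS_col[of L j] inj_on_eq_iff[of "\<lambda>i. L i j" S i k] by (simp add: bij_betw_def)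

lemma row_of: assumes "L \<in> LS" "j \<in> S" "s \<in> S" shows "row_of L j s \<in> S" "L (row_of L j s) j = s"
  using LS_col[OF assms(1,2)] assms(3) f_inv_into_f[of s "\<lambda>i. L i j" S] inv_into_into[of s "\<lambda>i. L i j" S]
  by (auto simp: bij_betw_def row_of_def)

lemma row_of_eq: "L \<in> LS \<Longrightarrow> i \<in> S \<Longrightarrow> j \<in> S \<Longrightarrow> L i j = s \<Longrightarrow> row_of L j s = i"
  using LS_col[of L j] inv_into_f_f[of "\<lambda>i. L i j" S i] by (auto simp: bij_betw_def row_of_def)

lemma col_of: assumes "L \<in> LS" "i \<in> S" "s \<in> S" shows "col_of L i s \<in> S" "L i (col_of L i s) = s"
  using LS_row[OF assms(1,2)] assms(3) f_inv_into_f[of s "L i" S] inv_into_into[of s "L i" S]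
  by (auto simp: bij_betw_def col_of_def)

lemma col_of_eq: "L \<in> LS \<Longrightarrow> i \<in> S \<Longrightarrow> j \<in> S \<Longrightarrow> L i j = s \<Longrightarrow> col_of L i s = j"
  using LS_row[of L i] inv_into_f_f[of "L i" S j] by (auto simp: bij_betw_def col_of_def)

lemma LS_I:
  assumes "L \<in> LS" "\<And>i j. i \<notin> S \<or> j \<notin> S \<Longrightarrow> L' i j = L i j"
    "\<And>i. i \<in> S \<Longrightarrow> bij_betw (L' i) S S" "\<And>j. j \<in> S \<Longrightarrow> inj_on (\<lambda>i. L' i j) S"
  shows "L' \<in> LS"
proof -
  have "L' i \<in> S \<rightarrow>\<^sub>E S" if i: "i \<in> S" for i
  proof (rule PiE_I)
    fix j assume "j \<in> S" then show "L' i j \<in> S" using assms(3)[OF i] by (auto simp: bij_betw_def)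
  next
    fix j assume "j \<notin> S" then show "L' i j = undefined"
      using assms(1,2) i unfolding LS_iff by (auto simp: PiE_iff extensional_def)
  qed
  moreover have "L' i = undefined" if "i \<notin> S" for i
  proof -
    have "L' i = L i" using assms(2) that by (intro ext) auto
    then show ?thesis using assms(1) that unfolding LS_iff by (auto simp: PiE_iff extensional_def)
  qed
  ultimately have "L' \<in> S \<rightarrow>\<^sub>E S \<rightarrow>\<^sub>E S" by (rule PiE_I)
  then show ?thesis using assms(3,4) unfolding LS_iff by (auto simp: bij_betw_def)
qed

lemma row_switch_LS:
  assumes L: "L \<in> LS" and pq: "p \<in> S" "q \<in> S" "p \<noteq> q" and W: "stable S (L p) (L q) W"
  shows "row_switch L p q W \<in> LS"
proof (rule LS_I[OF L])
  interpret two_bij S "L p" "L q" using LS_two_bij L pq by blast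
  interpret B: two_bij S "L q" "L p" using LS_two_bij L pq by blast
  have WS: "W \<subseteq> S" using W by (simp add: stable_def)
  fix i j :: nat
  { assume "i \<notin> S \<or> j \<notin> S"
    then show "row_switch L p q W i j = L i j" using pq WS by (auto simp: row_switch_def swap_nat_def) }
  { assume i: "i \<in> S"
    consider "i = p" | "i = q" | "i \<noteq> p" "i \<noteq> q" by blast
    then show "bij_betw (row_switch L p q W i) S S"
      using switch_bij[OF W] B.switch_bij[of W] W LS_row[OF L i] 
      by cases (simp_all add: row_switch_row stable_commute) }
  { assume j: "j \<in> S"
    have "inj_on (\<lambda>i. L i j) S" using LS_col[OF L j] by (simp add: bij_betw_def)
    then show "inj_on (\<lambda>i. row_switch L p q W i j) S"
      using swap_nat_inj[of "\<lambda>i. L i j" S p q] pq by (cases "j \<in> W") (auto simp: row_switch_def) }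
qed

definition cycle_switch :: "(nat \<Rightarrow> nat \<Rightarrow> nat) \<Rightarrow> nat \<Rightarrow> nat \<Rightarrow> nat \<Rightarrow> (nat \<Rightarrow> nat \<Rightarrow> nat)" where
  "cycle_switch L p q c = row_switch L p q (row_cycle L p q c)"

lemma cycle_switch_rows:
  "cycle_switch L p q c p j = (if j \<in> row_cycle L p q c then L q j else L p j)"
  "cycle_switch L p q c q j = (if j \<in> row_cycle L p q c then L p j else L q j)"
  "i \<noteq> p \<Longrightarrow> i \<noteq> q \<Longrightarrow> cycle_switch L p q c i = L i"
  by (simp_all add: cycle_switch_def row_switch_row)

context
  fixes L p q c
  assumes L: "L \<in> LS" and pq: "p \<in> S" "q \<in> S" "p \<noteq> q" and c: "c \<in> S"
begin

lemma row_cycle_facts: "stable S (L p) (L q) (row_cycle L p q c)" "c \<in> row_cycle L p q c" "row_cycle L p q c \<subseteq> S"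
proof -
  interpret two_bij S "L p" "L q" using LS_two_bij L pq by blast
  show "stable S (L p) (L q) (row_cycle L p q c)" "c \<in> row_cycle L p q c" "row_cycle L p q c \<subseteq> S"
    using cycle_eq[OF c] cycle_S[OF c] by auto
qed

lemma cycle_switch_LS: "cycle_switch L p q c \<in> LS"
  unfolding cycle_switch_def using row_switch_LS[OF L pq row_cycle_facts(1)] .

lemma row_cycle_cycle_switch: "row_cycle (cycle_switch L p q c) p q = row_cycle L p q"
proof
  fix x
  show "row_cycle (cycle_switch L p q c) p q x = row_cycle L p q x"
    using switch_cycle[OF LS_two_bij[OF L pq(1,2)] row_cycle_facts(1), of x]
    by (simp add: cycle_switch_def row_switch_row)
qed

lemma cycle_switch_involution: "cycle_switch (cycle_switch L p q c) p q c = L"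
  by (subst cycle_switch_def, subst row_cycle_cycle_switch) (simp add: cycle_switch_def)

lemma row_cycle_disjoint: "d \<in> S \<Longrightarrow> d \<notin> row_cycle L p q c \<Longrightarrow> row_cycle L p q c \<inter> row_cycle L p q d = {}"
proof -
  interpret two_bij S "L p" "L q" using LS_two_bij L pq by blast
  show "d \<in> S \<Longrightarrow> d \<notin> row_cycle L p q c \<Longrightarrow> row_cycle L p q c \<inter> row_cycle L p q d = {}" using cycle_disjoint c by blast
qed

lemma row_cycle_sym: "d \<in> S \<Longrightarrow> d \<notin> row_cycle L p q c \<Longrightarrow> c \<notin> row_cycle L p q d"
  using row_cycle_disjoint row_cycle_facts by blast

end

section \<open>Switchings of intercalates and along arcs\<close>

definition intercalate :: "(nat \<Rightarrow> nat \<Rightarrow> nat) \<Rightarrow> nat \<Rightarrow> nat \<Rightarrow> nat \<Rightarrow> nat \<Rightarrow> bool" where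
  "intercalate L p q c d \<longleftrightarrow> p \<in> S \<and> q \<in> S \<and> p \<noteq> q \<and> c \<in> S \<and> d \<in> S \<and> c \<noteq> d \<and> L p c = L q d \<and> L p d = L q c"

definition int_switch :: "(nat \<Rightarrow> nat \<Rightarrow> nat) \<Rightarrow> nat \<Rightarrow> nat \<Rightarrow> nat \<Rightarrow> nat \<Rightarrow> (nat \<Rightarrow> nat \<Rightarrow> nat)" where
  "int_switch L p q c d = row_switch L p q {c, d}"

lemma int_switch_LS: "L \<in> LS \<Longrightarrow> intercalate L p q c d \<Longrightarrow> int_switch L p q c d \<in> LS"
  unfolding int_switch_def by (rule row_switch_LS) (auto simp: intercalate_def stable_def)

lemma int_switch_rows:
  "int_switch L p q c d p = (\<lambda>j. if j \<in> {c, d} then L q j else L p j)"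
  "int_switch L p q c d q = (\<lambda>j. if j \<in> {c, d} then L p j else L q j)"
  "i \<noteq> p \<Longrightarrow> i \<noteq> q \<Longrightarrow> int_switch L p q c d i = L i"
  by (simp_all add: int_switch_def row_switch_row)

lemma int_switch_involution: "int_switch (int_switch L p q c d) p q c d = L"
  by (simp add: int_switch_def)

text \<open>For an outside row \<open>g\<close>, switching the intercalate merely transposes two
  entries of row \<open>q\<close>, so \<open>cycle_toggle\<close> applies.\<close>

lemma int_switch_toggle:
  assumes L: "L \<in> LS" and I: "intercalate L p q c d" and g: "g \<in> S" "g \<noteq> p" "g \<noteq> q" and "d \<in> row_cycle L q g c"
  shows "d \<notin> row_cycle (int_switch L p q c d) q g c" (is "_ \<notin> row_cycle ?L q g c")
proof -
  have S: "p \<in> S" "q \<in> S" "c \<in> S" "d \<in> S" "c \<noteq> d" "p \<noteq> q" using I by (auto simp: intercalate_def)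
  have "d \<notin> cycle S (L g) (?L q) c"
  proof (rule cycle_toggle[OF LS_two_bij[OF L g(1) S(2)] S(3-5)])
    show "d \<in> cycle S (L g) (L q) c" using assms(6) by (simp add: cycle_commute)
    show "bij_betw (?L q) S S" using LS_row[OF int_switch_LS[OF L I]] S by blast
  qed (use I S in \<open>auto simp: int_switch_rows intercalate_def\<close>)
  moreover have "?L g = L g" using g by (simp add: int_switch_rows(3))
  ultimately show ?thesis by (simp add: cycle_commute[of S "?L q"])
qed

text \<open>Here \<open>u\<close> holds in column \<open>d\<close> the entry of row \<open>q\<close> in column \<open>c\<close>, and \<open>v\<close> holds in column \<open>c\<close>
  the entry of row \<open>q\<close> in column \<open>d\<close>. After these two entries of row \<open>q\<close> have been exchanged, the rows \<open>u\<close>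
  and \<open>v\<close> are repaired along an arc, which exists only if \<open>c\<close> and \<open>d\<close> lie on one cycle.\<close>

definition arc_switch :: "(nat \<Rightarrow> nat \<Rightarrow> nat) \<Rightarrow> nat \<Rightarrow> nat \<Rightarrow> nat \<Rightarrow> nat \<Rightarrow> nat \<Rightarrow> (nat \<Rightarrow> nat \<Rightarrow> nat)" where
  "arc_switch L q u v c d = (\<lambda>i j. if j = c then L (swap_nat q v i) c else if j = d then L (swap_nat q u i) d
     else if j \<in> arc S (L u) (L v) c d then L (swap_nat u v i) j else L i j)"

context
  fixes L q u v c d
  assumes L: "L \<in> LS" and S: "q \<in> S" "u \<in> S" "v \<in> S" "c \<in> S" "d \<in> S" "c \<noteq> d"
    and distinct: "q \<noteq> u" "q \<noteq> v" "u \<noteq> v"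
    and eq: "L u d = L q c" "L v c = L q d"
    and same: "d \<in> row_cycle L u v c"
begin

interpretation two_bij S "L u" "L v" using LS_two_bij L S by blast

lemma arc_switch_arc: "arc S (L u) (L v) c d \<subseteq> S" "c \<notin> arc S (L u) (L v) c d" "d \<notin> arc S (L u) (L v) c d"
  "arc S (L u) (L v) c d \<subseteq> row_cycle L u v c"
  using arc_facts[OF S(4,6) same] arc_cycle[OF S(4,6) same] by auto

lemma arc_switch_rows:
  "arc_switch L q u v c d q = (\<lambda>j. if j = c then L q d else if j = d then L q c else L q j)"
  "arc_switch L q u v c d u = arc_f c d"
  "arc_switch L q u v c d v = arc_g c d"
  "i \<noteq> q \<Longrightarrow> i \<noteq> u \<Longrightarrow> i \<noteq> v \<Longrightarrow> arc_switch L q u v c d i = L i"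
  using distinct eq S arc_switch_arc unfolding arc_switch_def arc_f_def arc_g_def
  by (auto simp: fun_eq_iff)

lemma arc_switch_LS: "arc_switch L q u v c d \<in> LS"
proof (rule LS_I[OF L])
  interpret B: two_bij S "arc_f c d" "arc_g c d" by (rule arc_switch_two_bij[OF S(4,6) same])
  fix i j :: nat
  { assume "i \<notin> S \<or> j \<notin> S"
    then show "arc_switch L q u v c d i j = L i j" using S arc_switch_arc by (auto simp: arc_switch_def swap_nat_def) }
  { assume i: "i \<in> S"
    have q: "bij_betw (\<lambda>j. if j = c then L q d else if j = d then L q c else L q j) S S"
    proof (rule finite_onto_bij)
      have "(\<lambda>j. if j = c then L q d else if j = d then L q c else L q j) ` S = (\<lambda>j. L q (swap_nat c d j)) ` S"
        by (intro image_cong) (auto simp: swap_nat_def)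
      also have "\<dots> = L q ` swap_nat c d ` S" by (simp add: image_image)
      also have "swap_nat c d ` S = S"
      proof -
        have "inj_on (swap_nat c d) S" using swap_nat_inj[of "\<lambda>x. x" S c d] S by simp
        moreover have "swap_nat c d ` S \<subseteq> S" using S by (auto simp: swap_nat_def)
        ultimately show ?thesis by (simp add: endo_inj_surj)
      qed
      also have "L q ` S = S" using LS_row[OF L S(1)] by (simp add: bij_betw_def)
      finally show "(\<lambda>j. if j = c then L q d else if j = d then L q c else L q j) ` S = S" .
    qed simp
    consider "i = q" | "i = u" | "i = v" | "i \<noteq> q" "i \<noteq> u" "i \<noteq> v" by blast
    then show "bij_betw (arc_switch L q u v c d i) S S"
      using q B.f B.g LS_row[OF L i] by cases (simp_all add: arc_switch_rows) }
  { assume j: "j \<in> S"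
    have "inj_on (\<lambda>i. L i j) S" using LS_col[OF L j] by (simp add: bij_betw_def)
    consider "j = c" | "j = d" | "j \<noteq> c" "j \<noteq> d" "j \<in> arc S (L u) (L v) c d"
      | "j \<noteq> c" "j \<noteq> d" "j \<notin> arc S (L u) (L v) c d" by blast
    then show "inj_on (\<lambda>i. arc_switch L q u v c d i j) S"
      using swap_nat_inj[OF \<open>inj_on (\<lambda>i. L i j) S\<close>] S \<open>inj_on (\<lambda>i. L i j) S\<close>
      by cases (simp_all add: arc_switch_def) }
qed

lemma arc_switch_arc_eq: "arc S (arc_switch L q u v c d u) (arc_switch L q u v c d v) c d = arc S (L u) (L v) c d"
  by (simp add: arc_switch_rows arc_switch_invariant[OF S(4,6) same])

lemma arc_switch_cycle:
  "insert c (insert d (arc S (L u) (L v) c d)) \<subseteq> row_cycle (arc_switch L q u v c d) u v c"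
  "row_cycle (arc_switch L q u v c d) u v c \<subseteq> row_cycle L u v c"
  using arc_switch_invariant(2,3)[OF S(4,6) same] by (simp_all add: arc_switch_rows)

lemma arc_switch_involution: "arc_switch (arc_switch L q u v c d) q u v c d = L"
proof -
  have "arc_switch (arc_switch L q u v c d) q u v c d i j = L i j" for i j
    using S(6) arc_switch_arc
    by (subst arc_switch_def) (simp add: arc_switch_arc_eq, simp add: arc_switch_def)
  then show ?thesis by blast
qed

lemma arc_switch_vals:
  "arc_switch L q u v c d u c = L u c" "arc_switch L q u v c d u d = L q d"
  "arc_switch L q u v c d v c = L q c" "arc_switch L q u v c d v d = L v d"
  "j \<notin> arc S (L u) (L v) c d \<Longrightarrow> j \<noteq> d \<Longrightarrow> arc_switch L q u v c d u j = L u j"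
  "j \<in> arc S (L u) (L v) c d \<Longrightarrow> arc_switch L q u v c d v j = L u j"
  using S eq distinct arc_switch_arc by (auto simp: arc_switch_def)

end

end

section \<open>Exchanging two entries of one row\<close>

context latin
begin

text \<open>The second component is a row that is needed to undo the exchange; \<open>0\<close> is not a row and means that no
  row has to be remembered.\<close>

definition swap_entries :: "(nat \<Rightarrow> nat \<Rightarrow> nat) \<Rightarrow> nat \<Rightarrow> nat \<Rightarrow> nat \<Rightarrow> (nat \<Rightarrow> nat \<Rightarrow> nat) \<times> nat" where
  "swap_entries L q c d = (let u = row_of L d (L q c); v = row_of L c (L q d) in
     if u = v then (int_switch L q u c d, 0)
     else if d \<in> row_cycle L u v c then (arc_switch L q u v c d, 0)
     else (int_switch (cycle_switch L u v d) q v c d, u))"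

text \<open>Without a remembered row the exchange is its own inverse. Otherwise \<open>g\<close> is
  the row \<open>u\<close> of the original square, while \<open>v\<close> can still be read off from
  the result.\<close>

definition swap_back :: "(nat \<Rightarrow> nat \<Rightarrow> nat) \<Rightarrow> nat \<Rightarrow> nat \<Rightarrow> nat \<Rightarrow> nat \<Rightarrow> (nat \<Rightarrow> nat \<Rightarrow> nat)" where
  "swap_back L g q c d = (if g = 0 then fst (swap_entries L q c d)
     else let v = row_of L c (L q d) in cycle_switch (int_switch L q v c d) g v d)"

context
  fixes L q c d L2 g u v
  assumes L: "L \<in> LS" and S: "q \<in> S" "c \<in> S" "d \<in> S" "c \<noteq> d"
  and res: "swap_entries L q c d = (L2, g)"
  and uv: "u = row_of L d (L q c)" "v = row_of L c (L q d)"
begin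

lemma swap_entries_uv: "u \<in> S" "v \<in> S" "u \<noteq> q" "v \<noteq> q" "L u d = L q c" "L v c = L q d"
proof -
  have r: "L q c \<in> S" "L q d \<in> S" using LS_range L S by auto
  show "u \<in> S" "v \<in> S" "L u d = L q c" "L v c = L q d"
    using row_of[OF L S(3) r(1)] row_of[OF L S(2) r(2)] uv by auto
  then show "u \<noteq> q" "v \<noteq> q" using row_inj[OF L S(1-3)] S(4) by auto
qed

text \<open>In the third case the cycle through \<open>d\<close> avoids \<open>c\<close>. Switching
  \<open>u\<close> and \<open>v\<close> on it brings \<open>L q c\<close> into row \<open>v\<close>
  in column \<open>d\<close>, while row \<open>v\<close> keeps \<open>L q d\<close> in column
  \<open>c\<close>, so rows \<open>q\<close> and \<open>v\<close> form an intercalate.\<close>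

lemma swap_entries_cases:
  obtains (int) "u = v" "L2 = int_switch L q u c d" "g = 0" "intercalate L q u c d"
  | (arc) "u \<noteq> v" "d \<in> row_cycle L u v c" "L2 = arc_switch L q u v c d" "g = 0"
  | (cycle) "u \<noteq> v" "d \<notin> row_cycle L u v c" "L2 = int_switch (cycle_switch L u v d) q v c d" "g = u"
      "intercalate (cycle_switch L u v d) q v c d"
proof -
  note f = swap_entries_uv
  have "intercalate L q u c d" if "u = v" using f S that by (auto simp: intercalate_def)
  moreover have "intercalate (cycle_switch L u v d) q v c d" if uv: "u \<noteq> v" "d \<notin> row_cycle L u v c"
  proof -
    have "c \<notin> row_cycle L u v d" using row_cycle_sym[OF L f(1,2) uv(1) S(2,3) uv(2)] .
    moreover have "d \<in> row_cycle L u v d" using row_cycle_facts(2)[OF L f(1,2) uv(1) S(3)] .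
    ultimately show ?thesis using f S uv by (simp add: intercalate_def cycle_switch_rows)
  qed
  ultimately show ?thesis
    using that res uv unfolding swap_entries_def Let_def by (metis Pair_inject)
qed

lemma swap_entries_LS: "L2 \<in> LS"
  using swap_entries_uv S L
  by (cases rule: swap_entries_cases)
    (auto intro!: int_switch_LS cycle_switch_LS arc_switch_LS)

lemma swap_entries_row: "L2 q = (\<lambda>j. if j = c then L q d else if j = d then L q c else L q j)"
proof (cases rule: swap_entries_cases)
  case int
  then show ?thesis using swap_entries_uv S by (auto simp: int_switch_rows fun_eq_iff)
next
  case arc
  then show ?thesis using arc_switch_rows(1)[OF L S(1) swap_entries_uv(1,2) S(2-4)] swap_entries_uv by metis
next
  case cycle
  then show ?thesis using swap_entries_uv S 
    by (auto simp: int_switch_rows fun_eq_iff intercalate_def cycle_switch_rows(3))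
qed

lemma swap_entries_other: "i \<noteq> q \<Longrightarrow> i \<noteq> u \<Longrightarrow> i \<noteq> v \<Longrightarrow> L2 i = L i"
proof (cases rule: swap_entries_cases)
  assume i: "i \<noteq> q" "i \<noteq> u" "i \<noteq> v"
  case arc
  then show ?thesis using arc_switch_rows(4)[OF L S(1) swap_entries_uv(1,2) S(2-4)] swap_entries_uv i by metis
qed (simp_all add: int_switch_rows cycle_switch_rows)

text \<open>Information is lost only in the third case, and there the result shows it by an
  intercalate in the rows \<open>q\<close>, \<open>v\<close> and the columns \<open>c\<close>,
  \<open>d\<close>.\<close>

lemma swap_entries_tag:
  assumes "g \<noteq> 0"
  shows "g = u" "u \<noteq> v" "L2 v c = L2 q d" "L2 v d = L2 q c"
  by (cases rule: swap_entries_cases;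
      use assms swap_entries_uv S in \<open>auto simp: int_switch_rows intercalate_def\<close>)+

lemma swap_entries_back: "swap_back L2 g q c d = L"
proof (cases rule: swap_entries_cases)
  case int
  have "L2 u d = L2 q c" "L2 u c = L2 q d"
    using int S swap_entries_uv by (auto simp: int_switch_rows)
  then have "row_of L2 d (L2 q c) = u" "row_of L2 c (L2 q d) = u"
    using row_of_eq[OF swap_entries_LS] swap_entries_uv S by auto
  then show ?thesis using int by (simp add: swap_back_def swap_entries_def int_switch_involution)
next
  case arc
  note A = L S(1) swap_entries_uv(1,2) S(2-4) swap_entries_uv(3,4)[symmetric] arc(1) swap_entries_uv(5,6) arc(2)
  have "L2 u d = L2 q c" "L2 v c = L2 q d"
    using arc_switch_vals[OF A] arc_switch_rows(1)[OF A] S by (simp_all add: arc(3))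
  then have "row_of L2 d (L2 q c) = u" "row_of L2 c (L2 q d) = v"
    using row_of_eq[OF swap_entries_LS] swap_entries_uv S by auto
  moreover have "d \<in> row_cycle L2 u v c" using arc_switch_cycle(1)[OF A] by (simp add: arc(3))
  ultimately show ?thesis
    using arc arc_switch_involution[OF A] by (simp add: swap_back_def swap_entries_def)
next
  case cycle
  have "L2 v c = L2 q d" using swap_entries_tag cycle(4) swap_entries_uv(1) by (simp add: S_def)
  then have v: "row_of L2 c (L2 q d) = v" using row_of_eq[OF swap_entries_LS] swap_entries_uv S by auto
  have "g \<noteq> 0" using cycle(4) swap_entries_uv(1) by (simp add: S_def)
  then have "swap_back L2 g q c d = cycle_switch (int_switch L2 q v c d) u v d"
    using v cycle(4) by (simp add: swap_back_def)
  also have "\<dots> = L"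
    unfolding cycle(3) int_switch_involution
    by (rule cycle_switch_involution[OF L swap_entries_uv(1,2) cycle(1) S(3)])
  finally show ?thesis .
qed

end

text \<open>Switching an intercalate exchanges two entries of row \<open>q\<close> and so splits the cycle of \<open>q\<close> and \<open>g\<close>
  through \<open>c\<close> and \<open>d\<close>. Hence one cell of the intercalate can always be removed with the help of any row \<open>g\<close>.\<close>

definition int_break :: "(nat \<Rightarrow> nat \<Rightarrow> nat) \<Rightarrow> nat \<Rightarrow> nat \<Rightarrow> nat \<Rightarrow> nat \<Rightarrow> nat \<Rightarrow> (nat \<Rightarrow> nat \<Rightarrow> nat)" where
  "int_break L p q c d g = cycle_switch (if d \<in> row_cycle L q g c then int_switch L p q c d else L) q g d"

context
  fixes L p q c d g
  assumes L: "L \<in> LS" and I: "intercalate L p q c d" and g: "g \<in> S" "g \<noteq> p" "g \<noteq> q"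
begin

lemma int_S: "p \<in> S" "q \<in> S" "p \<noteq> q" "c \<in> S" "d \<in> S" "c \<noteq> d" "L p c = L q d" "L p d = L q c"
  using I by (auto simp: intercalate_def)

lemma int_break_LS: "int_break L p q c d g \<in> LS"
  unfolding int_break_def using int_switch_LS[OF L I] L int_S g by (intro cycle_switch_LS) auto

lemma int_break_other: "i \<noteq> p \<Longrightarrow> i \<noteq> q \<Longrightarrow> i \<noteq> g \<Longrightarrow> int_break L p q c d g i = L i"
  by (simp add: int_break_def cycle_switch_rows int_switch_rows)

lemma int_break_far:
  assumes "d \<notin> row_cycle L q g c"
  shows "int_break L p q c d g p = L p" "int_break L p q c d g q c = L q c" "int_break L p q c d g g d = L q d"
    "cycle_switch (int_break L p q c d g) q g d = L"
proof -
  have c: "c \<notin> row_cycle L q g d" using row_cycle_sym[OF L int_S(2) g(1) g(3)[symmetric] int_S(4,5) assms] .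
  have d: "d \<in> row_cycle L q g d" using row_cycle_facts(2)[OF L int_S(2) g(1) g(3)[symmetric] int_S(5)] .
  show "int_break L p q c d g p = L p" "int_break L p q c d g q c = L q c" "int_break L p q c d g g d = L q d"
    using assms c d g int_S by (simp_all add: int_break_def cycle_switch_rows)
  show "cycle_switch (int_break L p q c d g) q g d = L"
    using assms cycle_switch_involution[OF L int_S(2) g(1) g(3)[symmetric] int_S(5)] by (simp add: int_break_def)
qed

lemma int_break_near:
  assumes A: "d \<in> row_cycle L q g c"
  shows "int_break L p q c d g p = (\<lambda>j. if j = c then L p d else if j = d then L p c else L p j)"
    "int_break L p q c d g q c = L p c" "int_break L p q c d g g d = L p d"
    "int_switch (cycle_switch (int_break L p q c d g) q g d) p q c d = L"
proof -
  let ?L = "int_switch L p q c d"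
  have L': "?L \<in> LS" using int_switch_LS[OF L I] .
  have c: "c \<notin> row_cycle ?L q g d"
    using row_cycle_sym[OF L' int_S(2) g(1) g(3)[symmetric] int_S(4,5) int_switch_toggle[OF L I g A]] .
  have d: "d \<in> row_cycle ?L q g d" using row_cycle_facts(2)[OF L' int_S(2) g(1) g(3)[symmetric] int_S(5)] .
  show "int_break L p q c d g p = (\<lambda>j. if j = c then L p d else if j = d then L p c else L p j)"
    "int_break L p q c d g q c = L p c" "int_break L p q c d g g d = L p d"
    using assms c d g int_S by (auto simp: int_break_def cycle_switch_rows int_switch_rows fun_eq_iff)
  show "int_switch (cycle_switch (int_break L p q c d g) q g d) p q c d = L"
    using assms cycle_switch_involution[OF L' int_S(2) g(1) g(3)[symmetric] int_S(5)]
    by (simp add: int_break_def int_switch_involution)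
qed

end

end

section \<open>The average number of intercalates through an entry\<close>

context latin
begin

definition partner :: "(nat \<Rightarrow> nat \<Rightarrow> nat) \<Rightarrow> nat \<Rightarrow> nat \<Rightarrow> nat \<Rightarrow> nat" where
  "partner L c s d = row_of L c (L (row_of L c s) d)"

text \<open>The columns \<open>d\<close> for which the cell of \<open>s\<close> in column
  \<open>c\<close> lies in an intercalate with columns \<open>c\<close>, \<open>d\<close> whose
  other row is outside \<open>Fz\<close>, the rows that must not be changed.\<close>

definition ints :: "nat set \<Rightarrow> nat \<Rightarrow> nat \<Rightarrow> (nat \<Rightarrow> nat \<Rightarrow> nat) \<Rightarrow> nat set" where
  "ints Fz c s L = {d \<in> S. d \<noteq> c \<and> partner L c s d \<notin> Fz \<and> L (partner L c s d) d = s}"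

lemma ints_intercalate:
  assumes L: "L \<in> LS" and cs: "c \<in> S" "s \<in> S" and d: "d \<in> ints Fz c s L"
  shows "intercalate L (row_of L c s) (partner L c s d) c d" "L (row_of L c s) c = s" "partner L c s d \<notin> Fz"
proof -
  define p where "p = row_of L c s"
  have dS: "d \<in> S" "d \<noteq> c" using d by (auto simp: ints_def)
  have p: "p \<in> S" "L p c = s" using row_of[OF L cs] by (auto simp: p_def)
  have q: "partner L c s d \<in> S" "L (partner L c s d) c = L p d"
    using row_of[OF L cs(1), of "L p d"] LS_range[OF L p(1) dS(1)] by (auto simp: partner_def p_def)
  have "p \<noteq> partner L c s d" using q p row_inj[OF L p(1) dS(1) cs(1)] dS by auto
  then show "intercalate L (row_of L c s) (partner L c s d) c d" "L (row_of L c s) c = s" "partner L c s d \<notin> Fz"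
    using d p q cs unfolding p_def[symmetric] by (auto simp: intercalate_def ints_def)
qed

text \<open>Each pair leaves at least \<open>n - card Fz - 2\<close> choices of \<open>g\<close>.
  The broken square and \<open>d\<close> determine both \<open>L\<close> and \<open>g\<close>, but
  by different formulas according to whether the intercalate was switched first. So the map is
  injective on each of the two cases, which explains the two targets.\<close>

lemma int_break_count:
  assumes cs: "c \<in> S" "s \<in> S" and Fz: "Fz \<subseteq> S" and fin: "finite V" "finite U" "finite W"
    and V: "\<And>L d. (L, d) \<in> V \<Longrightarrow> L \<in> LS \<and> d \<in> ints Fz c s L"
    and far: "\<And>L d g p q. (L, d) \<in> V \<Longrightarrow> p = row_of L c s \<Longrightarrow> q = partner L c s d \<Longrightarrow> g \<in> S - Fz - {p, q} \<Longrightarrow>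
      d \<notin> row_cycle L q g c \<Longrightarrow> (int_break L p q c d g, d) \<in> U"
    and near: "\<And>L d g p q. (L, d) \<in> V \<Longrightarrow> p = row_of L c s \<Longrightarrow> q = partner L c s d \<Longrightarrow> g \<in> S - Fz - {p, q} \<Longrightarrow>
      d \<in> row_cycle L q g c \<Longrightarrow> (int_break L p q c d g, d) \<in> W"
  shows "card V * (n - card Fz - 2) \<le> card U + card W"
proof -
  define G where "G = (\<lambda>(L, d). S - Fz - {row_of L c s, partner L c s d})"
  define T where "T = (SIGMA x : V. G x)"
  define T1 where "T1 = {((L, d), g) \<in> T. d \<notin> row_cycle L (partner L c s d) g c}"
  define T2 where "T2 = {((L, d), g) \<in> T. d \<in> row_cycle L (partner L c s d) g c}"
  have finG: "finite (G x)" for x by (auto simp: G_def split: prod.split)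
  have "n - card Fz - 2 \<le> card (G x)" for x
  proof (cases x)
    case (Pair L d)
    have "card (S - Fz) = n - card Fz" using Fz fin_S by (simp add: card_Diff_subset finite_subset)
    moreover have "card {row_of L c s, partner L c s d} \<le> 2" by (simp add: card_insert_if)
    ultimately have "n - card Fz - 2 \<le> card (S - Fz) - card {row_of L c s, partner L c s d}"
      by (simp only: diff_le_mono2)
    also have "\<dots> \<le> card (G x)" unfolding G_def Pair by (simp only: prod.case) (rule diff_card_le_card_Diff, simp)
    finally show ?thesis .
  qed
  then have "card V * (n - card Fz - 2) \<le> (\<Sum>x\<in>V. card (G x))"
    using sum_bounded_below[of V "n - card Fz - 2" "\<lambda>x. card (G x)"] by simp
  also have "\<dots> = card T" unfolding T_def using fin(1) finG by simp
  also have "\<dots> \<le> card T1 + card T2"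
  proof -
    have "T = T1 \<union> T2" by (auto simp: T1_def T2_def)
    then show ?thesis using card_Un_le by metis
  qed
  also have "card T1 \<le> card U"
  proof (rule card_le_inverse[OF fin(2)])
    fix x assume "x \<in> T1"
    then obtain L d g where x: "x = ((L, d), g)" and LV: "(L, d) \<in> V" and g: "g \<in> G (L, d)"
      and A: "d \<notin> row_cycle L (partner L c s d) g c" by (auto simp: T1_def T_def)
    define p q where "p = row_of L c s" and "q = partner L c s d"
    have L: "L \<in> LS" and dI: "d \<in> ints Fz c s L" using V[OF LV] by auto
    have I: "intercalate L p q c d" and pc: "L p c = s" using ints_intercalate[OF L cs dI] by (auto simp: p_def q_def)
    have g': "g \<in> S" "g \<noteq> p" "g \<noteq> q" using g by (auto simp: G_def p_def q_def)
    have A': "d \<notin> row_cycle L q g c" using A by (simp add: q_def)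
    let ?L = "int_break L p q c d g"
    note S = int_S[OF L I g'] and B = int_break_far[OF L I g' A'] and LS' = int_break_LS[OF L I g']
    let ?f = "\<lambda>((L, d), g). (int_break L (row_of L c s) (partner L c s d) c d g, d)"
    let ?h = "\<lambda>(L1, d). let p = row_of L1 c s; q = row_of L1 c (L1 p d); g = row_of L1 d s in ((cycle_switch L1 q g d, d), g)"
    show "?f x \<in> U" using far[OF LV refl refl, of g] g A unfolding x G_def by simp
    have "row_of ?L c s = p" "row_of ?L c (?L p d) = q" "row_of ?L d s = g"
      using row_of_eq[OF LS'] S B g' pc by auto
    then show "?h (?f x) = x" unfolding x using B(4) by (simp add: Let_def p_def q_def)
  qed
  also have "card T2 \<le> card W"
  proof (rule card_le_inverse[OF fin(3)])
    fix x assume "x \<in> T2"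
    then obtain L d g where x: "x = ((L, d), g)" and LV: "(L, d) \<in> V" and g: "g \<in> G (L, d)"
      and A: "d \<in> row_cycle L (partner L c s d) g c" by (auto simp: T2_def T_def)
    define p q where "p = row_of L c s" and "q = partner L c s d"
    have L: "L \<in> LS" and dI: "d \<in> ints Fz c s L" using V[OF LV] by auto
    have I: "intercalate L p q c d" and pc: "L p c = s" using ints_intercalate[OF L cs dI] by (auto simp: p_def q_def)
    have g': "g \<in> S" "g \<noteq> p" "g \<noteq> q" using g by (auto simp: G_def p_def q_def)
    have A': "d \<in> row_cycle L q g c" using A by (simp add: q_def)
    let ?L = "int_break L p q c d g"
    note S = int_S[OF L I g'] and B = int_break_near[OF L I g' A'] and LS' = int_break_LS[OF L I g']
    let ?f = "\<lambda>((L, d), g). (int_break L (row_of L c s) (partner L c s d) c d g, d)"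
    let ?h = "\<lambda>(L1, d). let q = row_of L1 c s; p = row_of L1 d s; g = row_of L1 d (L1 p c)
      in ((int_switch (cycle_switch L1 q g d) p q c d, d), g)"
    show "?f x \<in> W" using near[OF LV refl refl, of g] g A unfolding x G_def by simp
    have "row_of ?L c s = q" "row_of ?L d s = p" "row_of ?L d (?L p c) = g"
      using row_of_eq[OF LS'] S B g' pc by auto
    then show "?h (?f x) = x" unfolding x using B(4) by (simp add: Let_def p_def q_def)
  qed
  finally show ?thesis by simp
qed

text \<open>Both cases stay inside \<open>Om\<close>, so each contributes at most
  \<open>n * card Om\<close>; on average there are about two intercalates through the entry.\<close>

lemma sum_ints_le:
  assumes cs: "c \<in> S" "s \<in> S" and Fz: "Fz \<subseteq> S" and Om: "Om \<subseteq> LS"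
    and inv: "\<And>L L'. L \<in> Om \<Longrightarrow> L' \<in> LS \<Longrightarrow> (\<And>i. i \<in> Fz \<Longrightarrow> L' i = L i) \<Longrightarrow> L' \<in> Om"
    and row: "\<And>L. L \<in> Om \<Longrightarrow> row_of L c s \<notin> Fz"
  shows "(\<Sum>L\<in>Om. card (ints Fz c s L)) * (n - card Fz - 2) \<le> 2 * (n * card Om)"
proof -
  define V where "V = (SIGMA L : Om. ints Fz c s L)"
  have finO: "finite Om" using Om fin_LS finite_subset by blast
  have finI: "finite (ints Fz c s L)" for L by (auto simp: ints_def)
  have brk: "int_break L p q c d g \<in> Om"
    if "(L, d) \<in> V" "p = row_of L c s" "q = partner L c s d" "g \<in> S - Fz - {p, q}" for L d g p q
  proof -
    have L: "L \<in> Om" "L \<in> LS" "d \<in> ints Fz c s L" using that(1) Om by (auto simp: V_def)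
    have I: "intercalate L p q c d" "q \<notin> Fz" using ints_intercalate[OF L(2) cs L(3)] that by auto
    have g: "g \<in> S" "g \<noteq> p" "g \<noteq> q" using that(4) by auto
    show ?thesis
    proof (rule inv[OF L(1) int_break_LS[OF L(2) I(1) g]])
      fix i assume "i \<in> Fz"
      then show "int_break L p q c d g i = L i"
        using int_break_other[OF L(2) I(1) g, of i] row[OF L(1)] I(2) that by auto
    qed
  qed
  have dS: "d \<in> S" if "(L, d) \<in> V" for L d using that by (auto simp: V_def ints_def)
  have "card V * (n - card Fz - 2) \<le> card (Om \<times> S) + card (Om \<times> S)"
    by (rule int_break_count[OF cs Fz]) (use finO finI brk dS Om in \<open>auto simp: V_def\<close>)
  moreover have "card V = (\<Sum>L\<in>Om. card (ints Fz c s L))" unfolding V_def using finO finI by simp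
  ultimately show ?thesis by (simp add: card_cartesian_product mult.commute)
qed

end

section \<open>Completing a cell of a partial square\<close>

text \<open>The rows \<open>R0\<close>, described by \<open>Q\<close>, and the cells of row \<open>r\<close> in the columns \<open>C\<close> are prescribed; the
  symbol \<open>s\<close> is to be brought into the cell \<open>(r, c)\<close>.\<close>

locale closing = latin +
  fixes R0 :: "nat set" and r c s :: nat and C :: "nat set" and v :: "nat \<Rightarrow> nat" and Q :: "(nat \<Rightarrow> nat \<Rightarrow> nat) \<Rightarrow> bool"
  assumes R0: "R0 \<subseteq> S" "r \<in> S" "r \<notin> R0" and c: "c \<in> S" and s: "s \<in> S"
    and C: "C \<subseteq> S" "c \<notin> C" "\<And>j. j \<in> C \<Longrightarrow> v j \<noteq> s"
    and Q_inv: "\<And>L L'. (\<And>i. i \<in> R0 \<Longrightarrow> L' i = L i) \<Longrightarrow> Q L \<Longrightarrow> Q L'"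
    and Q_free: "\<And>L i. L \<in> LS \<Longrightarrow> Q L \<Longrightarrow> i \<in> R0 \<Longrightarrow> L i c \<noteq> s"
begin

definition Base :: "(nat \<Rightarrow> nat \<Rightarrow> nat) set" where
  "Base = {L \<in> LS. Q L \<and> (\<forall>j\<in>C. L r j = v j)}"

definition Op :: "(nat \<Rightarrow> nat \<Rightarrow> nat) set" where "Op = {L \<in> Base. L r c \<noteq> s}"

definition Cl :: "(nat \<Rightarrow> nat \<Rightarrow> nat) set" where "Cl = {L \<in> Base. L r c = s}"

lemma fin_Base: "finite Base" using fin_LS by (simp add: Base_def)

lemma fin_Op: "finite Op" and fin_Cl: "finite Cl" using fin_Base by (simp_all add: Op_def Cl_def)

lemma card_Base: "card Base = card Op + card Cl"
proof -
  have "Base = Op \<union> Cl" "Op \<inter> Cl = {}" by (auto simp: Op_def Cl_def)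
  then show ?thesis using card_Un_disjoint[OF fin_Op fin_Cl] by simp
qed

lemma fin_R0: "finite R0" using R0(1) fin_S finite_subset by blast

lemma fin_C: "finite C" using C(1) fin_S finite_subset by blast

lemma Op_LS: "L \<in> Op \<Longrightarrow> L \<in> LS" by (simp add: Op_def Base_def)

lemma OpI:
  assumes "L \<in> Op" "L' \<in> LS" "\<And>i. i \<in> R0 \<Longrightarrow> L' i = L i" "\<And>j. j \<in> C \<Longrightarrow> L' r j = L r j" "L' r c \<noteq> s"
  shows "L' \<in> Op"
  using assms Q_inv[of L' L] by (auto simp: Op_def Base_def)

lemma ClI:
  assumes "L \<in> Op" "L' \<in> LS" "\<And>i. i \<in> R0 \<Longrightarrow> L' i = L i" "\<And>j. j \<in> C \<Longrightarrow> L' r j = L r j" "L' r c = s"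
  shows "L' \<in> Cl"
  using assms Q_inv[of L' L] by (auto simp: Op_def Cl_def Base_def)

lemma Op_row:
  assumes "L \<in> Op"
  shows "row_of L c s \<in> S" "L (row_of L c s) c = s" "row_of L c s \<notin> insert r R0"
  using row_of[OF Op_LS[OF assms] c s] assms Q_free by (auto simp: Op_def Base_def)

lemma Op_col:
  assumes "L \<in> Op"
  shows "col_of L r s \<in> S" "L r (col_of L r s) = s" "col_of L r s \<noteq> c" "col_of L r s \<notin> C"
  using col_of[OF Op_LS[OF assms] R0(2) s] assms C(3) by (auto simp: Op_def Base_def)

lemma sum_ints_Op:
  "(\<Sum>L\<in>Op. card (ints (insert r R0) c s L)) * (n - card R0 - 3) \<le> 2 * (n * card Op)"
proof -
  have "card (insert r R0) = Suc (card R0)" using R0(3) fin_R0 by simp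
  moreover have "(\<Sum>L\<in>Op. card (ints (insert r R0) c s L)) * (n - card (insert r R0) - 2) \<le> 2 * (n * card Op)"
  proof (rule sum_ints_le[OF c s])
    fix L L' assume "L \<in> Op" "L' \<in> LS" "\<And>i. i \<in> insert r R0 \<Longrightarrow> L' i = L i"
    then show "L' \<in> Op" using OpI[of L L'] by (auto simp: Op_def)
  qed (use R0 Op_LS Op_row in auto)
  ultimately show ?thesis by (simp add: numeral_3_eq_3)
qed

text \<open>Let \<open>d\<close> be the column of \<open>s\<close> in row \<open>r\<close>. Exchanging the entries of row \<open>r\<close> in the columns \<open>c\<close> and
  \<open>d\<close> is obstructed when the entry of row \<open>r\<close> in column \<open>c\<close> occurs in column \<open>d\<close> inside a
  fixed row \<open>i\<close>. Then \<open>d\<close> is the first of a chain of columns; moving \<open>s\<close> along row \<open>r\<close> to a random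
  column either destroys the obstruction or makes \<open>s\<close> hit the next column of the chain. The events of
  hitting the chain for the first time at the \<open>m\<close>-th column are disjoint.\<close>

definition step :: "(nat \<Rightarrow> nat \<Rightarrow> nat) \<Rightarrow> nat \<Rightarrow> nat" where
  "step L k = col_of L (row_of L k s) (L r k)"

definition chain :: "nat \<Rightarrow> nat \<Rightarrow> (nat \<Rightarrow> nat \<Rightarrow> nat) \<Rightarrow> nat" where
  "chain i m L = (step L ^^ m) (col_of L i (L r c))"

definition hit :: "nat \<Rightarrow> nat \<Rightarrow> (nat \<Rightarrow> nat \<Rightarrow> nat) set" where
  "hit i m = {L \<in> Op. chain i m L = col_of L r s \<and> (\<forall>j<m. chain i j L \<noteq> col_of L r s)}"

lemma chain_Suc: "chain i (Suc m) L = step L (chain i m L)"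
  by (simp add: chain_def)

lemma chain_S:
  assumes "L \<in> Op" "i \<in> R0" shows "chain i m L \<in> S"
proof (induction m)
  case 0
  then show ?case using col_of[OF Op_LS[OF assms(1)]] LS_range[OF Op_LS[OF assms(1)]] R0 c assms(2)
    by (auto simp: chain_def)
next
  case (Suc m)
  then show ?case using col_of[OF Op_LS[OF assms(1)]] row_of[OF Op_LS[OF assms(1)]]
      LS_range[OF Op_LS[OF assms(1)]] R0 s by (auto simp: chain_Suc step_def)
qed

lemma hit_disjoint: "m \<noteq> m' \<Longrightarrow> hit i m \<inter> hit i m' = {}"
  by (auto simp: hit_def) (metis linorder_neqE_nat)

text \<open>Moving \<open>s\<close> along row \<open>r\<close> from its column \<open>d\<close> to
  an admissible \<open>e\<close> keeps the chain up to index \<open>m\<close>. Hence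
  \<open>d\<close> is recovered as \<open>chain i m\<close> of the new square and \<open>e\<close>
  as its column of \<open>s\<close>. If a row has to be remembered, the new square lies in
  \<open>hit i (Suc m)\<close>, which gives the term with the factor \<open>n\<close>.\<close>

lemma hit_step:
  assumes i: "i \<in> R0"
  shows "card (hit i m) * (n - (2 + card C + 2 * card R0 + 2 * m)) \<le> card Op + n * card (hit i (Suc m))"
proof -
  \<comment> \<open>Excluded are the columns \<open>d\<close>, \<open>c\<close>, those of
    \<open>C\<close> and of the earlier chain; then those where one of the two repaired rows would
    be fixed; finally those where a repaired row would be the row of \<open>s\<close> in a chain
    column, whose step has to survive.\<close>
  define G where "G = (\<lambda>L. let d = col_of L r s in S - (insert d (insert c C) \<union> (\<lambda>j. chain i j L) ` {..<m}
     \<union> (\<lambda>k. col_of L r (L k d)) ` R0 \<union> (\<lambda>k. col_of L k s) ` R0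
     \<union> (\<lambda>j. col_of L r (L (row_of L (chain i j L) s) d)) ` {..<m}))"
  define T where "T = (SIGMA L : hit i m. G L)"
  define f where "f = (\<lambda>(L, e). swap_entries L r (col_of L r s) e)"
  have finh: "finite (hit i k)" for k using fin_Op by (simp add: hit_def)
  have finG: "finite (G L)" for L by (simp add: G_def Let_def)
  have cardG: "n - (2 + card C + 2 * card R0 + 2 * m) \<le> card (G L)" for L
  proof -
    let ?d = "col_of L r s"
    let ?B = "insert ?d (insert c C) \<union> (\<lambda>j. chain i j L) ` {..<m}
     \<union> (\<lambda>k. col_of L r (L k ?d)) ` R0 \<union> (\<lambda>k. col_of L k s) ` R0
     \<union> (\<lambda>j. col_of L r (L (row_of L (chain i j L) s) ?d)) ` {..<m}"
    have fB: "finite ?B" using fin_R0 fin_C by simp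
    have "card ?B \<le> (2 + card C) + m + card R0 + card R0 + m"
      by (intro order.trans[OF card_Un_le] add_mono order.trans[OF card_image_le])
        (use fin_R0 fin_C in \<open>auto simp: card_insert_if\<close>)
    then have "n - (2 + card C + 2 * card R0 + 2 * m) \<le> card S - card ?B" by simp
    also have "\<dots> \<le> card (G L)" unfolding G_def Let_def by (rule diff_card_le_card_Diff[OF fB])
    finally show ?thesis .
  qed
  have main: "fst (f (L, e)) \<in> Op" "col_of (fst (f (L, e))) r s = e"
      "chain i m (fst (f (L, e))) = col_of L r s"
      "swap_back (fst (f (L, e))) (snd (f (L, e))) r (col_of L r s) e = L"
      "snd (f (L, e)) \<noteq> 0 \<Longrightarrow> fst (f (L, e)) \<in> hit i (Suc m) \<and> snd (f (L, e)) \<in> S"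
    if T: "L \<in> hit i m" "e \<in> G L" for L e
  proof -
    define d where "d = col_of L r s"
    define u w where "u = row_of L e (L r d)" and "w = row_of L d (L r e)"
    obtain L2 g where res: "swap_entries L r d e = (L2, g)" by fastforce
    have LO: "L \<in> Op" and hd: "chain i m L = d" and hne: "\<And>j. j < m \<Longrightarrow> chain i j L \<noteq> d"
      using T(1) by (auto simp: hit_def d_def)
    note L = Op_LS[OF LO]
    have d: "d \<in> S" "L r d = s" "d \<noteq> c" "d \<notin> C" using Op_col[OF LO] by (auto simp: d_def)
    have e: "e \<in> S" "e \<noteq> d" "e \<noteq> c" "e \<notin> C" and e1: "\<And>j. j < m \<Longrightarrow> e \<noteq> chain i j L"
      and e2: "\<And>k. k \<in> R0 \<Longrightarrow> e \<noteq> col_of L r (L k d)" and e3: "\<And>k. k \<in> R0 \<Longrightarrow> e \<noteq> col_of L k s"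
      and e4: "\<And>j. j < m \<Longrightarrow> e \<noteq> col_of L r (L (row_of L (chain i j L) s) d)"
      using T(2) unfolding G_def Let_def d_def[symmetric] by auto
    note A = L R0(2) d(1) e(1) e(2)[symmetric] res u_def w_def
    have U: "u \<in> S" "w \<in> S" "u \<noteq> r" "w \<noteq> r" "L u e = s" "L w d = L r e"
      using swap_entries_uv[OF A] d(2) by auto
    have uR: "u \<notin> R0" using e3 col_of_eq[OF L U(1) e(1) U(5)] by auto
    have wR: "w \<notin> R0" using e2[of w] U(6) col_of_eq[OF L R0(2) e(1), of "L r e"] by auto
    have L2: "L2 \<in> LS" using swap_entries_LS[OF A] .
    have row: "L2 r = (\<lambda>j. if j = d then L r e else if j = e then L r d else L r j)"
      using swap_entries_row[OF A] .
    have oth: "L2 k = L k" if "k \<noteq> r" "k \<noteq> u" "k \<noteq> w" for k using swap_entries_other[OF A that] .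
    have R0eq: "L2 k = L k" if "k \<in> R0" for k using oth[of k] that uR wR R0(3) by auto
    have cc: "L2 r c = L r c" using row d(3) e(3) by simp
    have L2O: "L2 \<in> Op"
      by (rule OpI[OF LO L2 R0eq]) (use row d e cc LO in \<open>auto simp: Op_def\<close>)
    have col: "col_of L2 r s = e" using col_of_eq[OF L2 R0(2) e(1)] row d e by auto
    have ch: "chain i j L2 = chain i j L" if "j \<le> m" for j
      using that
    proof (induction j)
      case 0
      have "i \<in> S" using i R0 by auto
      moreover have "L i (chain i 0 L) = L r c"
        using col_of(2)[OF L \<open>i \<in> S\<close> LS_range[OF L R0(2) c]] by (simp add: chain_def)
      ultimately have "col_of L2 i (L2 r c) = chain i 0 L"
        using col_of_eq[OF L2 _ chain_S[OF LO i, of 0]] R0eq[OF i] cc by auto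
      then show ?case by (simp add: chain_def)
    next
      case (Suc j)
      then have IH: "chain i j L2 = chain i j L" and j: "j < m" by auto
      define k where "k = chain i j L"
      define q where "q = row_of L k s"
      have k: "k \<in> S" "k \<noteq> d" "k \<noteq> e" using chain_S[OF LO i] hne[OF j] e1[OF j] by (auto simp: k_def)
      have q: "q \<in> S" "L q k = s" using row_of[OF L k(1) s] by (auto simp: q_def)
      have "q \<noteq> r" using row_inj[OF L R0(2) d(1) k(1)] d(2) q(2) k(2) by auto
      moreover have "q \<noteq> u" using row_inj[OF L U(1) e(1) k(1)] U(5) q(2) k(3) by auto
      moreover have "q \<noteq> w" using e4[OF j] U(6) col_of_eq[OF L R0(2) e(1), of "L r e"] unfolding k_def[symmetric] q_def[symmetric] by auto
      ultimately have qq: "L2 q = L q" by (rule oth)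
      have "row_of L2 k s = q" using row_of_eq[OF L2 q(1) k(1)] q qq by simp
      moreover have "L2 r k = L r k" using row k by simp
      moreover have "L q (step L k) = L r k" "step L k \<in> S"
        using col_of[OF L q(1) LS_range[OF L R0(2) k(1)]] by (auto simp: step_def q_def)
      ultimately have "step L2 k = step L k"
        using col_of_eq[OF L2 q(1)] qq by (simp add: step_def[of L2])
      then show ?case using IH by (simp add: chain_Suc k_def)
    qed
    have undo: "swap_back L2 g r d e = L" using swap_entries_back[OF A] .
    have tag: "L2 \<in> hit i (Suc m) \<and> g \<in> S" if "g \<noteq> 0"
    proof -
      note t = swap_entries_tag[OF A that]
      have w1: "L2 w d = s" "L2 w e = L2 r d" using t row d e by auto
      have "row_of L2 d s = w" using row_of_eq[OF L2 U(2) d(1) w1(1)] .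
      \<comment> \<open>The intercalate left by the lossy case is exactly one step of the chain,
        from the old column of \<open>s\<close> to the new one.\<close>
      then have "step L2 d = e" using col_of_eq[OF L2 U(2) e(1) w1(2)] by (simp add: step_def)
      then have "chain i (Suc m) L2 = e" using ch[of m] hd by (simp add: chain_Suc)
      moreover have "chain i j L2 \<noteq> e" if "j < Suc m" for j
        using that ch[of j] e1[of j] hd e(2) by (cases "j = m") auto
      ultimately show ?thesis using L2O col t(1) U(1) by (simp add: hit_def)
    qed
    have fe: "f (L, e) = (L2, g)" by (simp add: f_def d_def[symmetric] res)
    show "fst (f (L, e)) \<in> Op" "col_of (fst (f (L, e))) r s = e"
      "chain i m (fst (f (L, e))) = col_of L r s"
      "swap_back (fst (f (L, e))) (snd (f (L, e))) r (col_of L r s) e = L"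
      "snd (f (L, e)) \<noteq> 0 \<Longrightarrow> fst (f (L, e)) \<in> hit i (Suc m) \<and> snd (f (L, e)) \<in> S"
      unfolding fe using L2O col ch[of m] hd undo tag by (auto simp: d_def)
  qed
  have "card (hit i m) * (n - (2 + card C + 2 * card R0 + 2 * m)) \<le> (\<Sum>L\<in>hit i m. card (G L))"
    using sum_bounded_below[of "hit i m" _ "\<lambda>L. card (G L)"] cardG by simp
  also have "\<dots> = card T" unfolding T_def using finh finG by simp
  also have "\<dots> \<le> card (Op \<times> {0} \<union> hit i (Suc m) \<times> S)"
  proof (rule card_le_inverse)
    fix x assume "x \<in> T"
    then obtain L e where x: "x = (L, e)" "L \<in> hit i m" "e \<in> G L" by (auto simp: T_def)
    note M = main[OF x(2,3)]
    show "f x \<in> Op \<times> {0} \<union> hit i (Suc m) \<times> S"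
      unfolding x(1) using M by (cases "snd (f (L, e)) = 0") (auto simp: mem_Times_iff)
    show "(\<lambda>(L2, g). (swap_back L2 g r (chain i m L2) (col_of L2 r s), col_of L2 r s)) (f x) = x"
      unfolding x(1) using M by (simp add: case_prod_beta)
  qed (use fin_Op finh in auto)
  also have "\<dots> \<le> card Op + n * card (hit i (Suc m))"
    by (rule order.trans[OF card_Un_le]) (simp add: card_cartesian_product mult.commute)
  finally show ?thesis .
qed

end

text \<open>Some \<open>m \<le> M\<close> has \<open>a m \<le> t / (M + 1)\<close> by averaging;
  unrolling the recursion down from this \<open>m\<close> bounds \<open>a 0\<close>.\<close>

lemma small_head:
  fixes a :: "nat \<Rightarrow> real"
  assumes rec: "\<And>m. m < M \<Longrightarrow> a m \<le> e * t + b * a (Suc m)" and sum: "(\<Sum>m\<le>M. a m) \<le> t"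
    and pos: "0 \<le> e" "1 \<le> b" "0 \<le> t"
  shows "a 0 \<le> b ^ M * (M * e + 1 / (real M + 1)) * t"
proof -
  have ind: "a 0 \<le> b ^ m * (m * e * t + a m)" if "m \<le> M" for m
    using that
  proof (induction m)
    case (Suc m)
    have "a 0 \<le> b ^ m * (m * e * t + (e * t + b * a (Suc m)))"
      by (rule order.trans[OF Suc.IH]) (use Suc.prems pos in \<open>auto intro!: mult_left_mono rec\<close>)
    also have "\<dots> = b ^ m * ((m + 1) * e * t) + b ^ Suc m * a (Suc m)" by (simp add: algebra_simps)
    also have "b ^ m * ((m + 1) * e * t) \<le> b ^ Suc m * ((m + 1) * e * t)"
      by (intro mult_right_mono power_increasing) (use pos in auto)
    finally show ?case by (simp add: algebra_simps)
  qed simp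
  have "\<exists>m\<le>M. a m \<le> t / (real M + 1)"
  proof (rule ccontr)
    assume "\<not> ?thesis"
    then have "(\<Sum>m\<le>M. t / (real M + 1)) < (\<Sum>m\<le>M. a m)" by (intro sum_strict_mono) auto
    then show False using sum by (simp add: add.commute)
  qed
  then obtain m where m: "m \<le> M" "a m \<le> t / (real M + 1)" by blast
  have "a 0 \<le> b ^ m * (m * e * t + a m)" by (rule ind[OF m(1)])
  also have "\<dots> \<le> b ^ m * (M * e * t + t / (real M + 1))"
    using m pos by (intro mult_left_mono add_mono mult_right_mono) auto
  also have "\<dots> \<le> b ^ M * (M * e * t + t / (real M + 1))"
    using m pos by (intro mult_right_mono power_increasing) auto
  finally show ?thesis by (simp add: algebra_simps)
qed

section \<open>Closing a cell by a cycle switch or by an exchange\<close>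

context closing
begin

definition srow :: "(nat \<Rightarrow> nat \<Rightarrow> nat) \<Rightarrow> nat" where "srow L = row_of L c s"

text \<open>Here the exchange into column \<open>c\<close> would have to change a fixed row.\<close>

definition exceptional :: "(nat \<Rightarrow> nat \<Rightarrow> nat) set" where
  "exceptional = {L \<in> Op. row_of L (col_of L r s) (L r c) \<in> R0}"

text \<open>If row \<open>i\<close> obstructs, the column of \<open>s\<close> in row
  \<open>r\<close> is where row \<open>i\<close> holds \<open>L r c\<close>, so the chain of
  \<open>i\<close> is hit at index 0. Then \<open>small_head\<close> applies, with
  \<open>hit_step\<close> as recursion and the disjointness of the hits bounding the sum.\<close>

lemma card_exceptional:
  fixes M :: nat
  assumes K: "K = 2 + card C + 2 * card R0 + 2 * M" "K < n"
  shows "real (card exceptional) \<le>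
    card R0 * ((n / (n - K)) ^ M * (M / (n - K) + 1 / (real M + 1))) * card Op"
proof -
  have "exceptional \<subseteq> (\<Union>i\<in>R0. hit i 0)"
  proof
    fix L assume L: "L \<in> exceptional"
    define i where "i = row_of L (col_of L r s) (L r c)"
    have LO: "L \<in> Op" and i: "i \<in> R0" using L by (auto simp: exceptional_def i_def)
    note d = Op_col[OF LO]
    have "L i (col_of L r s) = L r c"
      unfolding i_def using row_of[OF Op_LS[OF LO] d(1) LS_range[OF Op_LS[OF LO] R0(2) c]] by simp
    then have "chain i 0 L = col_of L r s"
      unfolding chain_def using col_of_eq[OF Op_LS[OF LO] _ d(1)] i R0 by auto
    then show "L \<in> (\<Union>i\<in>R0. hit i 0)" using LO i by (auto simp: hit_def)
  qed
  moreover have finh: "finite (hit i m)" for i m using fin_Op by (simp add: hit_def)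
  ultimately have "card exceptional \<le> card (\<Union>i\<in>R0. hit i 0)" using fin_R0 by (intro card_mono) auto
  also have "\<dots> \<le> (\<Sum>i\<in>R0. card (hit i 0))" by (rule card_UN_le[OF fin_R0])
  finally have "real (card exceptional) \<le> (\<Sum>i\<in>R0. real (card (hit i 0)))" 
    using of_nat_mono[of "card exceptional" "\<Sum>i\<in>R0. card (hit i 0)", where 'a=real] by simp
  also have "\<dots> \<le> (\<Sum>i\<in>R0. (n / (n - K)) ^ M * (M / (n - K) + 1 / (real M + 1)) * card Op)"
  proof (rule sum_mono)
    fix i assume i: "i \<in> R0"
    have N: "real n - real K > 0" "real (n - K) = real n - real K" using K(2) by auto
    have "real (card (hit i 0)) \<le> (n / (n - K)) ^ M * (M * (1 / (n - K)) + 1 / (real M + 1)) * card Op"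
    proof (rule small_head[where a = "\<lambda>m. real (card (hit i m))"])
      fix m assume m: "m < M"
      have "card (hit i m) * (n - K) \<le> card (hit i m) * (n - (2 + card C + 2 * card R0 + 2 * m))"
        using m K by (intro mult_left_mono) auto
      also have "\<dots> \<le> card Op + n * card (hit i (Suc m))" by (rule hit_step[OF i])
      finally have "real (card (hit i m) * (n - K)) \<le> real (card Op + n * card (hit i (Suc m)))"
        by (simp only: of_nat_le_iff)
      then have "real (card (hit i m)) * real (n - K) \<le> card Op + n * real (card (hit i (Suc m)))"
        by (simp only: of_nat_mult of_nat_add)
      then have "real (card (hit i m)) \<le> (card Op + n * real (card (hit i (Suc m)))) / real (n - K)"
        using K(2) by (simp add: pos_le_divide_eq)
      then show "real (card (hit i m)) \<le> 1 / (n - K) * card Op + n / (n - K) * card (hit i (Suc m))"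
        by (simp add: add_divide_distrib)
    next
      have "(\<Sum>m\<le>M. card (hit i m)) = card (\<Union>m\<le>M. hit i m)"
        using finh hit_disjoint by (intro card_UN_disjoint[symmetric]) auto
      also have "\<dots> \<le> card Op" using fin_Op by (intro card_mono) (auto simp: hit_def)
      finally show "(\<Sum>m\<le>M. real (card (hit i m))) \<le> real (card Op)"
        by (metis of_nat_le_iff of_nat_sum)
    qed (use N in auto)
    then show "real (card (hit i 0)) \<le> (n / (n - K)) ^ M * (M / (n - K) + 1 / (real M + 1)) * card Op" by simp
  qed
  finally show ?thesis by (simp add: mult.assoc)
qed

lemma srow:
  assumes "L \<in> Op"
  shows "srow L \<in> S" "L (srow L) c = s" "srow L \<noteq> r" "srow L \<notin> R0" "r \<noteq> srow L"
  using Op_row[OF assms] by (auto simp: srow_def)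

text \<open>The cycle switch leaves every prescribed cell alone here, and one row out of
  \<open>n\<close> suffices to undo it.\<close>

lemma card_good: "card {L \<in> Op. C \<inter> row_cycle L r (srow L) c = {}} \<le> n * card Cl"
proof -
  have "card {L \<in> Op. C \<inter> row_cycle L r (srow L) c = {}} \<le> card (Cl \<times> S)"
  proof (rule card_le_inverse)
    fix L assume "L \<in> {L \<in> Op. C \<inter> row_cycle L r (srow L) c = {}}"
    then have LO: "L \<in> Op" and C0: "C \<inter> row_cycle L r (srow L) c = {}" by auto
    note p = srow[OF LO]
    note A = Op_LS[OF LO] R0(2) p(1) p(5) c
    have "cycle_switch L r (srow L) c \<in> Cl"
    proof (rule ClI[OF LO cycle_switch_LS[OF A]])
      fix i assume "i \<in> R0"
      then have "i \<noteq> r" "i \<noteq> srow L" using R0(3) p(4) by metis+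
      then show "cycle_switch L r (srow L) c i = L i" by (simp add: cycle_switch_rows(3))
    qed (use p C0 row_cycle_facts(2)[OF A] in \<open>auto simp: cycle_switch_rows\<close>)
    then show "(\<lambda>L. (cycle_switch L r (srow L) c, srow L)) L \<in> Cl \<times> S" using p by simp
    show "(\<lambda>(L', g). cycle_switch L' r g c) ((\<lambda>L. (cycle_switch L r (srow L) c, srow L)) L) = L"
      using cycle_switch_involution[OF A] by simp
  qed (use fin_Cl in auto)
  then show ?thesis by (simp add: card_cartesian_product mult.commute)
qed

text \<open>For \<open>L r c = s\<close> these are the columns of the intercalates through the cell \<open>(r, c)\<close>; otherwise they
  would be, if that cell contained \<open>s\<close>.\<close>

definition virt :: "(nat \<Rightarrow> nat \<Rightarrow> nat) \<Rightarrow> nat set" where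
  "virt L = {j \<in> S - insert c C. row_of L c (L r j) \<notin> R0 \<and> L (row_of L c (L r j)) j = s}"

lemma fin_virt: "finite (virt L)" by (simp add: virt_def)

text \<open>Exchanging the entries of row \<open>r\<close> so that \<open>s\<close> enters column \<open>c\<close> needs an extra row \<open>g\<close> to be remembered
  only when the result contains an intercalate through the new cell. The other intercalates through
  this cell leave a trace \<open>virt\<close> in the original square, so the Cauchy-Schwarz inequality applies.\<close>

lemma open_le_closed:
  assumes Ob: "Ob \<subseteq> Op" and mu: "\<mu> > (0 :: real)"
  shows "real (card Ob) \<le> card exceptional + (1 + (1 + \<mu> / 2)\<^sup>2 / \<mu>) * (n * card Cl)
    + (\<Sum>L\<in>Ob. real (card (virt L))) / \<mu>"
proof -
  define mv where "mv = (\<lambda>L. swap_entries L r c (col_of L r s))"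
  define NE where "NE = Ob - exceptional"
  define N0 N1 where "N0 = {L \<in> NE. snd (mv L) = 0}" and "N1 = {L \<in> NE. snd (mv L) \<noteq> 0}"
  have finOb: "finite Ob" using Ob fin_Op finite_subset by blast
  then have fin: "finite NE" "finite N0" "finite N1" by (auto simp: NE_def N0_def N1_def)
  have main: "fst (mv L) \<in> Cl" "swap_back (fst (mv L)) (snd (mv L)) r c (col_of L r s) = L"
    "snd (mv L) \<noteq> 0 \<Longrightarrow> snd (mv L) \<in> S \<and> col_of L r s \<in> virt (fst (mv L)) \<and>
      card (virt (fst (mv L))) \<le> card (virt L) + 2"
    if LN: "L \<in> NE" for L
  proof -
    define d where "d = col_of L r s"
    define u p where "u = row_of L d (L r c)" and "p = row_of L c (L r d)"
    obtain L2 g where res: "swap_entries L r c d = (L2, g)" by fastforce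
    have LO: "L \<in> Op" using LN Ob by (auto simp: NE_def)
    note L = Op_LS[OF LO]
    have d: "d \<in> S" "L r d = s" "d \<noteq> c" "d \<notin> C" using Op_col[OF LO] by (auto simp: d_def)
    note A = L R0(2) c d(1) d(3)[symmetric] res u_def p_def
    note U = swap_entries_uv[OF A]
    have uR: "u \<notin> R0" using LN LO by (auto simp: NE_def exceptional_def u_def d_def)
    have pR: "p \<notin> R0" using Op_row(3)[OF LO] by (simp add: p_def d(2))
    have L2: "L2 \<in> LS" using swap_entries_LS[OF A] .
    have row: "L2 r = (\<lambda>j. if j = c then L r d else if j = d then L r c else L r j)"
      using swap_entries_row[OF A] .
    have oth: "L2 k = L k" if "k \<noteq> r" "k \<noteq> u" "k \<noteq> p" for k using swap_entries_other[OF A that] .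
    have L2C: "L2 \<in> Cl"
    proof (rule ClI[OF LO L2])
      fix i assume "i \<in> R0"
      then have "i \<noteq> r" "i \<noteq> u" "i \<noteq> p" using R0(3) uR pR by metis+
      then show "L2 i = L i" by (rule oth)
    qed (use row d C in auto)
    have tag: "g \<in> S \<and> d \<in> virt L2 \<and> card (virt L2) \<le> card (virt L) + 2" if g0: "g \<noteq> 0"
    proof -
      note t = swap_entries_tag[OF A g0]
      have "row_of L2 c (L2 r d) = p" using row_of_eq[OF L2 U(2) c] t by simp
      then have 1: "d \<in> virt L2" using t d pR row by (simp add: virt_def)
      \<comment> \<open>Rows other than \<open>r\<close>, \<open>u\<close>, \<open>p\<close> are
        unchanged. For \<open>j\<close> in the left-hand set the partner row cannot be
        \<open>r\<close>; it is \<open>p\<close> only for \<open>j = d\<close>, and it is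
        \<open>u\<close> for at most one column. This is the origin of the summand 2.\<close>
      have "virt L2 - {d, col_of L2 r (L2 u c)} \<subseteq> virt L"
      proof
        fix j assume j: "j \<in> virt L2 - {d, col_of L2 r (L2 u c)}"
        define q where "q = row_of L2 c (L2 r j)"
        have jS: "j \<in> S" "j \<noteq> c" "j \<notin> C" "j \<noteq> d" and q': "q \<notin> R0" "L2 q j = s"
          using j by (auto simp: virt_def q_def)
        have q: "q \<in> S" "L2 q c = L2 r j" using row_of[OF L2 c LS_range[OF L2 R0(2) jS(1)]] by (auto simp: q_def)
        have "q \<noteq> r" using q row_inj[OF L2 R0(2) jS(1) c] jS by auto
        moreover have "q \<noteq> u" using q(2) col_of_eq[OF L2 R0(2) jS(1), of "L2 u c"] j by auto
        moreover have "q \<noteq> p" using q(2) t(3) row_inj[OF L2 R0(2) jS(1) d(1)] jS by auto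
        ultimately have qq: "L2 q = L q" by (rule oth)
        have rj: "L2 r j = L r j" using row jS by simp
        have "row_of L c (L r j) = q" using row_of_eq[OF L q(1) c] q(2) qq rj by simp
        then show "j \<in> virt L" using jS q' qq by (simp add: virt_def)
      qed
      then have "card (virt L2 - {d, col_of L2 r (L2 u c)}) \<le> card (virt L)" by (rule card_mono[OF fin_virt])
      moreover have "card (virt L2) - card {d, col_of L2 r (L2 u c)} \<le> card (virt L2 - {d, col_of L2 r (L2 u c)})"
        by (rule diff_card_le_card_Diff) simp
      moreover have "card {d, col_of L2 r (L2 u c)} \<le> 2" by (simp add: card_insert_if)
      ultimately show ?thesis using 1 t(1) U(1) by simp
    qed
    have mvL: "mv L = (L2, g)" by (simp add: mv_def d_def[symmetric] res)
    show "fst (mv L) \<in> Cl" "swap_back (fst (mv L)) (snd (mv L)) r c (col_of L r s) = L"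
    "snd (mv L) \<noteq> 0 \<Longrightarrow> snd (mv L) \<in> S \<and> col_of L r s \<in> virt (fst (mv L)) \<and>
      card (virt (fst (mv L))) \<le> card (virt L) + 2"
      unfolding mvL using L2C swap_entries_back[OF A] tag by (auto simp: d_def)
  qed
  have "card N0 \<le> card (Cl \<times> S)"
  proof (rule card_le_inverse)
    fix L assume "L \<in> N0"
    then have LN: "L \<in> NE" "snd (mv L) = 0" by (auto simp: N0_def)
    have "L \<in> Op" using LN Ob by (auto simp: NE_def)
    then show "(\<lambda>L. (fst (mv L), col_of L r s)) L \<in> Cl \<times> S" using main(1)[OF LN(1)] Op_col(1) by simp
    show "(\<lambda>(L2, d). swap_back L2 0 r c d) ((\<lambda>L. (fst (mv L), col_of L r s)) L) = L"
      using main(2)[OF LN(1)] LN(2) by simp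
  qed (use fin_Cl in auto)
  then have N0: "real (card N0) \<le> n * card Cl" 
    using of_nat_mono[of "card N0" "n * card Cl", where 'a=real] by (simp add: card_cartesian_product mult.commute)
  define w where "w = (\<lambda>L'. card {L \<in> N1. fst (mv L) = L'})"
  have img: "(\<lambda>L. fst (mv L)) ` N1 \<subseteq> Cl" using main(1) by (auto simp: N1_def)
  \<comment> \<open>A square in the fibre over \<open>L'\<close> is determined by a column in
    \<open>virt L'\<close> and a row, so \<open>w L' \<le> n * card (virt L')\<close>. It also has
    at least \<open>card (virt L') - 2\<close> virtual intercalates itself, so large fibres force
    many of them.\<close>
  have fiber: "\<mu> * w L' - (1 + \<mu> / 2)\<^sup>2 * n \<le> (\<Sum>L | L \<in> N1 \<and> fst (mv L) = L'. real (card (virt L)))"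
    if L': "L' \<in> Cl" for L'
  proof -
    have "n > 0" using c by (auto simp: S_def)
    have "w L' \<le> card (virt L' \<times> S)" unfolding w_def
    proof (rule card_le_inverse)
      fix L assume "L \<in> {L \<in> N1. fst (mv L) = L'}"
      then have LN: "L \<in> NE" "snd (mv L) \<noteq> 0" "fst (mv L) = L'" by (auto simp: N1_def)
      show "(\<lambda>L. (col_of L r s, snd (mv L))) L \<in> virt L' \<times> S" using main(3)[OF LN(1,2)] LN(3) by simp
      show "(\<lambda>(d, g). swap_back L' g r c d) ((\<lambda>L. (col_of L r s, snd (mv L))) L) = L"
        using main(2)[OF LN(1)] LN(3) by simp
    qed (use fin_virt in auto)
    then have "real (w L') \<le> real (card (virt L')) * n"
      using of_nat_mono[of "w L'" "card (virt L') * n", where 'a=real] by (simp add: card_cartesian_product)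
    then have wv: "w L' / n \<le> real (card (virt L'))" using \<open>n > 0\<close> by (simp add: field_simps)
    \<comment> \<open>The Cauchy-Schwarz inequality is used in linearised form: completing the
      square bounds the quadratic term below by a linear one, with \<mu> left free.\<close>
    have "0 \<le> (w L' / n - (1 + \<mu> / 2))\<^sup>2 * n" by simp
    also have "\<dots> = w L' * (w L' / n) - 2 * (1 + \<mu> / 2) * w L' + (1 + \<mu> / 2)\<^sup>2 * n"
      using \<open>n > 0\<close> by (simp add: power2_eq_square field_simps)
    finally have "\<mu> * w L' - (1 + \<mu> / 2)\<^sup>2 * n \<le> w L' * (w L' / n - 2)" by (simp add: algebra_simps)
    also have "\<dots> \<le> w L' * (real (card (virt L')) - 2)" using wv by (intro mult_left_mono) auto
    also have "\<dots> \<le> (\<Sum>L | L \<in> N1 \<and> fst (mv L) = L'. real (card (virt L)))"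
      unfolding w_def
    proof (rule sum_bounded_below)
      fix L assume "L \<in> {L \<in> N1. fst (mv L) = L'}"
      then have LN: "L \<in> NE" "snd (mv L) \<noteq> 0" "fst (mv L) = L'" by (auto simp: N1_def)
      have "card (virt L') \<le> card (virt L) + 2" using main(3)[OF LN(1,2)] LN(3) by simp
      then show "real (card (virt L')) - 2 \<le> real (card (virt L))" by linarith
    qed
    finally show ?thesis .
  qed
  have "(\<Sum>L'\<in>Cl. w L') = (\<Sum>L\<in>N1. 1)"
    unfolding w_def using sum.group[OF fin(3) fin_Cl img, of "\<lambda>_. 1 :: nat"] by simp
  then have sw: "(\<Sum>L'\<in>Cl. real (w L')) = real (card N1)" by (metis card_eq_sum of_nat_sum)
  have "\<mu> * card N1 - (1 + \<mu> / 2)\<^sup>2 * (n * card Cl) = (\<Sum>L'\<in>Cl. \<mu> * w L' - (1 + \<mu> / 2)\<^sup>2 * n)"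
    by (simp add: sum_subtractf sum_distrib_left[symmetric] sw mult.commute mult.left_commute)
  also have "\<dots> \<le> (\<Sum>L'\<in>Cl. \<Sum>L | L \<in> N1 \<and> fst (mv L) = L'. real (card (virt L)))"
    by (rule sum_mono) (rule fiber)
  also have "\<dots> = (\<Sum>L\<in>N1. real (card (virt L)))"
    by (rule sum.group[OF fin(3) fin_Cl img])
  also have "\<dots> \<le> (\<Sum>L\<in>Ob. real (card (virt L)))"
    by (rule sum_mono2[OF finOb]) (auto simp: N1_def NE_def)
  finally have N1: "real (card N1) \<le> (1 + \<mu> / 2)\<^sup>2 / \<mu> * (n * card Cl) + (\<Sum>L\<in>Ob. real (card (virt L))) / \<mu>"
    using mu by (simp add: field_simps)
  have "card Ob \<le> card (exceptional \<union> (N0 \<union> N1))"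
    using finOb fin_Op fin by (intro card_mono) (auto simp: exceptional_def N0_def N1_def NE_def)
  also have "\<dots> \<le> card exceptional + (card N0 + card N1)"
    by (intro order.trans[OF card_Un_le] add_left_mono card_Un_le)
  finally have "real (card Ob) \<le> card exceptional + (card N0 + card N1)"
    by (simp only: of_nat_le_iff of_nat_add[symmetric])
  then show ?thesis using N0 N1 by (simp add: algebra_simps)
qed

definition single :: "(nat \<Rightarrow> nat \<Rightarrow> nat) set" where
  "single = {L \<in> Op. card (C \<inter> row_cycle L r (srow L) c) = 1}"

text \<open>For these pairs there is no arc from \<open>c\<close> to \<open>j\<close>, and switching
  on the cycle of \<open>j\<close> would move a prescribed entry of row \<open>r\<close>. They are
  counted separately.\<close>

definition split_pairs :: "((nat \<Rightarrow> nat \<Rightarrow> nat) \<times> nat) set" where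
  "split_pairs = {(L, j). L \<in> single \<and> j \<in> virt L \<and> j \<notin> row_cycle L r (srow L) c \<and> C \<inter> row_cycle L r (srow L) j \<noteq> {}}"

lemma virt_facts:
  assumes "L \<in> Op" "j \<in> virt L" "q = row_of L c (L r j)"
  shows "j \<in> S" "j \<noteq> c" "j \<notin> C" "q \<in> S" "q \<notin> R0" "L q c = L r j" "L q j = s" "q \<noteq> r" "q \<noteq> srow L" "L r j \<noteq> s"
proof -
  note L = Op_LS[OF assms(1)] and p = srow[OF assms(1)]
  show j: "j \<in> S" "j \<noteq> c" "j \<notin> C" "q \<notin> R0" "L q j = s" using assms(2,3) by (auto simp: virt_def)
  show q: "q \<in> S" "L q c = L r j" using row_of[OF L c LS_range[OF L R0(2) j(1)]] assms(3) by auto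
  show "q \<noteq> r" using q(2) row_inj[OF L R0(2) j(1) c] j(2) by auto
  then show "L r j \<noteq> s" using j(5) col_inj[OF L q(1) R0(2) j(1)] by auto
  then show "q \<noteq> srow L" using q(2) p(2) by auto
qed

text \<open>A virtual intercalate in column \<open>j\<close> is turned into one of two configurations determined by the
  resulting square if \<open>j\<close> and \<open>c\<close> lie on the same cycle of the rows \<open>r\<close> and \<open>srow L\<close>, and into an
  intercalate through the cell of \<open>s\<close> in column \<open>c\<close> otherwise.\<close>

lemma sum_virt:
  "(\<Sum>L\<in>single. card (virt L)) \<le> 2 * card Op + (\<Sum>L\<in>Op. card (ints (insert r R0) c s L)) + card split_pairs"
proof -
  define A where "A = (\<lambda>L j. arc S (L r) (L (srow L)) c j)"
  define T where "T = (SIGMA L : single. virt L)"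
  define T1 where "T1 = {(L, j) \<in> T. j \<in> row_cycle L r (srow L) c \<and> C \<inter> A L j = {}}"
  define T2 where "T2 = {(L, j) \<in> T. j \<in> row_cycle L r (srow L) c \<and> C \<inter> A L j \<noteq> {}}"
  define T3 where "T3 = {(L, j) \<in> T. j \<notin> row_cycle L r (srow L) c \<and> C \<inter> row_cycle L r (srow L) j = {}}"
  have fins: "finite single" using fin_Op by (simp add: single_def)
  have finT: "finite T" unfolding T_def using fins fin_virt by simp
  have sp: "split_pairs \<subseteq> T" by (auto simp: split_pairs_def T_def)
  have finI: "finite (ints Fz x y L)" for Fz x y L by (auto simp: ints_def)
  have c1: "card T1 \<le> card Op"
  proof (rule card_le_inverse[OF fin_Op])
    fix x assume "x \<in> T1"
    then obtain L j where x: "x = (L, j)" and "L \<in> single" and jv: "j \<in> virt L"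
      and jc: "j \<in> row_cycle L r (srow L) c" and CA: "C \<inter> A L j = {}" by (auto simp: T1_def T_def)
    have LO: "L \<in> Op" using \<open>L \<in> single\<close> by (simp add: single_def)
    define p q where "p = srow L" and "q = row_of L c (L r j)"
    note p = srow[OF LO, folded p_def] and q = virt_facts[OF LO jv q_def, folded p_def]
    note Z = Op_LS[OF LO] q(4) R0(2) p(1) c q(1) q(2)[symmetric] q(8,9) p(5) q(6)[symmetric]
      trans[OF p(2) q(7)[symmetric]] jc[folded p_def]
    let ?L = "arc_switch L q r p c j"
    note L1 = arc_switch_LS[OF Z] and rows = arc_switch_rows[OF Z] and vals = arc_switch_vals[OF Z]
    have CA': "k \<notin> arc S (L r) (L p) c j" if "k \<in> C" for k using CA that by (auto simp: A_def p_def)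
    have "?L \<in> Op"
    proof (rule OpI[OF LO L1])
      fix i assume "i \<in> R0" then show "?L i = L i" using rows(4)[of i] q p R0 by auto
    next
      fix k assume "k \<in> C" then show "?L r k = L r k" using vals(5)[OF CA', of k] q by auto
    qed (use vals LO in \<open>simp add: Op_def\<close>)
    then show "(\<lambda>(L, j). arc_switch L (row_of L c (L r j)) r (srow L) c j) x \<in> Op"
      by (simp add: x p_def q_def)
    have "?L r j = s" "?L q c = s" "?L p c = ?L q j" using vals rows(1) q p by auto
    then have "col_of ?L r s = j" "row_of ?L c s = q" "row_of ?L c (?L q j) = p"
      using row_of_eq[OF L1] col_of_eq[OF L1] q p R0 c by auto
    then show "(\<lambda>L1. let j = col_of L1 r s; q = row_of L1 c s in (arc_switch L1 q r (row_of L1 c (L1 q j)) c j, j))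
      ((\<lambda>(L, j). arc_switch L (row_of L c (L r j)) r (srow L) c j) x) = x"
      using arc_switch_involution[OF Z] by (simp add: x p_def q_def Let_def)
  qed
  have c2: "card T2 \<le> card Op"
  proof (rule card_le_inverse[OF fin_Op])
    fix x assume "x \<in> T2"
    then obtain L j where x: "x = (L, j)" and Ls: "L \<in> single" and jv: "j \<in> virt L"
      and jc: "j \<in> row_cycle L r (srow L) c" and CA: "C \<inter> A L j \<noteq> {}" by (auto simp: T2_def T_def)
    have LO: "L \<in> Op" using Ls by (simp add: single_def)
    define p q where "p = srow L" and "q = row_of L c (L r j)"
    note p = srow[OF LO, folded p_def] and q = virt_facts[OF LO jv q_def, folded p_def]
    note Z = Op_LS[OF LO] q(4) R0(2) p(1) c q(1) q(2)[symmetric] q(8,9) p(5) q(6)[symmetric]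
      trans[OF p(2) q(7)[symmetric]] jc[folded p_def]
    let ?L = "arc_switch L q r p c j"
    let ?M = "cycle_switch ?L r p c"
    note L1 = arc_switch_LS[OF Z] and rows = arc_switch_rows[OF Z] and vals = arc_switch_vals[OF Z]
      and arc = arc_switch_arc[OF Z] and cycs = arc_switch_cycle[OF Z]
    note Y = L1 R0(2) p(1,5) c
    note L2 = cycle_switch_LS[OF Y]
    obtain k0 where k0: "C \<inter> row_cycle L r p c = {k0}" using Ls by (auto simp: single_def p_def card_1_singleton_iff)
    \<comment> \<open>The only prescribed column on the cycle is on the arc, so the arc switch
      displaces its entry to row \<open>p\<close>. The following cycle switch brings it back; the
      other prescribed columns are touched by neither.\<close>
    have k0A: "k0 \<in> arc S (L r) (L p) c j" using CA arc(4) k0 by (auto simp: A_def p_def)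
    have "?M \<in> Op"
    proof (rule OpI[OF LO L2])
      fix i assume "i \<in> R0"
      then have "i \<noteq> q" "i \<noteq> r" "i \<noteq> p" using q(5) R0(3) p(4) by metis+
      then show "?M i = L i" using rows(4)[of i] by (simp add: cycle_switch_rows(3))
    next
      fix k assume k: "k \<in> C"
      show "?M r k = L r k"
      proof (cases "k = k0")
        case True
        then have "k \<in> row_cycle ?L r p c" using k0A cycs(1) by auto
        then show ?thesis using vals(6) k0A True by (simp add: cycle_switch_rows)
      next
        case False
        then have "k \<notin> row_cycle L r p c" using k0 k by auto
        then have "k \<notin> row_cycle ?L r p c" "k \<notin> arc S (L r) (L p) c j" using cycs(2) arc(4) by auto
        then show ?thesis using vals(5)[of k] k q by (auto simp: cycle_switch_rows)
      qed
    next
      show "?M r c \<noteq> s" using cycs(1) vals q by (simp add: cycle_switch_rows)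
    qed
    then show "(\<lambda>(L, j). cycle_switch (arc_switch L (row_of L c (L r j)) r (srow L) c j) r (srow L) c) x \<in> Op"
      by (simp add: x p_def q_def)
    have "?M q c = s" "?M r c = L q c" "?M q j = L q c" "?M p j = s"
      using vals rows(1) q p cycs(1) by (auto simp: cycle_switch_rows)
    then have "row_of ?M c s = q" "col_of ?M q (?M r c) = j" "row_of ?M j s = p"
      using row_of_eq[OF L2] col_of_eq[OF L2] q p R0 c by auto
    then show "(\<lambda>M. let q = row_of M c s; j = col_of M q (M r c); p = row_of M j s
      in (arc_switch (cycle_switch M r p c) q r p c j, j))
      ((\<lambda>(L, j). cycle_switch (arc_switch L (row_of L c (L r j)) r (srow L) c j) r (srow L) c) x) = x"
      using arc_switch_involution[OF Z] cycle_switch_involution[OF Y] by (simp add: x p_def q_def Let_def)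
  qed
  have c3: "card T3 \<le> card (SIGMA L : Op. ints (insert r R0) c s L)"
  proof (rule card_le_inverse)
    fix x assume "x \<in> T3"
    then obtain L j where x: "x = (L, j)" and Ls: "L \<in> single" and jv: "j \<in> virt L"
      and jc: "j \<notin> row_cycle L r (srow L) c" and CA: "C \<inter> row_cycle L r (srow L) j = {}" by (auto simp: T3_def T_def)
    have LO: "L \<in> Op" using Ls by (simp add: single_def)
    define p q where "p = srow L" and "q = row_of L c (L r j)"
    note p = srow[OF LO, folded p_def] and q = virt_facts[OF LO jv q_def, folded p_def]
    note Y = Op_LS[OF LO] R0(2) p(1,5) q(1)
    let ?L = "cycle_switch L r p j"
    note L1 = cycle_switch_LS[OF Y]
    have cj: "c \<notin> row_cycle L r p j"
      using row_cycle_sym[OF Op_LS[OF LO] R0(2) p(1,5) c q(1)] jc by (simp add: p_def)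
    have jj: "j \<in> row_cycle L r p j" using row_cycle_facts(2)[OF Y] .
    have "?L \<in> Op"
    proof (rule OpI[OF LO L1])
      fix i assume "i \<in> R0"
      then have "i \<noteq> r" "i \<noteq> p" using R0(3) p(4) by metis+
      then show "?L i = L i" by (simp add: cycle_switch_rows(3))
    next
      fix k assume "k \<in> C" then show "?L r k = L r k" using CA by (auto simp: cycle_switch_rows p_def)
    qed (use cj LO in \<open>simp add: Op_def cycle_switch_rows\<close>)
    moreover have pc: "row_of ?L c s = p" using row_of_eq[OF L1 p(1) c] cj p by (simp add: cycle_switch_rows)
    moreover have pt: "partner ?L c s j = q"
      unfolding partner_def pc using row_of_eq[OF L1 q(4) c] jj q by (simp add: cycle_switch_rows)
    ultimately show "(\<lambda>(L, j). (cycle_switch L r (srow L) j, j)) x \<in> (SIGMA L : Op. ints (insert r R0) c s L)"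
      using q by (simp add: x ints_def p_def[symmetric] cycle_switch_rows)
    show "(\<lambda>(L, j). (cycle_switch L r (row_of L c s) j, j)) ((\<lambda>(L, j). (cycle_switch L r (srow L) j, j)) x) = x"
      using pc cycle_switch_involution[OF Y] by (simp add: x p_def[symmetric])
  qed (use fin_Op finI in auto)
  have "T \<subseteq> (T1 \<union> T2) \<union> (T3 \<union> split_pairs)"
    by (auto simp: T1_def T2_def T3_def T_def split_pairs_def)
  then have "card T \<le> card ((T1 \<union> T2) \<union> (T3 \<union> split_pairs))"
    using finT sp by (intro card_mono) (auto simp: T1_def T2_def T3_def intro: finite_subset)
  also have "\<dots> \<le> (card T1 + card T2) + (card T3 + card split_pairs)"
    by (intro order.trans[OF card_Un_le] add_mono card_Un_le)
  finally have "card T \<le> 2 * card Op + card (SIGMA L : Op. ints (insert r R0) c s L) + card split_pairs"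
    using c1 c2 c3 by linarith
  moreover have "card T = (\<Sum>L\<in>single. card (virt L))" unfolding T_def using fins fin_virt by simp
  moreover have "card (SIGMA L : Op. ints (insert r R0) c s L) = (\<Sum>L\<in>Op. card (ints (insert r R0) c s L))"
    using fin_Op finI by simp
  ultimately show ?thesis by simp
qed

end

text \<open>Chains of 400 columns are used; 807 and 808 are the numbers \<open>2 + card C + 2 * card R0 + 2 * 400\<close> of
  excluded columns in \<open>hit_step\<close> for \<open>card R0 = 2\<close> and \<open>card C\<close> equal to 1 and 2.\<close>

definition large :: "nat \<Rightarrow> bool" where
  "large n \<longleftrightarrow> n > 10000 \<and>
     2 * ((n / real (n - 807)) ^ 400 * (400 / real (n - 807) + 1 / 401)) \<le> 6 / 1000 \<and>
     2 * ((n / real (n - 808)) ^ 400 * (400 / real (n - 808) + 1 / 401)) \<le> 6 / 1000"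

lemma eventually_large: "eventually large sequentially"
proof -
  have lim: "(\<lambda>n. 2 * ((n / real (n - k)) ^ 400 * (400 / real (n - k) + 1 / 401))) \<longlonglongrightarrow> 2 * (1 ^ 400 * (0 + 1 / 401))" for k
  proof (intro tendsto_intros)
    show "(\<lambda>n. n / real (n - k)) \<longlonglongrightarrow> 1"
    proof (rule Lim_transform_eventually)
      show "(\<lambda>n. 1 + real k * (1 / real (n - k))) \<longlonglongrightarrow> 1"
      proof -
        have "(\<lambda>n. 1 / real (n + k - k)) \<longlonglongrightarrow> 0" using lim_1_over_n by simp
        then have "(\<lambda>n. 1 / real (n - k)) \<longlonglongrightarrow> 0" by (rule LIMSEQ_offset[where k = k])
        then have "(\<lambda>n. 1 + real k * (1 / real (n - k))) \<longlonglongrightarrow> 1 + real k * 0" by (intro tendsto_intros)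
        then show ?thesis by simp
      qed
      show "\<forall>\<^sub>F n in sequentially. 1 + real k * (1 / real (n - k)) = n / real (n - k)"
        using eventually_gt_at_top[of k] by eventually_elim (simp add: field_simps)
    qed
    have "(\<lambda>n. 400 / real (n + k - k)) \<longlonglongrightarrow> 0" using lim_const_over_n[of 400] by simp
    then show "(\<lambda>n. 400 / real (n - k)) \<longlonglongrightarrow> 0" by (rule LIMSEQ_offset[where k = k])
  qed
  have "\<forall>\<^sub>F n in sequentially. 2 * ((n / real (n - k)) ^ 400 * (400 / real (n - k) + 1 / 401)) < 6 / 1000" for k
    by (rule order_tendstoD(2)[OF lim]) simp
  from this[of 807] this[of 808] eventually_gt_at_top[of 10000] show ?thesis
    by eventually_elim (simp add: large_def)
qed

context closing
begin

lemma sum_ints_large: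
  assumes "large n" "card R0 = 2"
  shows "real (\<Sum>L\<in>Op. card (ints (insert r R0) c s L)) \<le> 201 / 100 * card Op"
proof -
  let ?s = "\<Sum>L\<in>Op. card (ints (insert r R0) c s L)"
  have n: "n > 10000" using assms by (simp add: large_def)
  have "?s * (n - 5) \<le> 2 * (n * card Op)" using sum_ints_Op by (simp add: assms(2))
  then have "real (?s * (n - 5)) \<le> real (2 * (n * card Op))" by (simp only: of_nat_le_iff)
  then have "real ?s * (real n - 5) \<le> 2 * real n * real (card Op)"
    using n by (simp only: of_nat_mult) (simp add: of_nat_diff)
  also have "\<dots> \<le> 201 / 100 * (real n - 5) * real (card Op)"
    using n by (intro mult_right_mono) auto
  also have "\<dots> = (201 / 100 * card Op) * (real n - 5)" by simp
  finally show ?thesis using n by simp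
qed

lemma exceptional_large:
  assumes "large n" "card R0 = 2" "card C = 1 \<or> card C = 2"
  shows "real (card exceptional) \<le> 6 / 1000 * card Op"
proof -
  define K where "K = 2 + card C + 2 * card R0 + 2 * (400 :: nat)"
  have K: "K = 807 \<or> K = 808" using assms by (auto simp: K_def)
  have "K < n" using K assms(1) by (auto simp: large_def)
  note E = card_exceptional[OF K_def this]
  have "real (card R0) * ((n / (n - K)) ^ 400 * (real (400 :: nat) / (n - K) + 1 / (real (400 :: nat) + 1))) \<le> 6 / 1000"
    using K assms by (auto simp: large_def)
  from mult_right_mono[OF this, of "card Op"] E show ?thesis by linarith
qed

text \<open>A single prescribed column cannot lie on two disjoint cycles, so there are no split
  pairs, and \<open>sum_virt\<close> gives at most 2 + 2.01 virtual intercalates per open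
  square.\<close>

lemma one_obstacle:
  assumes "large n" "card R0 = 2" "C = {k}"
  shows "real (card Op) \<le> 93 / 10 * (n * card Cl)"
proof -
  have "split_pairs = {}"
  proof -
    have False if "(L, j) \<in> split_pairs" for L j
    proof -
      have LO: "L \<in> Op" and j: "j \<in> S" "j \<notin> row_cycle L r (srow L) c"
        and C: "C \<inter> row_cycle L r (srow L) j \<noteq> {}" "card (C \<inter> row_cycle L r (srow L) c) = 1"
        using that by (auto simp: split_pairs_def single_def virt_def)
      have "C \<inter> row_cycle L r (srow L) c \<noteq> {}" using C(2) by (metis card.empty zero_neq_one)
      then have k: "k \<in> row_cycle L r (srow L) j" "k \<in> row_cycle L r (srow L) c" using C(1) assms(3) by auto
      show False
        using row_cycle_disjoint[OF Op_LS[OF LO] R0(2) srow(1,5)[OF LO] c j] k by blast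
    qed
    then show ?thesis by auto
  qed
  then have "(\<Sum>L\<in>single. card (virt L)) \<le> 2 * card Op + (\<Sum>L\<in>Op. card (ints (insert r R0) c s L))"
    using sum_virt by simp
  then have "real (\<Sum>L\<in>single. card (virt L)) \<le> real (2 * card Op + (\<Sum>L\<in>Op. card (ints (insert r R0) c s L)))"
    by (simp only: of_nat_le_iff)
  then have "real (\<Sum>L\<in>single. card (virt L)) \<le> 2 * real (card Op) + real (\<Sum>L\<in>Op. card (ints (insert r R0) c s L))"
    by (simp only: of_nat_add of_nat_mult of_nat_numeral)
  then have virt: "(\<Sum>L\<in>single. real (card (virt L))) \<le> 401 / 100 * card Op"
    using sum_ints_large[OF assms(1,2)] by simp
  have "single \<subseteq> Op" by (auto simp: single_def)
  \<comment> \<open>The value 12 nearly minimises (2 + (1 + x/2)^2 / x) / (1 - 0.006 - 4.01/x),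
    which is below 9.3 there.\<close>
  from open_le_closed[OF this, of 12]
  have "real (card single) \<le> card exceptional + (1 + (1 + 12 / 2)\<^sup>2 / 12) * (n * card Cl) + (\<Sum>L\<in>single. real (card (virt L))) / 12"
    by simp
  moreover have "real (card exceptional) \<le> 6 / 1000 * card Op"
    using exceptional_large[OF assms(1,2)] assms(3) by simp
  moreover have "real (card Op) \<le> n * card Cl + card single"
  proof -
    have "Op \<subseteq> {L \<in> Op. C \<inter> row_cycle L r (srow L) c = {}} \<union> single"
    proof
      fix L assume L: "L \<in> Op"
      have "C \<inter> row_cycle L r (srow L) c = {} \<or> C \<inter> row_cycle L r (srow L) c = {k}" unfolding assms(3) by blast
      then show "L \<in> {L \<in> Op. C \<inter> row_cycle L r (srow L) c = {}} \<union> single"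
        using L unfolding single_def by force
    qed
    then have "card Op \<le> card ({L \<in> Op. C \<inter> row_cycle L r (srow L) c = {}} \<union> single)"
      using fin_Op by (intro card_mono) (auto simp: single_def)
    also have "\<dots> \<le> card {L \<in> Op. C \<inter> row_cycle L r (srow L) c = {}} + card single" by (rule card_Un_le)
    also have "\<dots> \<le> n * card Cl + card single" using card_good by simp
    finally show ?thesis by (simp only: of_nat_le_iff of_nat_add[symmetric])
  qed
  ultimately have "real (card Op) \<le> 6 / 1000 * card Op + (2 + 49 / 12) * (n * card Cl) + 401 / 1200 * card Op"
    using virt by (simp add: power2_eq_square algebra_simps)
  then show ?thesis by (simp add: field_simps)
qed

end

section \<open>Transposition and switching of columns\<close>

context latin
begin

definition transp :: "(nat \<Rightarrow> nat \<Rightarrow> nat) \<Rightarrow> (nat \<Rightarrow> nat \<Rightarrow> nat)" where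
  "transp L = (\<lambda>i\<in>S. \<lambda>j\<in>S. L j i)"

lemma transp_apply [simp]: "i \<in> S \<Longrightarrow> j \<in> S \<Longrightarrow> transp L i j = L j i"
  by (simp add: transp_def)

lemma transp_LS: assumes "L \<in> LS" shows "transp L \<in> LS"
proof -
  have "inj_on (transp L i) S" if "i \<in> S" for i
    using LS_col[OF assms that] that inj_on_cong[of S "transp L i" "\<lambda>j. L j i"] by (simp add: bij_betw_def)
  moreover have "inj_on (\<lambda>i. transp L i j) S" if "j \<in> S" for j
    using LS_row[OF assms that] that inj_on_cong[of S "\<lambda>i. transp L i j" "L j"] by (simp add: bij_betw_def)
  moreover have "transp L \<in> S \<rightarrow>\<^sub>E S \<rightarrow>\<^sub>E S" using LS_range[OF assms] by (auto simp: transp_def)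
  ultimately show ?thesis unfolding LS_iff by blast
qed

lemma LS_eqI:
  assumes "L \<in> LS" "L' \<in> LS" "\<And>j. j \<in> S \<Longrightarrow> L i j = L' i j"
  shows "L i = L' i"
proof (cases "i \<in> S")
  case True
  then have "L i \<in> extensional S" "L' i \<in> extensional S"
    using assms(1,2) unfolding LS_iff by (auto simp: PiE_iff)
  then show ?thesis using assms(3) by (rule extensionalityI)
next
  case False
  then show ?thesis using assms(1,2) unfolding LS_iff by (auto simp: PiE_iff extensional_def)
qed

lemma transp_tr: "L \<in> LS \<Longrightarrow> transp (transp L) = L"
proof
  fix i assume L: "L \<in> LS"
  show "transp (transp L) i = L i"
  proof (cases "i \<in> S")
    case True
    then show ?thesis by (intro LS_eqI[OF transp_LS[OF transp_LS[OF L]] L]) simp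
  next
    case False
    then show ?thesis using L unfolding LS_iff by (auto simp: transp_def PiE_iff extensional_def)
  qed
qed

definition col_switch :: "(nat \<Rightarrow> nat \<Rightarrow> nat) \<Rightarrow> nat \<Rightarrow> nat \<Rightarrow> nat \<Rightarrow> (nat \<Rightarrow> nat \<Rightarrow> nat)" where
  "col_switch L c d p = transp (cycle_switch (transp L) c d p)"

context
  fixes L c d p
  assumes L: "L \<in> LS" and S: "c \<in> S" "d \<in> S" "c \<noteq> d" "p \<in> S"
begin

lemma col_switch_LS: "col_switch L c d p \<in> LS"
  unfolding col_switch_def by (rule transp_LS, rule cycle_switch_LS[OF transp_LS[OF L] S])

lemma col_switch_involution: "col_switch (col_switch L c d p) c d p = L"
  unfolding col_switch_def
  by (simp add: transp_tr L cycle_switch_LS[OF transp_LS[OF L] S] cycle_switch_involution[OF transp_LS[OF L] S])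

lemma col_switch_row:
  "i \<in> S \<Longrightarrow> i \<notin> row_cycle (transp L) c d p \<Longrightarrow> col_switch L c d p i = L i"
  "col_switch L c d p p c = L p d" "col_switch L c d p p d = L p c"
  "i \<in> S \<Longrightarrow> j \<in> S \<Longrightarrow> j \<noteq> c \<Longrightarrow> j \<noteq> d \<Longrightarrow> col_switch L c d p i j = L i j"
proof -
  have val: "col_switch L c d p i j = (if i \<in> row_cycle (transp L) c d p then L i (swap_nat c d j) else L i j)"
    if "i \<in> S" "j \<in> S" for i j
    using that S by (simp add: col_switch_def cycle_switch_def row_switch_def swap_nat_def)
  show "i \<in> S \<Longrightarrow> i \<notin> row_cycle (transp L) c d p \<Longrightarrow> col_switch L c d p i = L i"
    by (rule LS_eqI[OF col_switch_LS L]) (simp add: val)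
  have "p \<in> row_cycle (transp L) c d p" using row_cycle_facts(2)[OF transp_LS[OF L] S] .
  then show "col_switch L c d p p c = L p d" "col_switch L c d p p d = L p c"
    using val S by simp_all
  show "i \<in> S \<Longrightarrow> j \<in> S \<Longrightarrow> j \<noteq> c \<Longrightarrow> j \<noteq> d \<Longrightarrow> col_switch L c d p i j = L i j"
    using val by simp
qed

end

end

section \<open>Subsquares of order 3\<close>

text \<open>Rows \<open>r1\<close>, \<open>r2\<close>, \<open>r\<close> and columns \<open>c1\<close>, \<open>c2\<close>, \<open>c3\<close> of a subsquare with rows
  \<open>a b g\<close>, \<open>b g a\<close>, \<open>g a b\<close>, whose first two rows are given.\<close>

locale pattern = latin +
  fixes r1 r2 r c1 c2 c3 a b g :: nat
  assumes rows: "r1 \<in> S" "r2 \<in> S" "r \<in> S" "r1 \<noteq> r2" "r \<noteq> r1" "r \<noteq> r2"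
    and cols: "c1 \<in> S" "c2 \<in> S" "c3 \<in> S" "c1 \<noteq> c2" "c1 \<noteq> c3" "c2 \<noteq> c3"
    and syms: "a \<in> S" "b \<in> S" "g \<in> S" "a \<noteq> b" "a \<noteq> g" "b \<noteq> g"
begin

definition rect :: "(nat \<Rightarrow> nat \<Rightarrow> nat) \<Rightarrow> bool" where
  "rect L \<longleftrightarrow> L r1 c1 = a \<and> L r1 c2 = b \<and> L r1 c3 = g \<and> L r2 c1 = b \<and> L r2 c2 = g \<and> L r2 c3 = a"

definition one1 :: "(nat \<Rightarrow> nat \<Rightarrow> nat) set" where "one1 = {L \<in> LS. rect L \<and> L r c1 = g}"
definition one2 :: "(nat \<Rightarrow> nat \<Rightarrow> nat) set" where "one2 = {L \<in> LS. rect L \<and> L r c2 = a}"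
definition two :: "(nat \<Rightarrow> nat \<Rightarrow> nat) set" where "two = {L \<in> LS. rect L \<and> L r c1 = g \<and> L r c2 = a \<and> L r c3 \<noteq> b}"
definition three :: "(nat \<Rightarrow> nat \<Rightarrow> nat) set" where "three = {L \<in> LS. rect L \<and> L r c1 = g \<and> L r c2 = a \<and> L r c3 = b}"
text \<open>The third row of the pattern is spread over two rows: \<open>r\<close> holds the middle
  cell, the row of \<open>b\<close> in column \<open>c3\<close> holds the outer two.\<close>

definition apart1 :: "(nat \<Rightarrow> nat \<Rightarrow> nat) set" where
  "apart1 = {L \<in> LS. rect L \<and> L r c2 = a \<and> row_of L c3 b \<noteq> r \<and> L (row_of L c3 b) c1 = g}"
definition apart2 :: "(nat \<Rightarrow> nat \<Rightarrow> nat) set" where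
  "apart2 = {L \<in> LS. rect L \<and> L r c1 = g \<and> row_of L c3 b \<noteq> r \<and> L (row_of L c3 b) c2 = a}"

lemma fin_sets: "finite one1" "finite one2" "finite two" "finite three" "finite apart1" "finite apart2"
  using fin_LS by (simp_all add: one1_def one2_def two_def three_def apart1_def apart2_def)

lemma rect_cong: "L' r1 = L r1 \<Longrightarrow> L' r2 = L r2 \<Longrightarrow> rect L' = rect L"
  by (simp add: rect_def)

sublocale E: closing n "{r1, r2}" r c3 b "{c1, c2}" "\<lambda>j. if j = c1 then g else a" rect
  by unfold_locales (use rows cols syms in \<open>auto simp: rect_def\<close>)

sublocale F1: closing n "{r1, r2}" r c2 a "{c1}" "\<lambda>j. g" rect
  by unfold_locales (use rows cols syms in \<open>auto simp: rect_def\<close>)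

sublocale F2: closing n "{r1, r2}" r c1 g "{c2}" "\<lambda>j. a" rect
  by unfold_locales (use rows cols syms in \<open>auto simp: rect_def\<close>)

lemma E_sets: "E.Op = two" "E.Cl = three"
  using cols by (auto simp: E.Op_def E.Cl_def E.Base_def two_def three_def)

lemma F_sets: "F1.Base = one1" "F1.Cl = two \<union> three" "F2.Base = one2" "F2.Cl = two \<union> three"
  by (auto simp: F1.Base_def F1.Cl_def F2.Base_def F2.Cl_def one1_def one2_def two_def three_def)

lemma card_R: "card {r1, r2} = 2" "card {c1, c2} = 2"
  using rows cols by simp_all

lemma card_two_three: "card (two \<union> three) = card two + card three"
  by (rule card_Un_disjoint[OF fin_sets(3,4)]) (auto simp: two_def three_def)

lemma one_le:
  assumes "large n"
  shows "real (card one1) \<le> (93 / 10 * n + 1) * (card two + card three)"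
    and "real (card one2) \<le> (93 / 10 * n + 1) * (card two + card three)"
  using F1.one_obstacle[OF assms card_R(1) refl] F1.card_Base
    F2.one_obstacle[OF assms card_R(1) refl] F2.card_Base
  unfolding F_sets card_two_three by (simp_all add: algebra_simps)

text \<open>Exchanging the columns \<open>c1\<close> and \<open>c2\<close> on their cycle of rows through \<open>E.srow L\<close>, which avoids the
  rows of the pattern, changes whether these columns lie on the same cycle of the rows \<open>r\<close> and \<open>E.srow L\<close>.\<close>

lemma half: "card two \<le> 2 * card {L \<in> two. c2 \<notin> row_cycle L r (E.srow L) c1}"
proof -
  have "card {L \<in> two. c2 \<in> row_cycle L r (E.srow L) c1} \<le> card {L \<in> two. c2 \<notin> row_cycle L r (E.srow L) c1}"
  proof (rule card_le_inverse[where f = "\<lambda>L. col_switch L c1 c2 (E.srow L)" and h = "\<lambda>L. col_switch L c1 c2 (E.srow L)"])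
    fix L assume "L \<in> {L \<in> two. c2 \<in> row_cycle L r (E.srow L) c1}"
    then have LO: "L \<in> E.Op" and cc: "c2 \<in> row_cycle L r (E.srow L) c1" by (auto simp: E_sets)
    define p where "p = E.srow L"
    note L = E.Op_LS[OF LO] and p = E.srow[OF LO, folded p_def]
    let ?L = "col_switch L c1 c2 p"
    note A = L cols(1,2,4) p(1)
    note L' = col_switch_LS[OF A] and row = col_switch_row[OF A]
    have LT: "L \<in> two" using LO E_sets by simp
    \<comment> \<open>In the columns \<open>c1\<close> and \<open>c2\<close> the rows of the pattern
      carry the same three symbols, so they form a stable set.\<close>
    have U: "row_cycle (transp L) c1 c2 p \<subseteq> S - {r1, r2, r}"
    proof -
      interpret T: two_bij S "transp L c1" "transp L c2" using LS_two_bij[OF transp_LS[OF L]] cols by blast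
      have "stable S (transp L c1) (transp L c2) {r1, r2, r}"
        using LT rows cols by (auto simp: stable_def two_def rect_def)
      from T.stable_Diff[OF T.stable_S this] show ?thesis by (rule T.cycle_subset) (use p in auto)
    qed
    have eq: "?L r1 = L r1" "?L r2 = L r2" "?L r = L r" using row(1) U rows by auto
    have pc: "?L p c3 = b" using row(4)[OF p(1) cols(3)] cols p by simp
    then have pp: "E.srow ?L = p" using row_of_eq[OF L' p(1) cols(3)] by (simp add: E.srow_def)
    have "?L \<in> two" using LT L' eq rect_cong[of ?L L] by (simp add: two_def)
    moreover have "c2 \<notin> cycle S (L r) (?L p) c1"
      by (rule cycle_toggle[OF LS_two_bij[OF L rows(3) p(1)] cols(1,2,4)])
        (use cc row p LS_row[OF L' p(1)] in \<open>auto simp: p_def[symmetric]\<close>)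
    ultimately show "col_switch L c1 c2 (E.srow L) \<in> {L \<in> two. c2 \<notin> row_cycle L r (E.srow L) c1}"
      using eq pp by (simp add: p_def[symmetric])
    show "col_switch (col_switch L c1 c2 (E.srow L)) c1 c2 (E.srow (col_switch L c1 c2 (E.srow L))) = L"
      using pp col_switch_involution[OF A] by (simp add: p_def[symmetric])
  qed (simp add: fin_sets)
  moreover have "card two \<le> card {L \<in> two. c2 \<in> row_cycle L r (E.srow L) c1} + card {L \<in> two. c2 \<notin> row_cycle L r (E.srow L) c1}"
    by (rule order.trans[OF card_mono card_Un_le]) (auto simp: fin_sets)
  ultimately show ?thesis by simp
qed

lemma cols_eq_cycle:
  assumes L: "L \<in> LS" and pq: "p \<in> S" "q \<in> S" "p \<noteq> q" and x: "x \<in> S" "y \<in> row_cycle L p q x"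
  shows "row_cycle L p q y = row_cycle L p q x"
proof
  interpret two_bij S "L p" "L q" using LS_two_bij L pq by blast
  note X = row_cycle_facts[OF L pq x(1)]
  have yS: "y \<in> S" using X(3) x(2) by blast
  note Y = row_cycle_facts[OF L pq yS]
  show "row_cycle L p q y \<subseteq> row_cycle L p q x" by (rule cycle_subset[OF X(1) x(2)])
  have "x \<in> row_cycle L p q y" using row_cycle_sym[OF L pq yS x(1)] x(2) by blast
  then show "row_cycle L p q x \<subseteq> row_cycle L p q y" by (rule cycle_subset[OF Y(1)])
qed

text \<open>Intercalates through the entry \<open>b\<close> of column \<open>c3\<close> are broken
  with the three pattern rows frozen. If the row of \<open>b\<close> is unchanged, the result stays
  in \<open>Ap\<close>. Otherwise this row loses \<open>b\<close> in column \<open>c3\<close> but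
  keeps \<open>vk\<close>, because \<open>d\<close> is neither \<open>c1\<close> nor
  \<open>c2\<close>. Then \<open>d\<close> can be read off as its column of \<open>b\<close>, so
  this case costs \<open>card On\<close> instead of \<open>n * card On\<close>.\<close>

lemma apart_count:
  fixes ci ck vi vk :: nat
  assumes c: "ci \<in> {c1, c2}" "ck \<in> {c1, c2}" and vk: "vk \<in> S"
    and Ap: "Ap = {L \<in> LS. rect L \<and> L r ci = vi \<and> row_of L c3 b \<noteq> r \<and> L (row_of L c3 b) ck = vk}"
    and On: "On = {L \<in> LS. rect L \<and> L r ci = vi}"
    and V: "V = {(L, d). L \<in> Ap \<and> d \<in> ints {r, r1, r2} c3 b L \<and> d \<notin> {c1, c2}}"
  shows "card V * (n - 5) \<le> n * card Ap + card On"
proof -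
  define W where "W = (\<lambda>L. (L, col_of L (row_of L ck vk) b)) ` On"
  have fin: "finite Ap" "finite On" "finite V" "finite W"
  proof -
    show f: "finite Ap" "finite On" using fin_LS by (simp_all add: Ap On)
    then show "finite W" by (simp add: W_def)
    show "finite V" by (rule finite_subset[of _ "Ap \<times> S"]) (use f in \<open>auto simp: V ints_def\<close>)
  qed
  have c': "ck \<in> S" "ck \<noteq> c3" using c cols by auto
  have main: "int_break L p q c3 d h \<in> LS \<and> p \<in> S \<and> p \<notin> {r, r1, r2} \<and> (\<forall>i\<in>{r, r1, r2}. int_break L p q c3 d h i = L i)
      \<and> intercalate L p q c3 d \<and> L p c3 = b \<and> h \<in> S \<and> h \<noteq> p \<and> h \<noteq> q \<and> L p ck = vk \<and> L \<in> Ap \<and> d \<notin> {c1, c2} \<and> L \<in> LS"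
    if "(L, d) \<in> V" "p = row_of L c3 b" "q = partner L c3 b d" "h \<in> S - {r, r1, r2} - {p, q}" for L d p q h
  proof -
    have L: "L \<in> LS" "L \<in> Ap" "rect L" "L r ci = vi" "p \<noteq> r" "L p ck = vk" and d: "d \<in> ints {r, r1, r2} c3 b L" "d \<notin> {c1, c2}"
      using that by (auto simp: V Ap)
    note I = ints_intercalate[OF L(1) cols(3) syms(2) d(1), folded that(2,3)]
    have h: "h \<in> S" "h \<noteq> p" "h \<noteq> q" "h \<notin> {r, r1, r2}" using that(4) by auto
    have p: "p \<in> S" using I(1) by (simp add: intercalate_def)
    have pR: "p \<notin> {r, r1, r2}" using L(3,5) I(2) syms by (auto simp: rect_def)
    have "int_break L p q c3 d h i = L i" if "i \<in> {r, r1, r2}" for i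
      by (rule int_break_other[OF L(1) I(1) h(1-3)]) (use that pR I(3) h(4) in auto)
    then show ?thesis using int_break_LS[OF L(1) I(1) h(1-3)] I L p pR h d by blast
  qed
  have "card V * (n - card {r, r1, r2} - 2) \<le> card (Ap \<times> S) + card W"
  proof (rule int_break_count[OF cols(3) syms(2)])
    fix L d h p q
    assume A: "(L, d) \<in> V" "p = row_of L c3 b" "q = partner L c3 b d" "h \<in> S - {r, r1, r2} - {p, q}"
    note m = main[OF A]
    let ?L = "int_break L p q c3 d h"
    have keep: "?L r = L r" "rect ?L" using m rect_cong[of ?L L] by (auto simp: Ap)
    { assume far: "d \<notin> row_cycle L q h c3"
      have P: "?L p = L p" using int_break_far(1)[of L p q c3 d h] m far by blast
      then have "row_of ?L c3 b = p" using row_of_eq[of ?L p c3] m cols by simp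
      then show "(?L, d) \<in> Ap \<times> S" using m keep P by (auto simp: Ap intercalate_def) }
    { assume near: "d \<in> row_cycle L q h c3"
      have P: "?L p = (\<lambda>j. if j = c3 then L p d else if j = d then L p c3 else L p j)"
        using int_break_near(1)[of L p q c3 d h] m near by blast
      have "?L p ck = vk" using P m c c' by auto
      then have "row_of ?L ck vk = p" using row_of_eq[of ?L p ck] m c' by simp
      moreover have "col_of ?L p b = d" using col_of_eq[of ?L p d] m P by (auto simp: intercalate_def)
      moreover have "?L \<in> On" using m keep by (auto simp: On Ap)
      ultimately show "(?L, d) \<in> W" by (auto simp: W_def) }
  qed (use fin rows V in \<open>auto simp: Ap\<close>)
  moreover have "card W \<le> card On" unfolding W_def by (rule card_image_le[OF fin(2)])
  ultimately show ?thesis using rows by (simp add: card_cartesian_product mult.commute numeral_eq_Suc)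
qed

text \<open>Exactly one of \<open>c1\<close>, \<open>c2\<close> lies on the cycle of
  \<open>c3\<close>, and the other on the cycle of \<open>j\<close>. Switching on the latter moves
  just that pattern entry to the row of \<open>b\<close>, and turns the virtual intercalate into a
  real one.\<close>

lemma split_pairs_le:
  "card E.split_pairs * (n - 5) \<le> n * (card apart1 + card apart2) + (card one1 + card one2)"
proof -
  define V where "V = (\<lambda>Ap. {(L, d). L \<in> Ap \<and> d \<in> ints {r, r1, r2} c3 b L \<and> d \<notin> {c1, c2}})"
  define P where "P = (\<lambda>ck. {(L, j) \<in> E.split_pairs. ck \<in> row_cycle L r (E.srow L) j})"
  have V1: "card (V apart1) * (n - 5) \<le> n * card apart1 + card one2"
    by (rule apart_count[of c2 c1 g]) (use syms in \<open>auto simp: V_def apart1_def one2_def\<close>)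
  have V2: "card (V apart2) * (n - 5) \<le> n * card apart2 + card one1"
    by (rule apart_count[of c1 c2 a]) (use syms in \<open>auto simp: V_def apart2_def one1_def\<close>)
  have finV: "finite (V Ap)" if "finite Ap" for Ap
    by (rule finite_subset[of _ "Ap \<times> S"]) (use that in \<open>auto simp: V_def ints_def\<close>)
  have main: "(cycle_switch L r (E.srow L) j, j) \<in> V Ap \<and>
      cycle_switch (cycle_switch L r (E.srow L) j) r (row_of (cycle_switch L r (E.srow L) j) c3 b) j = L"
    if pair: "(L, j) \<in> P ck" and k: "{ci, ck} = {c1, c2}" and v: "\<And>L. L \<in> two \<Longrightarrow> L r ci = vi \<and> L r ck = vk"
      and Ap: "Ap = {L \<in> LS. rect L \<and> L r ci = vi \<and> row_of L c3 b \<noteq> r \<and> L (row_of L c3 b) ck = vk}"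
    for L j Ap ci ck vi vk
  proof -
    have Ls: "L \<in> E.single" and jv: "j \<in> E.virt L" and jc: "j \<notin> row_cycle L r (E.srow L) c3" and ckj: "ck \<in> row_cycle L r (E.srow L) j"
      using pair by (auto simp: P_def E.split_pairs_def)
    have LO: "L \<in> E.Op" using Ls by (simp add: E.single_def)
    define p q where "p = E.srow L" and "q = row_of L c3 (L r j)"
    note p = E.srow[OF LO, folded p_def] and q = E.virt_facts[OF LO jv q_def, folded p_def]
    note Y = E.Op_LS[OF LO] rows(3) p(1,5) q(1)
    let ?L = "cycle_switch L r p j"
    note L1 = cycle_switch_LS[OF Y]
    have disj: "row_cycle L r p c3 \<inter> row_cycle L r p j = {}"
      using row_cycle_disjoint[OF Y(1-4) cols(3) q(1)] jc by (simp add: p_def)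
    have ck: "ck \<in> row_cycle L r p j" "ck \<notin> row_cycle L r p c3" using ckj disj by (auto simp: p_def)
    have "card ({ci, ck} \<inter> row_cycle L r p c3) = 1" using Ls k by (simp add: E.single_def p_def)
    then have "{ci, ck} \<inter> row_cycle L r p c3 \<noteq> {}" by (metis card.empty zero_neq_one)
    then have "ci \<in> row_cycle L r p c3" using ck(2) by simp
    then have ci: "ci \<notin> row_cycle L r p j" using disj by blast
    have cj: "c3 \<notin> row_cycle L r p j" using disj row_cycle_facts(2)[OF Y(1-4) cols(3)] by blast
    have jj: "j \<in> row_cycle L r p j" using row_cycle_facts(2)[OF Y] .
    have LT: "L \<in> two" using LO E_sets by simp
    have eq: "?L r1 = L r1" "?L r2 = L r2" using p rows by (auto simp: cycle_switch_rows(3))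
    have pc: "row_of ?L c3 b = p" using row_of_eq[OF L1 p(1) cols(3)] cj p by (simp add: cycle_switch_rows)
    have pt: "partner ?L c3 b j = q"
      unfolding partner_def pc using row_of_eq[OF L1 q(4) cols(3)] jj q by (simp add: cycle_switch_rows)
    have "?L \<in> Ap"
      unfolding Ap using L1 eq rect_cong[of ?L L] LT v[OF LT] ci ck pc p(3) by (simp add: two_def cycle_switch_rows)
    moreover have "j \<in> ints {r, r1, r2} c3 b ?L" "j \<notin> {c1, c2}"
      using pt q by (auto simp: ints_def cycle_switch_rows)
    ultimately show ?thesis
      using pc cycle_switch_involution[OF Y] by (simp add: V_def p_def[symmetric])
  qed
  have P1: "card (P c1) \<le> card (V apart1)"
  proof (rule card_le_inverse[OF finV])
    fix x assume "x \<in> P c1"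
    then obtain L j where x: "x = (L, j)" "(L, j) \<in> P c1" by (cases x) auto
    have m: "(cycle_switch L r (E.srow L) j, j) \<in> V apart1 \<and>
      cycle_switch (cycle_switch L r (E.srow L) j) r (row_of (cycle_switch L r (E.srow L) j) c3 b) j = L"
      by (rule main[OF x(2), of c2 a g]) (auto simp: two_def apart1_def)
    show "(\<lambda>(L, j). (cycle_switch L r (E.srow L) j, j)) x \<in> V apart1"
      "(\<lambda>(L, j). (cycle_switch L r (row_of L c3 b) j, j)) ((\<lambda>(L, j). (cycle_switch L r (E.srow L) j, j)) x) = x"
      using m by (simp_all add: x)
  qed (rule fin_sets)
  have P2: "card (P c2) \<le> card (V apart2)"
  proof (rule card_le_inverse[OF finV])
    fix x assume "x \<in> P c2"
    then obtain L j where x: "x = (L, j)" "(L, j) \<in> P c2" by (cases x) auto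
    have m: "(cycle_switch L r (E.srow L) j, j) \<in> V apart2 \<and>
      cycle_switch (cycle_switch L r (E.srow L) j) r (row_of (cycle_switch L r (E.srow L) j) c3 b) j = L"
      by (rule main[OF x(2), of c1 g a]) (auto simp: two_def apart2_def)
    show "(\<lambda>(L, j). (cycle_switch L r (E.srow L) j, j)) x \<in> V apart2"
      "(\<lambda>(L, j). (cycle_switch L r (row_of L c3 b) j, j)) ((\<lambda>(L, j). (cycle_switch L r (E.srow L) j, j)) x) = x"
      using m by (simp_all add: x)
  qed (rule fin_sets)
  have "E.split_pairs = P c1 \<union> P c2" by (auto simp: P_def E.split_pairs_def)
  then have "card E.split_pairs \<le> card (P c1) + card (P c2)" by (metis card_Un_le)
  also have "\<dots> \<le> card (V apart1) + card (V apart2)" using P1 P2 by simp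
  finally have "card E.split_pairs * (n - 5) \<le> (card (V apart1) + card (V apart2)) * (n - 5)" by simp
  also have "\<dots> \<le> n * (card apart1 + card apart2) + (card one1 + card one2)"
    using V1 V2 by (simp add: add_mult_distrib add_mult_distrib2)
  finally show ?thesis .
qed

text \<open>By \<open>half\<close> it suffices to treat squares with \<open>c1\<close> and
  \<open>c2\<close> on different cycles, where at most one of them lies on the cycle of
  \<open>c3\<close>. The \<open>apart\<close> terms are kept, since they are compared with
  \<open>two\<close> only across different patterns.\<close>

lemma last_cell:
  assumes "large n"
  shows "real (card two) / 2 \<le> 2801 / 100 * (n * card three) + 461 / 10000 * card two
    + 101 / 10000 * (real (card apart1) + card apart2) + 188 / 1000 * (real (card two) + card three)"
proof -
  define Ob where "Ob = {L \<in> E.single. c2 \<notin> row_cycle L r (E.srow L) c1}"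
  have n: "n > 10000" using assms by (simp add: large_def)
  have Ob: "Ob \<subseteq> E.Op" "Ob \<subseteq> E.single" by (auto simp: Ob_def E.single_def)
  have finS: "finite E.single" using E.fin_Op by (simp add: E.single_def)
  have "{L \<in> two. c2 \<notin> row_cycle L r (E.srow L) c1} \<subseteq> {L \<in> E.Op. {c1, c2} \<inter> row_cycle L r (E.srow L) c3 = {}} \<union> Ob"
  proof
    fix L assume L: "L \<in> {L \<in> two. c2 \<notin> row_cycle L r (E.srow L) c1}"
    then have LO: "L \<in> E.Op" by (simp add: E_sets)
    note p = E.srow[OF LO]
    have "\<not> (c1 \<in> row_cycle L r (E.srow L) c3 \<and> c2 \<in> row_cycle L r (E.srow L) c3)"
      using cols_eq_cycle[OF E.Op_LS[OF LO] rows(3) p(1,5) cols(3)] L by blast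
    then have "{c1, c2} \<inter> row_cycle L r (E.srow L) c3 = {} \<or> card ({c1, c2} \<inter> row_cycle L r (E.srow L) c3) = 1"
      by (auto simp: Int_insert_left)
    then show "L \<in> {L \<in> E.Op. {c1, c2} \<inter> row_cycle L r (E.srow L) c3 = {}} \<union> Ob"
      using L LO by (auto simp: Ob_def E.single_def)
  qed
  then have "card {L \<in> two. c2 \<notin> row_cycle L r (E.srow L) c1}
    \<le> card ({L \<in> E.Op. {c1, c2} \<inter> row_cycle L r (E.srow L) c3 = {}} \<union> Ob)"
    using E.fin_Op finS by (intro card_mono) (auto simp: Ob_def)
  also have "\<dots> \<le> card {L \<in> E.Op. {c1, c2} \<inter> row_cycle L r (E.srow L) c3 = {}} + card Ob" by (rule card_Un_le)
  also have "\<dots> \<le> n * card three + card Ob" using E.card_good by (simp add: E_sets)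
  finally have "card two \<le> 2 * (n * card three + card Ob)"
    using order.trans[OF half mult_le_mono2] by blast
  then have "real (card two) \<le> real (2 * (n * card three + card Ob))" by (simp only: of_nat_le_iff)
  then have 1: "real (card two) / 2 \<le> n * card three + card Ob" by simp
  \<comment> \<open>The value 100 is close to the minimiser of (2 + (1 + x/2)^2 / x) / (1/2 - 0.006
    - 24.83/x), where 24.83 = 4.01 + 2 * 1.01 + 18.8 collects the bounds below.\<close>
  have 2: "real (card Ob) \<le> card E.exceptional + (1 + (1 + 100 / 2)\<^sup>2 / 100) * (n * card three)
    + (\<Sum>L\<in>Ob. real (card (E.virt L))) / 100"
    using E.open_le_closed[OF Ob(1), of 100] by (simp add: E_sets)
  have 3: "real (card E.exceptional) \<le> 6 / 1000 * card two"
    using E.exceptional_large[OF assms] card_R by (simp add: E_sets)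
  have "(\<Sum>L\<in>Ob. card (E.virt L)) \<le> (\<Sum>L\<in>E.single. card (E.virt L))"
    by (rule sum_mono2[OF finS Ob(2)]) simp
  also have "\<dots> \<le> 2 * card two + (\<Sum>L\<in>E.Op. card (ints (insert r {r1, r2}) c3 b L)) + card E.split_pairs"
    using E.sum_virt by (simp add: E_sets)
  finally have "real (\<Sum>L\<in>Ob. card (E.virt L)) \<le> real (2 * card two
    + (\<Sum>L\<in>E.Op. card (ints (insert r {r1, r2}) c3 b L)) + card E.split_pairs)" by (simp only: of_nat_le_iff)
  also have "\<dots> = 2 * real (card two) + real (\<Sum>L\<in>E.Op. card (ints (insert r {r1, r2}) c3 b L)) + real (card E.split_pairs)"
    by (simp only: of_nat_add of_nat_mult of_nat_numeral)
  also have "\<dots> \<le> 401 / 100 * card two + card E.split_pairs"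
    using E.sum_ints_large[OF assms card_R(1)] by (simp add: E_sets)
  finally have 4: "(\<Sum>L\<in>Ob. real (card (E.virt L))) \<le> 401 / 100 * card two + card E.split_pairs" by simp
  \<comment> \<open>Passing from one completed cell to two costs a factor of order \<open>n\<close>,
    which is cancelled by \<open>n - 5\<close>; 18.8 is twice 9.3 with some slack.\<close>
  have 5: "real (card E.split_pairs) \<le> 101 / 100 * (real (card apart1) + card apart2)
    + 188 / 10 * (real (card two) + card three)"
  proof -
    have "real (card E.split_pairs * (n - 5)) \<le> real (n * (card apart1 + card apart2) + (card one1 + card one2))"
      using split_pairs_le by (simp only: of_nat_le_iff)
    then have "real (card E.split_pairs) * (real n - 5)
      \<le> n * (real (card apart1) + card apart2) + (real (card one1) + card one2)"
      using n by (simp only: of_nat_mult of_nat_add) (simp add: of_nat_diff)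
    also have "\<dots> \<le> n * (real (card apart1) + card apart2) + 2 * ((93 / 10 * n + 1) * (real (card two) + card three))"
      using one_le[OF assms] by simp
    also have "\<dots> \<le> (101 / 100 * (real n - 5)) * (real (card apart1) + card apart2)
      + (188 / 10 * (real n - 5)) * (real (card two) + card three)"
    proof (rule add_mono)
      show "n * (real (card apart1) + card apart2) \<le> (101 / 100 * (real n - 5)) * (real (card apart1) + card apart2)"
        using n by (intro mult_right_mono) auto
      have "2 * (93 / 10 * n + 1) * (real (card two) + card three) \<le> (188 / 10 * (real n - 5)) * (real (card two) + card three)"
        using n by (intro mult_right_mono) auto
      then show "2 * ((93 / 10 * n + 1) * (real (card two) + card three)) \<le> (188 / 10 * (real n - 5)) * (real (card two) + card three)"
        by (simp only: mult.assoc)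
    qed
    also have "\<dots> = (101 / 100 * (real (card apart1) + card apart2) + 188 / 10 * (real (card two) + card three)) * (real n - 5)"
    proof -
      have "(101 / 100 * m) * x + (188 / 10 * m) * y = (101 / 100 * x + 188 / 10 * y) * m" for m x y :: real
        by (simp add: algebra_simps)
      then show ?thesis .
    qed
    finally show ?thesis using n by (simp add: mult_le_cancel_right)
  qed
  have "(1 + (1 + 100 / 2)\<^sup>2 / 100) = (2701 / 100 :: real)" by (simp add: power2_eq_square)
  then show ?thesis using 1 2 3 4 5 by (simp add: algebra_simps)
qed

end

section \<open>Summation over all labelled patterns\<close>

lemma tuple8_cases:
  obtains x1 x2 x3 x4 x5 x6 x7 x8 where "t = (x1, x2, x3, x4, x5, x6, x7, x8)"
  using that[of "fst t" "fst (snd t)" "fst (snd (snd t))" "fst (snd (snd (snd t)))"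
      "fst (snd (snd (snd (snd t))))" "fst (snd (snd (snd (snd (snd t)))))"
      "fst (snd (snd (snd (snd (snd (snd t))))))" "snd (snd (snd (snd (snd (snd (snd t))))))"]
  by simp

lemma tuple9_cases:
  obtains x1 x2 x3 x4 x5 x6 x7 x8 x9 where "t = (x1, x2, x3, x4, x5, x6, x7, x8, x9)"
  using tuple8_cases[of t] by (metis surj_pair)

context latin
begin

definition labels :: "(nat \<times> nat \<times> nat \<times> nat \<times> nat \<times> nat \<times> nat \<times> nat \<times> nat) set" where
  "labels = {(r1, r2, r, c1, c2, c3, a, b, g). pattern n r1 r2 r c1 c2 c3 a b g}"

definition uncurry9 :: "(nat \<Rightarrow> nat \<Rightarrow> nat \<Rightarrow> nat \<Rightarrow> nat \<Rightarrow> nat \<Rightarrow> nat \<Rightarrow> nat \<Rightarrow> nat \<Rightarrow> 'a) \<Rightarrow>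
    nat \<times> nat \<times> nat \<times> nat \<times> nat \<times> nat \<times> nat \<times> nat \<times> nat \<Rightarrow> 'a" where
  "uncurry9 f = (\<lambda>(r1, r2, r, c1, c2, c3, a, b, g). f r1 r2 r c1 c2 c3 a b g)"

lemma uncurry9_simp [simp]: "uncurry9 f (r1, r2, r, c1, c2, c3, a, b, g) = f r1 r2 r c1 c2 c3 a b g"
  by (simp add: uncurry9_def)

abbreviation "ones1 \<equiv> Sigma labels (uncurry9 (pattern.one1 n))"
abbreviation "twos \<equiv> Sigma labels (uncurry9 (pattern.two n))"
abbreviation "threes \<equiv> Sigma labels (uncurry9 (pattern.three n))"
abbreviation "aparts1 \<equiv> Sigma labels (uncurry9 (pattern.apart1 n))"
abbreviation "aparts2 \<equiv> Sigma labels (uncurry9 (pattern.apart2 n))"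

lemma fin_labels: "finite labels"
  by (rule finite_subset[of _ "S \<times> S \<times> S \<times> S \<times> S \<times> S \<times> S \<times> S \<times> S"])
    (auto simp: labels_def pattern_def)

lemma labels_cases:
  assumes "t \<in> labels"
  obtains r1 r2 r c1 c2 c3 a b g where "t = (r1, r2, r, c1, c2, c3, a, b, g)" "pattern n r1 r2 r c1 c2 c3 a b g"
proof -
  obtain r1 r2 r c1 c2 c3 a b g where "t = (r1, r2, r, c1, c2, c3, a, b, g)" by (rule tuple9_cases)
  then show ?thesis using that assms by (simp add: labels_def)
qed

lemma sets_finite:
  assumes "t \<in> labels"
  shows "finite (uncurry9 (pattern.one1 n) t)" "finite (uncurry9 (pattern.two n) t)"
    "finite (uncurry9 (pattern.three n) t)"
proof -
  obtain r1 r2 r c1 c2 c3 a b g where t: "t = (r1, r2, r, c1, c2, c3, a, b, g)" "pattern n r1 r2 r c1 c2 c3 a b g"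
    using labels_cases[OF assms] .
  interpret pattern n r1 r2 r c1 c2 c3 a b g by (rule t)
  show "finite (uncurry9 (pattern.one1 n) t)" "finite (uncurry9 (pattern.two n) t)"
    "finite (uncurry9 (pattern.three n) t)"
    using fin_sets by (simp_all add: t(1))
qed

lemma sets_finite_apart:
  assumes "t \<in> labels"
  shows "finite (uncurry9 (pattern.apart1 n) t)" "finite (uncurry9 (pattern.apart2 n) t)"
proof -
  obtain r1 r2 r c1 c2 c3 a b g where t: "t = (r1, r2, r, c1, c2, c3, a, b, g)" "pattern n r1 r2 r c1 c2 c3 a b g"
    using labels_cases[OF assms] .
  interpret pattern n r1 r2 r c1 c2 c3 a b g by (rule t)
  show "finite (uncurry9 (pattern.apart1 n) t)" "finite (uncurry9 (pattern.apart2 n) t)"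
    using fin_sets by (simp_all add: t(1))
qed

lemma finite_confs: "finite ones1" "finite twos" "finite threes"
  using fin_labels sets_finite by auto

lemma card_sum_real:
  "real (card ones1) = (\<Sum>t\<in>labels. real (card (uncurry9 (pattern.one1 n) t)))"
  "real (card twos) = (\<Sum>t\<in>labels. real (card (uncurry9 (pattern.two n) t)))"
  "real (card threes) = (\<Sum>t\<in>labels. real (card (uncurry9 (pattern.three n) t)))"
  "real (card aparts1) = (\<Sum>t\<in>labels. real (card (uncurry9 (pattern.apart1 n) t)))"
  "real (card aparts2) = (\<Sum>t\<in>labels. real (card (uncurry9 (pattern.apart2 n) t)))"
  using fin_labels sets_finite sets_finite_apart by simp_all

lemma pattern_iff:
  "pattern n r1 r2 r c1 c2 c3 a b g \<longleftrightarrow> {r1, r2, r, c1, c2, c3, a, b, g} \<subseteq> S \<and> r1 \<noteq> r2 \<and> r \<noteq> r1 \<and> r \<noteq> r2 \<and>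
    c1 \<noteq> c2 \<and> c1 \<noteq> c3 \<and> c2 \<noteq> c3 \<and> a \<noteq> b \<and> a \<noteq> g \<and> b \<noteq> g"
  unfolding pattern_def by auto

lemma conf_iff:
  "((r1, r2, r, c1, c2, c3, a, b, g), L) \<in> ones1 \<longleftrightarrow> pattern n r1 r2 r c1 c2 c3 a b g \<and> L \<in> LS \<and>
     pattern.rect r1 r2 c1 c2 c3 a b g L \<and> L r c1 = g" (is ?A)
  "((r1, r2, r, c1, c2, c3, a, b, g), L) \<in> twos \<longleftrightarrow> pattern n r1 r2 r c1 c2 c3 a b g \<and> L \<in> LS \<and>
     pattern.rect r1 r2 c1 c2 c3 a b g L \<and> L r c1 = g \<and> L r c2 = a \<and> L r c3 \<noteq> b" (is ?B)
  "((r1, r2, r, c1, c2, c3, a, b, g), L) \<in> threes \<longleftrightarrow> pattern n r1 r2 r c1 c2 c3 a b g \<and> L \<in> LS \<and>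
     pattern.rect r1 r2 c1 c2 c3 a b g L \<and> L r c1 = g \<and> L r c2 = a \<and> L r c3 = b" (is ?C)
  "((r1, r2, r, c1, c2, c3, a, b, g), L) \<in> aparts1 \<longleftrightarrow> pattern n r1 r2 r c1 c2 c3 a b g \<and> L \<in> LS \<and>
     pattern.rect r1 r2 c1 c2 c3 a b g L \<and> L r c2 = a \<and> row_of L c3 b \<noteq> r \<and> L (row_of L c3 b) c1 = g" (is ?D)
  "((r1, r2, r, c1, c2, c3, a, b, g), L) \<in> aparts2 \<longleftrightarrow> pattern n r1 r2 r c1 c2 c3 a b g \<and> L \<in> LS \<and>
     pattern.rect r1 r2 c1 c2 c3 a b g L \<and> L r c1 = g \<and> row_of L c3 b \<noteq> r \<and> L (row_of L c3 b) c2 = a" (is ?E)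
proof -
  have "?A \<and> ?B \<and> ?C \<and> ?D \<and> ?E"
  proof (cases "pattern n r1 r2 r c1 c2 c3 a b g")
    case True
    then interpret pattern n r1 r2 r c1 c2 c3 a b g .
    show ?thesis using True
      by (auto simp: labels_def one1_def two_def three_def apart1_def apart2_def)
  qed (auto simp: labels_def)
  then show ?A ?B ?C ?D ?E by auto
qed

lemma rect_iff:
  assumes "pattern n r1 r2 r c1 c2 c3 a b g"
  shows "pattern.rect r1 r2 c1 c2 c3 a b g L \<longleftrightarrow>
    L r1 c1 = a \<and> L r1 c2 = b \<and> L r1 c3 = g \<and> L r2 c1 = b \<and> L r2 c2 = g \<and> L r2 c3 = a"
  using pattern.rect_def[OF assms] .

text \<open>The three cells of the last row are cyclically equivalent.\<close>

lemma aparts2_le: "card aparts2 \<le> card twos"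
proof (rule card_le_inverse)
  let ?f = "\<lambda>((r1, r2, r, c1, c2, c3, a, b, g), L). ((r1, r2, row_of L c3 b, c2, c3, c1, b, g, a), L)"
  let ?h = "\<lambda>((r1, r2, r, c1, c2, c3, a, b, g), L). ((r1, r2, row_of L c3 b, c3, c1, c2, g, a, b), L)"
  show "finite twos" by (rule finite_confs)
  fix x assume x0: "x \<in> aparts2"
  obtain t L where "x = (t, L)" by fastforce
  moreover obtain r1 r2 r c1 c2 c3 a b g where "t = (r1, r2, r, c1, c2, c3, a, b, g)" by (rule tuple9_cases)
  ultimately have x: "x = ((r1, r2, r, c1, c2, c3, a, b, g), L)" by simp
  have P: "pattern n r1 r2 r c1 c2 c3 a b g" and L: "L \<in> LS" and "pattern.rect r1 r2 c1 c2 c3 a b g L"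
    and E: "L r c1 = g" "row_of L c3 b \<noteq> r" "L (row_of L c3 b) c2 = a"
    using x0 by (simp_all add: x conf_iff del: mem_Sigma_iff)
  then have R: "L r1 c1 = a" "L r1 c2 = b" "L r1 c3 = g" "L r2 c1 = b" "L r2 c2 = g" "L r2 c3 = a"
    using rect_iff by blast+
  note P' = P[unfolded pattern_iff]
  define p where "p = row_of L c3 b"
  have p: "p \<in> S" "L p c3 = b" using row_of[OF L] P' by (auto simp: p_def)
  have pn: "p \<noteq> r1" "p \<noteq> r2" using p R P' by auto
  have ne: "L p c1 \<noteq> g" using col_inj[OF L p(1), of r c1] E P' by (auto simp: p_def)
  have Pn: "pattern n r1 r2 p c2 c3 c1 b g a" using P' p pn unfolding pattern_iff by auto
  show "?f x \<in> twos"
    using Pn L R p E ne by (simp add: x conf_iff rect_iff[OF Pn] p_def[symmetric] del: mem_Sigma_iff)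
  have "row_of L c1 g = r" using row_of_eq[OF L _ _ E(1)] P' by auto
  then show "?h (?f x) = x" by (simp add: x)
qed

text \<open>The columns and symbols are rotated in the direction opposite to that of
  \<open>aparts2_le\<close>; the lost row \<open>r\<close> is the row of \<open>a\<close> in column
  \<open>c2\<close>.\<close>

lemma aparts1_le: "card aparts1 \<le> card twos"
proof (rule card_le_inverse)
  let ?f = "\<lambda>((r1, r2, r, c1, c2, c3, a, b, g), L). ((r1, r2, row_of L c3 b, c3, c1, c2, g, a, b), L)"
  let ?h = "\<lambda>((r1, r2, r, c1, c2, c3, a, b, g), L). ((r1, r2, row_of L c3 b, c2, c3, c1, b, g, a), L)"
  show "finite twos" by (rule finite_confs)
  fix x assume x0: "x \<in> aparts1"
  obtain t L where "x = (t, L)" by fastforce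
  moreover obtain r1 r2 r c1 c2 c3 a b g where "t = (r1, r2, r, c1, c2, c3, a, b, g)" by (rule tuple9_cases)
  ultimately have x: "x = ((r1, r2, r, c1, c2, c3, a, b, g), L)" by simp
  have P: "pattern n r1 r2 r c1 c2 c3 a b g" and L: "L \<in> LS" and "pattern.rect r1 r2 c1 c2 c3 a b g L"
    and E: "L r c2 = a" "row_of L c3 b \<noteq> r" "L (row_of L c3 b) c1 = g"
    using x0 by (simp_all add: x conf_iff del: mem_Sigma_iff)
  then have R: "L r1 c1 = a" "L r1 c2 = b" "L r1 c3 = g" "L r2 c1 = b" "L r2 c2 = g" "L r2 c3 = a"
    using rect_iff by blast+
  note P' = P[unfolded pattern_iff]
  define p where "p = row_of L c3 b"
  have p: "p \<in> S" "L p c3 = b" using row_of[OF L] P' by (auto simp: p_def)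
  have pn: "p \<noteq> r1" "p \<noteq> r2" using p R P' by auto
  have ne: "L p c2 \<noteq> a" using col_inj[OF L p(1), of r c2] E P' by (auto simp: p_def)
  have Pn: "pattern n r1 r2 p c3 c1 c2 g a b" using P' p pn unfolding pattern_iff by auto
  show "?f x \<in> twos"
    using Pn L R p E ne by (simp add: x conf_iff rect_iff[OF Pn] p_def[symmetric] del: mem_Sigma_iff)
  have "row_of L c2 a = r" using row_of_eq[OF L _ _ E(1)] P' by auto
  then show "?h (?f x) = x" by (simp add: x)
qed

text \<open>After summation both \<open>apart\<close> families are absorbed by \<open>twos\<close>,
  and 0.2457 = 1/2 - 0.0461 - 2 * 0.0101 - 0.188 remains on the left.\<close>

lemma twos_le:
  assumes "large n"
  shows "2457 / 10000 * card twos \<le> (2801 / 100 * n + 188 / 1000) * card threes"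
proof -
  have "real (card twos) / 2 = (\<Sum>t\<in>labels. real (card (uncurry9 (pattern.two n) t)) / 2)"
    unfolding card_sum_real by (simp add: sum_divide_distrib)
  also have "\<dots> \<le> (\<Sum>t\<in>labels. 2801 / 100 * (n * card (uncurry9 (pattern.three n) t))
    + 461 / 10000 * card (uncurry9 (pattern.two n) t)
    + 101 / 10000 * (real (card (uncurry9 (pattern.apart1 n) t)) + card (uncurry9 (pattern.apart2 n) t))
    + 188 / 1000 * (real (card (uncurry9 (pattern.two n) t)) + card (uncurry9 (pattern.three n) t)))"
  proof (rule sum_mono)
    fix t assume "t \<in> labels"
    then obtain r1 r2 r c1 c2 c3 a b g
      where t: "t = (r1, r2, r, c1, c2, c3, a, b, g)" "pattern n r1 r2 r c1 c2 c3 a b g" by (rule labels_cases)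
    show "real (card (uncurry9 (pattern.two n) t)) / 2 \<le> 2801 / 100 * (n * card (uncurry9 (pattern.three n) t))
    + 461 / 10000 * card (uncurry9 (pattern.two n) t)
    + 101 / 10000 * (real (card (uncurry9 (pattern.apart1 n) t)) + card (uncurry9 (pattern.apart2 n) t))
    + 188 / 1000 * (real (card (uncurry9 (pattern.two n) t)) + card (uncurry9 (pattern.three n) t))"
      using pattern.last_cell[OF t(2) assms] by (simp only: t(1) uncurry9_simp)
  qed
  also have "\<dots> = 2801 / 100 * (n * card threes) + 461 / 10000 * card twos
    + 101 / 10000 * (real (card aparts1) + card aparts2) + 188 / 1000 * (real (card twos) + card threes)"
    by (simp only: card_sum_real of_nat_mult sum.distrib sum_distrib_left distrib_left)
  also have "\<dots> \<le> 2801 / 100 * (n * card threes) + 461 / 10000 * card twos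
    + 101 / 10000 * (real (card twos) + card twos) + 188 / 1000 * (real (card twos) + card threes)"
    using aparts1_le aparts2_le by (intro add_mono mult_left_mono) auto
  finally have "real (card twos) / 2 \<le> 2801 / 100 * (real n * card threes) + 461 / 10000 * card twos
    + 101 / 10000 * (real (card twos) + card twos) + 188 / 1000 * (real (card twos) + card threes)"
    by (simp only: of_nat_mult)
  moreover have "(2801 / 100 * real n + 188 / 1000) * card threes = 2801 / 100 * (real n * card threes) + 188 / 1000 * card threes"
    by (simp only: distrib_right mult.assoc)
  moreover have "2457 / 10000 * x \<le> 2801 / 100 * z + 188 / 1000 * y"
    if "x / 2 \<le> 2801 / 100 * z + 461 / 10000 * x + 101 / 10000 * (x + x) + 188 / 1000 * (x + y)" for x y z :: real
    using that by (simp add: field_simps)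
  ultimately show ?thesis by metis
qed

lemma ones1_le:
  assumes "large n"
  shows "real (card ones1) \<le> (93 / 10 * n + 1) * (real (card twos) + card threes)"
proof -
  have "real (card ones1) \<le> (\<Sum>t\<in>labels. (93 / 10 * n + 1) *
    (real (card (uncurry9 (pattern.two n) t)) + card (uncurry9 (pattern.three n) t)))"
    unfolding card_sum_real(1)
  proof (rule sum_mono)
    fix t assume "t \<in> labels"
    then obtain r1 r2 r c1 c2 c3 a b g
      where t: "t = (r1, r2, r, c1, c2, c3, a, b, g)" "pattern n r1 r2 r c1 c2 c3 a b g" by (rule labels_cases)
    show "real (card (uncurry9 (pattern.one1 n) t)) \<le> (93 / 10 * n + 1) *
      (real (card (uncurry9 (pattern.two n) t)) + card (uncurry9 (pattern.three n) t))"
      using pattern.one_le(1)[OF t(2) assms] by (simp add: t(1))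
  qed
  also have "\<dots> = (93 / 10 * n + 1) * (real (card twos) + card threes)"
    unfolding card_sum_real by (simp only: sum.distrib sum_distrib_left distrib_left)
  finally show ?thesis .
qed

section \<open>The first hard cell: closing a 3-cycle between two columns\<close>

definition labels2 :: "(nat \<times> nat \<times> nat \<times> nat \<times> nat \<times> nat \<times> nat \<times> nat) set" where
  "labels2 = {(r1, r2, r, c1, c2, a, b, g). {r1, r2, r, c1, c2, a, b, g} \<subseteq> S \<and> r1 \<noteq> r2 \<and> r \<noteq> r1 \<and> r \<noteq> r2 \<and>
     c1 \<noteq> c2 \<and> a \<noteq> b \<and> a \<noteq> g \<and> b \<noteq> g}"

definition path2 :: "nat \<times> nat \<times> nat \<times> nat \<times> nat \<times> nat \<times> nat \<times> nat \<Rightarrow> (nat \<Rightarrow> nat \<Rightarrow> nat) set" where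
  "path2 = (\<lambda>(r1, r2, r, c1, c2, a, b, g). {L \<in> LS. L r1 c1 = a \<and> L r1 c2 = b \<and> L r2 c1 = b \<and> L r2 c2 = g \<and> L r c1 = g})"

definition cycle2 :: "nat \<times> nat \<times> nat \<times> nat \<times> nat \<times> nat \<times> nat \<times> nat \<Rightarrow> (nat \<Rightarrow> nat \<Rightarrow> nat) set" where
  "cycle2 = (\<lambda>(r1, r2, r, c1, c2, a, b, g). {L \<in> LS. L r1 c1 = a \<and> L r1 c2 = b \<and> L r2 c1 = b \<and> L r2 c2 = g \<and> L r c1 = g \<and> L r c2 = a})"

lemma fin_labels2: "finite labels2"
  by (rule finite_subset[of _ "S \<times> S \<times> S \<times> S \<times> S \<times> S \<times> S \<times> S"]) (auto simp: labels2_def)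

lemma fin_path2: "finite (path2 t)" "finite (cycle2 t)"
  using fin_LS by (auto simp: path2_def cycle2_def split: prod.split)

lemma path2_le:
  assumes "large n" "t \<in> labels2"
  shows "real (card (path2 t)) \<le> (93 / 10 * n + 1) * card (cycle2 t)"
proof -
  obtain r1 r2 r c1 c2 a b g where t: "t = (r1, r2, r, c1, c2, a, b, g)" by (rule tuple8_cases)
  let ?Q = "\<lambda>L. L r1 c1 = a \<and> L r1 c2 = b \<and> L r2 c1 = b \<and> L r2 c2 = g"
  have T: "{r1, r2, r, c1, c2, a, b, g} \<subseteq> S" "r1 \<noteq> r2" "r \<noteq> r1" "r \<noteq> r2" "c1 \<noteq> c2" "a \<noteq> b" "a \<noteq> g" "b \<noteq> g"
    using assms(2) by (simp_all add: labels2_def t)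
  interpret closing n "{r1, r2}" r c2 a "{c1}" "\<lambda>j. g" ?Q
    by unfold_locales (use T in auto)
  have "Base = path2 t" "Cl = cycle2 t" by (auto simp: Base_def Cl_def path2_def cycle2_def t)
  moreover have "real (card Op) \<le> 93 / 10 * (n * card Cl)"
    by (rule one_obstacle[OF assms(1) _ refl]) (use T in auto)
  ultimately show ?thesis using card_Base by (simp add: algebra_simps)
qed

text \<open>Transposition turns a triple of rows that forms a cycle in two columns into a pair of rows that forms a
  cycle in three columns.\<close>

lemma cycle2_le: "card (Sigma labels2 cycle2) \<le> card ones1"
proof (rule card_le_inverse)
  let ?f = "\<lambda>((r1, r2, r, c1, c2, a, b, g), L). ((c1, c2, row_of (transp L) r1 g, r1, r2, r, a, b, g), transp L)"
  let ?h = "\<lambda>((c1, c2, c, r1, r2, r, a, b, g), L). ((r1, r2, r, c1, c2, a, b, g), transp L)"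
  show "finite ones1" by (rule finite_confs)
  fix x assume x0: "x \<in> Sigma labels2 cycle2"
  obtain t L where "x = (t, L)" by fastforce
  moreover obtain r1 r2 r c1 c2 a b g where "t = (r1, r2, r, c1, c2, a, b, g)" by (rule tuple8_cases)
  ultimately have x: "x = ((r1, r2, r, c1, c2, a, b, g), L)" by simp
  have T: "{r1, r2, r, c1, c2, a, b, g} \<subseteq> S" "r1 \<noteq> r2" "r \<noteq> r1" "r \<noteq> r2" "c1 \<noteq> c2" "a \<noteq> b" "a \<noteq> g" "b \<noteq> g"
    and L: "L \<in> LS" "L r1 c1 = a" "L r1 c2 = b" "L r2 c1 = b" "L r2 c2 = g" "L r c1 = g" "L r c2 = a"
    using x0 by (auto simp: x labels2_def cycle2_def)
  define p where "p = row_of (transp L) r1 g"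
  have p: "p \<in> S" "transp L p r1 = g" using row_of[OF transp_LS[OF L(1)]] T by (auto simp: p_def)
  have pn: "p \<noteq> c1" "p \<noteq> c2" using p(2) L T by auto
  have Pn: "pattern n c1 c2 p r1 r2 r a b g" using T p pn unfolding pattern_iff by auto
  show "?f x \<in> ones1"
    using Pn transp_LS[OF L(1)] p T L by (simp add: x conf_iff rect_iff[OF Pn] p_def[symmetric] del: mem_Sigma_iff)
  show "?h (?f x) = x" by (simp add: x transp_tr L)
qed

lemma card_int: "card (SIGMA L : LS. {(r1, c1, c2). r1 \<in> S \<and> c1 \<in> S \<and> c2 \<in> ints {} c1 (L r1 c1) L}) * (n - 2)
  \<le> 2 * n ^ 3 * card LS"
proof -
  let ?T = "SIGMA (c, s) : S \<times> S. SIGMA L : LS. ints {} c s L"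
  have finI: "finite (ints Fz x y L)" for Fz x y L by (auto simp: ints_def)
  have "card (SIGMA L : LS. {(r1, c1, c2). r1 \<in> S \<and> c1 \<in> S \<and> c2 \<in> ints {} c1 (L r1 c1) L}) \<le> card ?T"
  proof (rule card_le_inverse)
    fix x assume "x \<in> (SIGMA L : LS. {(r1, c1, c2). r1 \<in> S \<and> c1 \<in> S \<and> c2 \<in> ints {} c1 (L r1 c1) L})"
    then obtain L r1 c1 c2 where x: "x = (L, r1, c1, c2)" "L \<in> LS" "r1 \<in> S" "c1 \<in> S" "c2 \<in> ints {} c1 (L r1 c1) L"
      by auto
    show "(\<lambda>(L, r1, c1, c2). ((c1, L r1 c1), L, c2)) x \<in> ?T" using x LS_range by auto
    show "(\<lambda>((c1, s), L, c2). (L, row_of L c1 s, c1, c2)) ((\<lambda>(L, r1, c1, c2). ((c1, L r1 c1), L, c2)) x) = x"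
      using x row_of_eq[of L r1 c1] by auto
  qed (use finI fin_LS in auto)
  also have "card ?T = (\<Sum>(c, s)\<in>S \<times> S. \<Sum>L\<in>LS. card (ints {} c s L))"
    using finI fin_LS by (simp add: case_prod_unfold)
  finally have "card (SIGMA L : LS. {(r1, c1, c2). r1 \<in> S \<and> c1 \<in> S \<and> c2 \<in> ints {} c1 (L r1 c1) L}) * (n - 2)
    \<le> (\<Sum>(c, s)\<in>S \<times> S. \<Sum>L\<in>LS. card (ints {} c s L)) * (n - 2)" by simp
  also have "\<dots> = (\<Sum>(c, s)\<in>S \<times> S. (\<Sum>L\<in>LS. card (ints {} c s L)) * (n - 2))"
    by (simp only: sum_distrib_right case_prod_unfold)
  also have "\<dots> \<le> (\<Sum>(c, s)\<in>S \<times> S. 2 * (n * card LS))"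
  proof (rule sum_mono, clarify)
    fix c s assume "c \<in> S" "s \<in> S"
    then show "(\<Sum>L\<in>LS. card (ints {} c s L)) * (n - 2) \<le> 2 * (n * card LS)"
      using sum_ints_le[of c s "{}" LS] by simp
  qed
  also have "\<dots> = 2 * n ^ 3 * card LS"
    by (simp add: card_cartesian_product case_prod_unfold power3_eq_cube)
  finally show ?thesis .
qed

text \<open>A row and two columns determine the remaining labels. The only requirement that can fail
  is that \<open>g\<close> differs from the first symbol, and this failure is an intercalate through
  the cell \<open>(r1, c1)\<close>.\<close>

lemma card_path2:
  "n * (n * (n - 1)) * card LS \<le> card (Sigma labels2 path2) +
    card (SIGMA L : LS. {(r1, c1, c2). r1 \<in> S \<and> c1 \<in> S \<and> c2 \<in> ints {} c1 (L r1 c1) L})"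
proof -
  let ?I = "SIGMA L : LS. {(r1, c1, c2). r1 \<in> S \<and> c1 \<in> S \<and> c2 \<in> ints {} c1 (L r1 c1) L}"
  let ?A = "LS \<times> (S \<times> (SIGMA c1 : S. S - {c1}))"
  have finI: "finite ?I" by (rule finite_subset[of _ "LS \<times> S \<times> S \<times> S"]) (use fin_LS in \<open>auto simp: ints_def\<close>)
  have finP: "finite (Sigma labels2 path2)" using fin_labels2 fin_path2 by simp
  have "card (?A - ?I) \<le> card (Sigma labels2 path2)"
  proof (rule card_le_inverse[OF finP])
    let ?f = "\<lambda>(L, r1, c1, c2). let r2 = row_of L c1 (L r1 c2); g = L r2 c2
      in ((r1, r2, row_of L c1 g, c1, c2, L r1 c1, L r1 c2, g), L)"
    let ?h = "\<lambda>((r1, r2, r, c1, c2, a, b, g), L). (L, r1, c1, c2)"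
    fix x assume "x \<in> ?A - ?I"
    then obtain L r1 c1 c2 where x: "x = (L, r1, c1, c2)" and L: "L \<in> LS" and S: "r1 \<in> S" "c1 \<in> S" "c2 \<in> S" "c2 \<noteq> c1"
      and nint: "c2 \<notin> ints {} c1 (L r1 c1) L" by auto
    define r2 where "r2 = row_of L c1 (L r1 c2)"
    define g where "g = L r2 c2"
    define r where "r = row_of L c1 g"
    have r2: "r2 \<in> S" "L r2 c1 = L r1 c2" using row_of[OF L S(2) LS_range[OF L S(1,3)]] by (auto simp: r2_def)
    have g: "g \<in> S" using LS_range[OF L r2(1) S(3)] by (simp add: g_def)
    have r: "r \<in> S" "L r c1 = g" using row_of[OF L S(2) g] by (auto simp: r_def)
    have ab: "L r1 c1 \<noteq> L r1 c2" using row_inj[OF L S(1-3)] S(4) by auto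
    have r12: "r1 \<noteq> r2" using r2 ab by auto
    have bg: "L r1 c2 \<noteq> g" using row_inj[OF L r2(1) S(2,3)] S(4) r2(2) by (auto simp: g_def)
    have ag: "L r1 c1 \<noteq> g"
      using nint S row_of_eq[OF L S(1,2) refl] by (auto simp: ints_def partner_def g_def r2_def)
    have rr: "r \<noteq> r1" "r \<noteq> r2" using r ag bg r2 by auto
    have "((r1, r2, r, c1, c2, L r1 c1, L r1 c2, g), L) \<in> Sigma labels2 path2"
      using S r2 g r ab r12 bg ag rr L LS_range[OF L S(1)] by (simp add: labels2_def path2_def g_def[symmetric])
    then show "?f x \<in> Sigma labels2 path2" by (simp add: x Let_def r2_def[symmetric] g_def[symmetric] r_def[symmetric])
    show "?h (?f x) = x" by (simp add: x Let_def)
  qed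
  moreover have "card ?A - card ?I \<le> card (?A - ?I)" by (rule diff_card_le_card_Diff[OF finI])
  moreover have "card ?A = n * (n * (n - 1)) * card LS"
    by (simp add: card_cartesian_product card_Diff_singleton)
  ultimately show ?thesis by linarith
qed

text \<open>A subsquare of order 3 is labelled in 18 ways: by one of its rows and an ordering of its columns.\<close>

lemma threes_le: "card threes \<le> 18 * (\<Sum>L\<in>LS. card (subsquares n 3 L))"
proof -
  define T where "T = (SIGMA L : LS. SIGMA (R, D) : subsquares n 3 L. R \<times> (SIGMA c : D. D - {c}))"
  have finsub: "finite (subsquares n 3 L)" for L
    by (rule finite_subset[of _ "Pow {1..n} \<times> Pow {1..n}"]) (auto simp: subsquares_def)
  have RD: "card R = 3 \<and> card D = 3 \<and> finite R \<and> finite D" if "(R, D) \<in> subsquares n 3 L" for R D L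
    using that card.infinite by (fastforce simp: subsquares_def)
  have fib: "finite (R \<times> (SIGMA c : D. D - {c}))" "card (R \<times> (SIGMA c : D. D - {c})) = 18"
    if "(R, D) \<in> subsquares n 3 L" for R D L
    using RD[OF that] by (simp_all add: card_cartesian_product card_Diff_singleton)
  have finT: "finite T" unfolding T_def using fin_LS finsub fib(1) by (intro finite_SigmaI) auto
  have inner: "card (SIGMA (R, D) : subsquares n 3 L. R \<times> (SIGMA c : D. D - {c})) = (\<Sum>x\<in>subsquares n 3 L. 18)" for L
  proof -
    have "card (SIGMA (R, D) : subsquares n 3 L. R \<times> (SIGMA c : D. D - {c}))
      = (\<Sum>(R, D)\<in>subsquares n 3 L. card (R \<times> (SIGMA c : D. D - {c})))"
      using fib finsub by (subst card_SigmaI) (auto simp: case_prod_unfold)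
    also have "\<dots> = (\<Sum>x\<in>subsquares n 3 L. 18)" using fib by (intro sum.cong) auto
    finally show ?thesis .
  qed
  have "card T = (\<Sum>L\<in>LS. card (SIGMA (R, D) : subsquares n 3 L. R \<times> (SIGMA c : D. D - {c})))"
    unfolding T_def using fin_LS finsub fib by (intro card_SigmaI) auto
  then have "card T = (\<Sum>L\<in>LS. \<Sum>x\<in>subsquares n 3 L. 18)" by (simp only: inner)
  then have cT: "card T = 18 * (\<Sum>L\<in>LS. card (subsquares n 3 L))"
    by (simp add: sum_distrib_left mult.commute)
  have "card threes \<le> card T"
  proof (rule card_le_inverse[OF finT])
    let ?f = "\<lambda>((r1, r2, r, c1, c2, c3, a, b, g), L). (L, ({r1, r2, r}, {c1, c2, c3}), (r1, (c1, c2)))"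
    let ?h = "\<lambda>(L, (R, D), (r1, (c1, c2))). let c3 = the_elem (D - {c1, c2}); r2 = row_of L c1 (L r1 c2);
      r = the_elem (R - {r1, r2}) in ((r1, r2, r, c1, c2, c3, L r1 c1, L r1 c2, L r1 c3), L)"
    fix x assume x0: "x \<in> threes"
    obtain t L where "x = (t, L)" by fastforce
    moreover obtain r1 r2 r c1 c2 c3 a b g where "t = (r1, r2, r, c1, c2, c3, a, b, g)" by (rule tuple9_cases)
    ultimately have x: "x = ((r1, r2, r, c1, c2, c3, a, b, g), L)" by simp
    have P: "pattern n r1 r2 r c1 c2 c3 a b g" and L: "L \<in> LS" and "pattern.rect r1 r2 c1 c2 c3 a b g L"
      and E: "L r c1 = g" "L r c2 = a" "L r c3 = b"
      using x0 by (simp_all add: x conf_iff del: mem_Sigma_iff)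
    then have R: "L r1 c1 = a" "L r1 c2 = b" "L r1 c3 = g" "L r2 c1 = b" "L r2 c2 = g" "L r2 c3 = a"
      using rect_iff by blast+
    note P' = P[unfolded pattern_iff]
    have "{L i j |i j. i \<in> {r1, r2, r} \<and> j \<in> {c1, c2, c3}} = {a, b, g}" using R E by auto
    then have "({r1, r2, r}, {c1, c2, c3}) \<in> subsquares n 3 L"
      using P' by (auto simp: subsquares_def S_def)
    then show "?f x \<in> T" using L P' by (auto simp: x T_def)
    have "{c1, c2, c3} - {c1, c2} = {c3}" "{r1, r2, r} - {r1, r2} = {r}" using P' by auto
    moreover have "row_of L c1 b = r2" using row_of_eq[OF L] P' R by auto
    ultimately show "?h (?f x) = x" using R by (simp add: x Let_def)
  qed
  then show ?thesis using cT by simp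
qed

lemma subsquares_lower:
  assumes "large n"
  shows "1 / 219006 \<le> expected_subsquares 3 n"
proof -
  define N where "N = real (card LS)"
  define X where "X = (\<Sum>L\<in>LS. real (card (subsquares n 3 L)))"
  define A B where "A = real (card twos)" and "B = real (card threes)"
  define P where "P = real (card (Sigma labels2 path2))"
  define Z where "Z = real (card (Sigma labels2 cycle2))"
  define I where "I = real (card (SIGMA L : LS. {(r1, c1, c2). r1 \<in> S \<and> c1 \<in> S \<and> c2 \<in> ints {} c1 (L r1 c1) L}))"
  define m where "m = real n"
  have m: "m > 10000" using assms by (simp add: large_def m_def)
  have N0: "N > 0" using latin_squares_nonempty fin_LS by (simp add: N_def card_gt_0_iff)
  have pos: "A \<ge> 0" "B \<ge> 0" "Z \<ge> 0" by (simp_all add: A_def B_def Z_def)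
  have "real (card (SIGMA L : LS. {(r1, c1, c2). r1 \<in> S \<and> c1 \<in> S \<and> c2 \<in> ints {} c1 (L r1 c1) L}) * (n - 2))
    \<le> real (2 * n ^ 3 * card LS)"
    using card_int by (simp only: of_nat_le_iff)
  then have I: "I * (m - 2) \<le> 2 * m ^ 3 * N"
    using m by (simp add: I_def m_def N_def of_nat_diff)
  have "m ^ 3 \<le> 2501 / 2500 * m ^ 2 * (m - 2)"
    using m by (simp add: power2_eq_square power3_eq_cube mult_left_mono)
  then have up: "m ^ 3 * (2 * N) \<le> 2501 / 2500 * m ^ 2 * (m - 2) * (2 * N)"
    by (rule mult_right_mono) (use N0 in simp)
  have "I * (m - 2) \<le> m ^ 3 * (2 * N)" using I by (simp add: mult_ac)
  also note up
  also have "2501 / 2500 * m ^ 2 * (m - 2) * (2 * N) = (2501 / 1250 * m ^ 2 * N) * (m - 2)" by simp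
  finally have "I * (m - 2) \<le> (2501 / 1250 * m ^ 2 * N) * (m - 2)" .
  then have I': "I \<le> 2501 / 1250 * m ^ 2 * N" using m by (simp add: mult_le_cancel_right)
  have "real (n * (n * (n - 1)) * card LS) \<le> real (card (Sigma labels2 path2) +
    card (SIGMA L : LS. {(r1, c1, c2). r1 \<in> S \<and> c1 \<in> S \<and> c2 \<in> ints {} c1 (L r1 c1) L}))"
    using card_path2 by (simp only: of_nat_le_iff)
  then have P: "m * (m * (m - 1)) * N \<le> P + I"
    using m by (simp add: P_def I_def m_def N_def of_nat_diff)
  have "999 / 1000 * m ^ 3 * N \<le> m * (m * (m - 1)) * N - 2501 / 1250 * m ^ 2 * N"
  proof -
    have "999 / 1000 * m \<le> m - 1 - 2501 / 1250" using m by simp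
    then have "m ^ 2 * N * (999 / 1000 * m) \<le> m ^ 2 * N * (m - 1 - 2501 / 1250)"
      using N0 by (intro mult_left_mono) auto
    then show ?thesis by (simp add: power2_eq_square power3_eq_cube algebra_simps)
  qed
  then have 1: "999 / 1000 * m ^ 3 * N \<le> P" using P I' by linarith
  have f: "93 / 10 * m + 1 \<le> 9301 / 1000 * m" using m by simp
  have "P = (\<Sum>t\<in>labels2. real (card (path2 t)))" unfolding P_def using fin_labels2 fin_path2 by simp
  also have "\<dots> \<le> (\<Sum>t\<in>labels2. (93 / 10 * n + 1) * real (card (cycle2 t)))"
    by (rule sum_mono) (rule path2_le[OF assms])
  also have "\<dots> = (93 / 10 * m + 1) * Z"
    unfolding Z_def m_def using fin_labels2 fin_path2 by (simp add: sum_distrib_left)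
  also have "\<dots> \<le> 9301 / 1000 * m * Z" by (rule mult_right_mono[OF f pos(3)])
  finally have 2: "P \<le> 9301 / 1000 * m * Z" .
  have "Z \<le> real (card ones1)" using cycle2_le by (simp add: Z_def)
  also have "\<dots> \<le> (93 / 10 * m + 1) * (A + B)" using ones1_le[OF assms] by (simp add: A_def B_def m_def)
  also have "\<dots> \<le> 9301 / 1000 * m * (A + B)" using f pos by (intro mult_right_mono) auto
  finally have 3: "Z \<le> 9301 / 1000 * m * (A + B)" .
  have "2457 / 10000 * A \<le> (2801 / 100 * m + 188 / 1000) * B"
    using twos_le[OF assms] by (simp add: A_def B_def m_def)
  also have "\<dots> \<le> 28011 / 1000 * m * B" using m pos by (intro mult_right_mono) auto
  finally have "2457 / 10000 * A \<le> 28011 / 1000 * m * B" .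
  moreover have "10000 * B \<le> m * B" by (rule mult_right_mono) (use m pos in auto)
  moreover have "0 \<le> m * B" using m pos by simp
  \<comment> \<open>Here 28.011 / 0.2457 is just above 114, and \<open>B\<close> itself is at most
    \<open>m * B / 10000\<close>.\<close>
  ultimately have "A + B \<le> 11402 / 100 * (m * B)" by (simp add: mult.commute)
  then have 4: "A + B \<le> 11402 / 100 * m * B" by (simp only: mult.assoc)
  have "999 / 1000 * m ^ 3 * N \<le> 9301 / 1000 * m * (9301 / 1000 * m * (11402 / 100 * m * B))"
  proof -
    have "9301 / 1000 * m * Z \<le> 9301 / 1000 * m * (9301 / 1000 * m * (A + B))"
      using 3 m by (intro mult_left_mono) auto
    moreover have "9301 / 1000 * m * (9301 / 1000 * m * (A + B)) \<le> 9301 / 1000 * m * (9301 / 1000 * m * (11402 / 100 * m * B))"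
      using 4 m by (intro mult_left_mono) auto
    ultimately show ?thesis using 1 2 by linarith
  qed
  also have "\<dots> = 9301 / 1000 * (9301 / 1000) * (11402 / 100) * B * m ^ 3" by (simp add: power3_eq_cube)
  finally have "999 / 1000 * N * m ^ 3 \<le> 9301 / 1000 * (9301 / 1000) * (11402 / 100) * B * m ^ 3" by (simp add: mult_ac)
  then have 5: "999 / 1000 * N \<le> 9301 / 1000 * (9301 / 1000) * (11402 / 100) * B"
    using m by (simp add: mult_le_cancel_right)
  have "real (card threes) \<le> real (18 * (\<Sum>L\<in>LS. card (subsquares n 3 L)))"
    using threes_le by (simp only: of_nat_le_iff)
  then have "B \<le> 18 * X" by (simp add: B_def X_def)
  \<comment> \<open>The product 18 * 9.301^2 * 114.02 / 0.999 is about 177700, so there is room to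
    spare.\<close>
  then have "N \<le> 219006 * X" using 5 pos by simp
  then have "1 / 219006 \<le> X / N" using N0 by (simp add: field_simps)
  then show ?thesis by (simp add: expected_subsquares_eq_average X_def N_def)
qed

end

theorem theorem1p4:
  shows "\<exists>e :: nat \<Rightarrow> real. e \<in> o(\<lambda>_. 1) \<and>
    (\<forall>\<^sub>F n in sequentially. expected_subsquares 3 n \<ge> 1 / 219006 - e n)"
\<comment> \<open>The slack in the constants absorbs all lower-order errors, so the error function
  can be zero.\<close>
proof (intro exI[of _ "\<lambda>_. 0"] conjI)
  show "\<forall>\<^sub>F n in sequentially. expected_subsquares 3 n \<ge> 1 / 219006 - 0"
    using eventually_large by eventually_elim (use latin.subsquares_lower in simp)
qed simp

end
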